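(* Let $N\ge 3$, and let $\pi:U_q(\mathfrak{sl}_N[u])\to U_q(\mathfrak{sl}_N)$ be the canonical projection sending all the affine generators to zero. Let $\Psi\in U_q(\mathfrak{sl}_N[u])\otimes U_q(\hat{\mathfrak{sl}}_N)$ be invertible and such that $$\Psi=\Psi_1\Psi_2,\qquad \Psi_2:=(\pi\otimes\mathrm{id})(\Psi).$$ Suppose that $\Psi_2$ is a twist and that the following two relations hold: $$\Psi_1^{23}\Psi_2^{12}=\Psi_2^{12}\Psi_1^{23},\qquad (\pi\otimes\mathrm{id}\otimes\mathrm{id})(\Delta\otimes\mathrm{id})(\Psi_1)=\Psi_1^{23}.$$ Finally, suppose that there exists an invertible element $\omega\in U_q(\mathfrak{sl}_N[u])[[\zeta]]$ such that $$\Psi_\omega:=(\omega\otimes\omega)\,\Psi\,\Delta(\omega^{-1})\in U_q(\mathfrak{sl}_N)\otimes U_q(\hat{\mathfrak{sl}}_N).$$ Then $\Psi$ is a twist.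
   Context: All algebras are unital associative algebras over $\mathbb{C}[[\log q]]$, and $\zeta$ is a formal parameter. Tensor products are understood to be suitably completed and, where $\zeta$ occurs, extended by formal power series in $\zeta$; all maps are extended $\zeta$-linearly. $U_q(\hat{\mathfrak{sl}}_N)$ is the quantum affine algebra (zero central charge, no derivation) with Chevalley generators $e_i,f_i,q^{\pm h_i}$, $i=0,1,\dots,N-1$, with $h_0=-(h_1+\dots+h_{N-1})$, subject to the standard quantum affine $\mathfrak{sl}_N$ relations. It is a Hopf algebra with coproduct $\Delta$ given by $\Delta(q^{\pm h_i})=q^{\pm h_i}\otimes q^{\pm h_i}$, $\Delta(e_i)=e_i\otimes 1+q^{-h_i}\otimes e_i$, $\Delta(f_i)=f_i\otimes q^{h_i}+1\otimes f_i$. $U_q(\mathfrak{sl}_N)$ is the Hopf subalgebra generated by $e_i,f_i,q^{\pm h_i}$ with $1\le i\le N-1$. $U_q(\mathfrak{sl}_N[u])$ is the Hopf subalgebra generated by $U_q(\mathfrak{sl}_N)$ and the affine generator $e_0$ (also denoted $e_{N1}^{(1)}$, a $q$-analogue of $u\,e_{N1}$). $\pi:U_q(\mathfrak{sl}_N[u])\to U_q(\mathfrak{sl}_N)$ is the Hopf algebra homomorphism which is the identity on $U_q(\mathfrak{sl}_N)$ and satisfies $\pi(e_0)=0$. Superscripts on tensors denote the positions of the tensor factors in a triple tensor product, e.g. $F^{12}=F\otimes 1$, $F^{23}=1\otimes F$. A twist is an invertible element $F$ satisfying the cocycle equation $F^{12}(\Delta\otimes\mathrm{id})(F)=F^{23}(\mathrm{id}\otimes\Delta)(F)$.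 *)

theory Defs
  imports
    "HOL-Analysis.Elementary_Topology"
    "HOL-Algebra.QuotRing"
    "HOL-Library.Poly_Mapping"
    "HOL-Library.Product_Plus"
    "HOL-Computational_Algebra.Formal_Power_Series"
begin

section \<open>Free topological algebras over formal power series\<close>

text \<open>
  The ground ring \<open>\<complex>[[log q]]\<close> is \<^typ>\<open>complex fps\<close>, with \<open>\<hbar> = log q\<close> as the
  variable, so that \<open>q = exp \<hbar>\<close> is \<open>fps_exp 1\<close>.  Words form a monoid under concatenation,
  pairs of words under componentwise concatenation.  For such a monoid \<open>'w\<close> the type below is
  the \<open>\<hbar>\<close>-adic completion \<open>\<complex>['w][[\<hbar>]]\<close> of its monoid algebra over \<open>\<complex>[[\<hbar>]]\<close>;
  its multiplication is the one of the type class ring, and the metric topology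
  provided by the library for formal power series is the \<open>\<hbar>\<close>-adic one.  The completed tensor
  product of two such algebras is the algebra of the product monoid.
\<close>

instantiation list :: (type) monoid_add
begin

definition zero_list :: "'a list" where "zero_list = []"

definition plus_list :: "'a list \<Rightarrow> 'a list \<Rightarrow> 'a list" where "plus_list xs ys = xs @ ys"

instance
  by standard (simp_all add: zero_list_def plus_list_def)

end

type_synonym 'w alg = "('w \<Rightarrow>\<^sub>0 complex) fps"

definition mon :: "'w \<Rightarrow> 'w alg" where
  "mon w = fps_const (Poly_Mapping.single w 1)"

definition scal :: "complex fps \<Rightarrow> 'w::monoid_add alg" where
  "scal c = Abs_fps (\<lambda>n. Poly_Mapping.single 0 (fps_nth c n))"

text \<open>The continuous \<open>\<complex>[[\<hbar>]]\<close>-linear map with prescribed values on words.\<close>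

definition lin :: "('w \<Rightarrow> 'v::monoid_add alg) \<Rightarrow> 'w alg \<Rightarrow> 'v alg" where
  "lin \<phi> x = Abs_fps (\<lambda>n. \<Sum>k\<le>n. \<Sum>w\<in>Poly_Mapping.keys (fps_nth x k).
      Poly_Mapping.single 0 (Poly_Mapping.lookup (fps_nth x k) w) * fps_nth (\<phi> w) (n - k))"

definition tensor :: "'v::monoid_add alg \<Rightarrow> 'w::monoid_add alg \<Rightarrow> ('v \<times> 'w) alg"
    (infixr \<open>\<boxtimes>\<close> 75) where
  "x \<boxtimes> y = lin (\<lambda>u. lin (\<lambda>v. mon (u, v)) y) x"

text \<open>The completed tensor product \<open>f \<otimes> g\<close> of continuous linear maps, and the identification
  of \<open>(A \<otimes> B) \<otimes> C\<close> with \<open>A \<otimes> (B \<otimes> C)\<close>.\<close>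

definition tensor_map ::
    "('v alg \<Rightarrow> 'a::monoid_add alg) \<Rightarrow> ('w alg \<Rightarrow> 'b::monoid_add alg)
      \<Rightarrow> ('v \<times> 'w) alg \<Rightarrow> ('a \<times> 'b) alg" where
  "tensor_map f g = lin (\<lambda>(u, v). f (mon u) \<boxtimes> g (mon v))"

definition reassoc ::
    "(('u::monoid_add \<times> 'v::monoid_add) \<times> 'w::monoid_add) alg \<Rightarrow> ('u \<times> 'v \<times> 'w) alg" where
  "reassoc = lin (\<lambda>((u, v), w). mon (u, v, w))"

text \<open>\<open>exp (\<hbar> x) = \<Sum>\<^sub>k \<hbar>^k x^k / k!\<close>, that is \<open>q^x\<close>.\<close>

definition qexp :: "'w::monoid_add alg \<Rightarrow> 'w alg" where
  "qexp x = Abs_fps (\<lambda>n. \<Sum>k\<le>n. Poly_Mapping.single 0 (1 / fact k) * fps_nth (x ^ k) (n - k))"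

text \<open>\<open>(q^x - q^(-x)) / (q - q^(-1))\<close>.  Numerator and denominator are both divided by \<open>\<hbar>\<close>
  (\<open>fps_shift 1\<close>), after which the denominator is invertible in \<open>\<complex>[[\<hbar>]]\<close>.\<close>

definition qbracket :: "'w::monoid_add alg \<Rightarrow> 'w alg" where
  "qbracket x = scal (inverse (fps_shift 1 (fps_exp 1 - fps_exp (-1))))
                  * fps_shift 1 (qexp x - qexp (- x))"

definition supported_on :: "'w set \<Rightarrow> 'w alg set" where
  "supported_on W = {x. \<forall>n. Poly_Mapping.keys (fps_nth x n) \<subseteq> W}"

definition free_alg :: "'w::monoid_add set \<Rightarrow> 'w alg ring" where
  "free_alg W = \<lparr>carrier = supported_on W, monoid.mult = (*), one = 1, zero = 0, add = (+)\<rparr>"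

text \<open>If \<open>I\<close> and \<open>J\<close> are closed ideals of \<open>A = free_alg V\<close> and \<open>B = free_alg W\<close>, the
  completed tensor product of \<open>A / I\<close> and \<open>B / J\<close> is the quotient of \<open>free_alg (V \<times> W)\<close> by the
  closure of \<open>I \<otimes> B + A \<otimes> J\<close>, which is the following closed ideal.\<close>

definition tensor_ideal ::
    "'v::monoid_add set \<Rightarrow> 'v alg set \<Rightarrow> 'w::monoid_add set \<Rightarrow> 'w alg set \<Rightarrow> ('v \<times> 'w) alg set" where
  "tensor_ideal V I W J =
     closure (Idl\<^bsub>free_alg (V \<times> W)\<^esub> ((\<lambda>x. x \<boxtimes> 1) ` I \<union> (\<lambda>y. 1 \<boxtimes> y) ` J))"

text \<open>The image in \<open>A / I\<close> of the elements supported on \<open>S\<close>, and the map from this image to a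
  quotient \<open>B / J\<close> induced by a map \<open>f\<close> between the free algebras.  In the latter only
  representatives supported on \<open>S\<close> are used.\<close>

definition classes_on :: "'w::monoid_add set \<Rightarrow> 'w alg set \<Rightarrow> 'w set \<Rightarrow> 'w alg set set" where
  "classes_on W I S = (\<lambda>x. I +>\<^bsub>free_alg W\<^esub> x) ` supported_on S"

definition induced ::
    "'w set \<Rightarrow> 'v::monoid_add set \<Rightarrow> 'v alg set \<Rightarrow> ('w alg \<Rightarrow> 'v alg) \<Rightarrow> 'w alg set \<Rightarrow> 'v alg set" where
  "induced S V J f X = (\<Union>x \<in> X \<inter> supported_on S. J +>\<^bsub>free_alg V\<^esub> f x)"

definition restrict_carrier :: "'a ring \<Rightarrow> 'a set \<Rightarrow> 'a ring" where
  "restrict_carrier R S = R\<lparr>carrier := S\<rparr>"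


section \<open>The quantum affine algebra\<close>

text \<open>The algebra is topologically generated by \<open>e\<^sub>i\<close>, \<open>f\<^sub>i\<close> (\<open>0 \<le> i < N\<close>) and \<open>h\<^sub>i\<close>
  (\<open>1 \<le> i < N\<close>); \<open>q^(\<plusminus>h\<^sub>i)\<close> is \<open>exp (\<plusminus>\<hbar> h\<^sub>i)\<close>, and \<open>h\<^sub>0\<close> is the element
  \<open>- (h\<^sub>1 + \<dots> + h\<^sub>N\<^sub>-\<^sub>1)\<close>.\<close>

datatype gen = Gen_e nat | Gen_f nat | Gen_h nat

type_synonym word = "gen list"
type_synonym alg1 = "word alg"
type_synonym alg2 = "(word \<times> word) alg"
type_synonym alg3 = "(word \<times> word \<times> word) alg"

definition e_gen :: "nat \<Rightarrow> alg1" where "e_gen i = mon [Gen_e i]"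
definition f_gen :: "nat \<Rightarrow> alg1" where "f_gen i = mon [Gen_f i]"
definition h_gen :: "nat \<Rightarrow> nat \<Rightarrow> alg1" where
  "h_gen N i = (if i = 0 then - (\<Sum>j=1..<N. mon [Gen_h j]) else mon [Gen_h i])"

definition fin_gens :: "nat \<Rightarrow> gen set" where
  "fin_gens N = Gen_e ` {1..<N} \<union> Gen_f ` {1..<N} \<union> Gen_h ` {1..<N}"

definition cur_gens :: "nat \<Rightarrow> gen set" where
  "cur_gens N = insert (Gen_e 0) (fin_gens N)"

definition aff_gens :: "nat \<Rightarrow> gen set" where
  "aff_gens N = insert (Gen_f 0) (cur_gens N)"

text \<open>The Cartan matrix of type \<open>A\<^sub>N\<^sub>-\<^sub>1\<^sup>(\<^sup>1\<^sup>)\<close> for \<open>N \<ge> 3\<close>.\<close>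

definition cartan :: "nat \<Rightarrow> nat \<Rightarrow> nat \<Rightarrow> int" where
  "cartan N i j = (if i = j then 2 else if j = Suc i mod N \<or> i = Suc j mod N then -1 else 0)"

definition commutator :: "'a::ring \<Rightarrow> 'a \<Rightarrow> 'a" where
  "commutator x y = x * y - y * x"

definition serre :: "alg1 \<Rightarrow> alg1 \<Rightarrow> alg1" where
  "serre x y = x\<^sup>2 * y - scal (fps_exp 1 + fps_exp (-1)) * (x * y * x) + y * x\<^sup>2"

definition relations :: "nat \<Rightarrow> alg1 set" where
  "relations N =
     {commutator (h_gen N i) (h_gen N j) | i j. i < N \<and> j < N}
   \<union> {commutator (h_gen N i) (e_gen j) - of_int (cartan N i j) * e_gen j | i j. i < N \<and> j < N}
   \<union> {commutator (h_gen N i) (f_gen j) + of_int (cartan N i j) * f_gen j | i j. i < N \<and> j < N}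
   \<union> {commutator (e_gen i) (f_gen i) - qbracket (h_gen N i) | i. i < N}
   \<union> {commutator (e_gen i) (f_gen j) | i j. i < N \<and> j < N \<and> i \<noteq> j}
   \<union> {commutator (e_gen i) (e_gen j) | i j. i < N \<and> j < N \<and> cartan N i j = 0}
   \<union> {commutator (f_gen i) (f_gen j) | i j. i < N \<and> j < N \<and> cartan N i j = 0}
   \<union> {serre (e_gen i) (e_gen j) | i j. i < N \<and> j < N \<and> cartan N i j = -1}
   \<union> {serre (f_gen i) (f_gen j) | i j. i < N \<and> j < N \<and> cartan N i j = -1}"

definition W1 :: "nat \<Rightarrow> word set" where "W1 N = lists (aff_gens N)"
definition W2 :: "nat \<Rightarrow> (word \<times> word) set" where "W2 N = W1 N \<times> W1 N"
definition W3 :: "nat \<Rightarrow> (word \<times> word \<times> word) set" where "W3 N = W1 N \<times> W2 N"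

definition I1 :: "nat \<Rightarrow> alg1 set" where
  "I1 N = closure (Idl\<^bsub>free_alg (W1 N)\<^esub> (relations N))"
definition I2 :: "nat \<Rightarrow> alg2 set" where
  "I2 N = tensor_ideal (W1 N) (I1 N) (W1 N) (I1 N)"
definition I3 :: "nat \<Rightarrow> alg3 set" where
  "I3 N = tensor_ideal (W1 N) (I1 N) (W2 N) (I2 N)"

text \<open>The quantum affine algebra \<open>U\<close> and its completed tensor powers \<open>U \<otimes> U\<close>, \<open>U \<otimes> U \<otimes> U\<close>.\<close>

definition U1 :: "nat \<Rightarrow> alg1 set ring" where "U1 N = free_alg (W1 N) Quot I1 N"
definition U2 :: "nat \<Rightarrow> alg2 set ring" where "U2 N = free_alg (W2 N) Quot I2 N"
definition U3 :: "nat \<Rightarrow> alg3 set ring" where "U3 N = free_alg (W3 N) Quot I3 N"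

text \<open>\<open>U\<^sub>q(sl\<^sub>N[u])\<close>, \<open>U\<^sub>q(sl\<^sub>N[u]) \<otimes> U\<close> and \<open>U\<^sub>q(sl\<^sub>N) \<otimes> U\<close>, as subalgebras of \<open>U\<close>
  and of \<open>U \<otimes> U\<close>.\<close>

definition U_cur :: "nat \<Rightarrow> alg1 set ring" where
  "U_cur N = restrict_carrier (U1 N) (classes_on (W1 N) (I1 N) (lists (cur_gens N)))"

definition U_cur_aff :: "nat \<Rightarrow> alg2 set ring" where
  "U_cur_aff N = restrict_carrier (U2 N) (classes_on (W2 N) (I2 N) (lists (cur_gens N) \<times> W1 N))"

definition U_fin_aff :: "nat \<Rightarrow> alg2 set ring" where
  "U_fin_aff N = restrict_carrier (U2 N) (classes_on (W2 N) (I2 N) (lists (fin_gens N) \<times> W1 N))"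


section \<open>Coproduct and projection\<close>

text \<open>Each map is defined first on the free algebra, as the continuous homomorphism with the
  given values on generators, and then on the quotients.  The condition
  \<open>\<Delta>(h\<^sub>i) = h\<^sub>i \<otimes> 1 + 1 \<otimes> h\<^sub>i\<close> expresses \<open>\<Delta>(q^(\<plusminus>h\<^sub>i)) = q^(\<plusminus>h\<^sub>i) \<otimes> q^(\<plusminus>h\<^sub>i)\<close>.\<close>

fun coprod_gen :: "nat \<Rightarrow> gen \<Rightarrow> alg2" where
  "coprod_gen N (Gen_e i) = e_gen i \<boxtimes> 1 + qexp (- h_gen N i) \<boxtimes> e_gen i"
| "coprod_gen N (Gen_f i) = f_gen i \<boxtimes> qexp (h_gen N i) + 1 \<boxtimes> f_gen i"
| "coprod_gen N (Gen_h i) = mon [Gen_h i] \<boxtimes> 1 + 1 \<boxtimes> mon [Gen_h i]"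

definition coprod_free :: "nat \<Rightarrow> alg1 \<Rightarrow> alg2" where
  "coprod_free N = lin (\<lambda>w. prod_list (map (coprod_gen N) w))"

definition proj_gen :: "gen \<Rightarrow> alg1" where
  "proj_gen g = (if g = Gen_e 0 then 0 else mon [g])"

definition proj_free :: "alg1 \<Rightarrow> alg1" where
  "proj_free = lin (\<lambda>w. prod_list (map proj_gen w))"

text \<open>\<open>\<Delta>\<close>, \<open>\<Delta> \<otimes> id\<close>, \<open>id \<otimes> \<Delta>\<close>; and \<open>\<pi> \<otimes> id\<close> on \<open>U\<^sub>q(sl\<^sub>N[u]) \<otimes> U\<close>,
  \<open>\<pi> \<otimes> id \<otimes> id\<close> on \<open>U\<^sub>q(sl\<^sub>N[u]) \<otimes> U \<otimes> U\<close>.\<close>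

definition coprod :: "nat \<Rightarrow> alg1 set \<Rightarrow> alg2 set" where
  "coprod N = induced (W1 N) (W2 N) (I2 N) (coprod_free N)"

definition coprod_id :: "nat \<Rightarrow> alg2 set \<Rightarrow> alg3 set" where
  "coprod_id N = induced (W2 N) (W3 N) (I3 N) (\<lambda>x. reassoc (tensor_map (coprod_free N) id x))"

definition id_coprod :: "nat \<Rightarrow> alg2 set \<Rightarrow> alg3 set" where
  "id_coprod N = induced (W2 N) (W3 N) (I3 N) (tensor_map id (coprod_free N))"

definition proj_id :: "nat \<Rightarrow> alg2 set \<Rightarrow> alg2 set" where
  "proj_id N = induced (lists (cur_gens N) \<times> W1 N) (W2 N) (I2 N) (tensor_map proj_free id)"

definition proj_id_id :: "nat \<Rightarrow> alg3 set \<Rightarrow> alg3 set" where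
  "proj_id_id N = induced (lists (cur_gens N) \<times> W2 N) (W3 N) (I3 N) (tensor_map proj_free id)"

text \<open>\<open>F \<mapsto> F\<^sup>1\<^sup>2 = F \<otimes> 1\<close> and \<open>F \<mapsto> F\<^sup>2\<^sup>3 = 1 \<otimes> F\<close>.\<close>

definition leg12 :: "nat \<Rightarrow> alg2 set \<Rightarrow> alg3 set" where
  "leg12 N = induced (W2 N) (W3 N) (I3 N) (\<lambda>x. reassoc (x \<boxtimes> (1 :: alg1)))"

definition leg23 :: "nat \<Rightarrow> alg2 set \<Rightarrow> alg3 set" where
  "leg23 N = induced (W2 N) (W3 N) (I3 N) (\<lambda>x. (1 :: alg1) \<boxtimes> x)"

definition is_twist :: "nat \<Rightarrow> alg2 set \<Rightarrow> bool" where
  "is_twist N X \<longleftrightarrow> X \<in> Units (U2 N) \<and>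
     leg12 N X \<otimes>\<^bsub>U3 N\<^esub> coprod_id N X = leg23 N X \<otimes>\<^bsub>U3 N\<^esub> id_coprod N X"


section \<open>Extension by power series in \<open>\<zeta>\<close>\<close>

text \<open>A power series in \<open>\<zeta>\<close> is its sequence of coefficients; maps are applied
  coefficientwise, \<open>\<zeta>\<close> being central.\<close>

definition zeta_ring :: "'a ring \<Rightarrow> (nat \<Rightarrow> 'a) ring" where
  "zeta_ring R = \<lparr>carrier = {a. \<forall>n. a n \<in> carrier R},
     monoid.mult = (\<lambda>a b n. \<Oplus>\<^bsub>R\<^esub>k\<in>{..n}. a k \<otimes>\<^bsub>R\<^esub> b (n - k)),
     one = (\<lambda>n. if n = 0 then \<one>\<^bsub>R\<^esub> else \<zero>\<^bsub>R\<^esub>),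
     zero = (\<lambda>n. \<zero>\<^bsub>R\<^esub>),
     add = (\<lambda>a b n. a n \<oplus>\<^bsub>R\<^esub> b n)\<rparr>"

definition zeta_const :: "'a ring \<Rightarrow> 'a \<Rightarrow> nat \<Rightarrow> 'a" where
  "zeta_const R x = (\<lambda>n. if n = 0 then x else \<zero>\<^bsub>R\<^esub>)"

definition class_tensor :: "nat \<Rightarrow> alg1 set \<Rightarrow> alg1 set \<Rightarrow> alg2 set" where
  "class_tensor N X Y = (\<Union>x\<in>X. \<Union>y\<in>Y. I2 N +>\<^bsub>free_alg (W2 N)\<^esub> (x \<boxtimes> y))"

definition zeta_tensor ::
    "nat \<Rightarrow> (nat \<Rightarrow> alg1 set) \<Rightarrow> (nat \<Rightarrow> alg1 set) \<Rightarrow> nat \<Rightarrow> alg2 set" where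
  "zeta_tensor N a b = (\<lambda>n. \<Oplus>\<^bsub>U2 N\<^esub>k\<in>{..n}. class_tensor N (a k) (b (n - k)))"

definition zeta_coprod :: "nat \<Rightarrow> (nat \<Rightarrow> alg1 set) \<Rightarrow> nat \<Rightarrow> alg2 set" where
  "zeta_coprod N a = (\<lambda>n. coprod N (a n))"

text \<open>\<open>(\<omega> \<otimes> \<omega>) X \<Delta>(\<omega>\<^sup>-\<^sup>1)\<close>, for \<open>\<omega>\<close> invertible in \<open>U\<^sub>q(sl\<^sub>N[u])[[\<zeta>]]\<close>.\<close>

definition gauge :: "nat \<Rightarrow> (nat \<Rightarrow> alg1 set) \<Rightarrow> alg2 set \<Rightarrow> nat \<Rightarrow> alg2 set" where
  "gauge N \<omega> X =
     zeta_tensor N \<omega> \<omega> \<otimes>\<^bsub>zeta_ring (U2 N)\<^esub> zeta_const (U2 N) X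
       \<otimes>\<^bsub>zeta_ring (U2 N)\<^esub> zeta_coprod N (inv\<^bsub>zeta_ring (U_cur N)\<^esub> \<omega>)"

end

theory Submission
  imports Defs "HOL-Analysis.Elementary_Metric_Spaces"
begin

text \<open>
  Put \<open>L = \<Psi>\<^sup>1\<^sup>2 (\<Delta> \<otimes> id)(\<Psi>)\<close> and \<open>R = \<Psi>\<^sup>2\<^sup>3 (id \<otimes> \<Delta>)(\<Psi>)\<close>.  The two relations for
  \<open>\<Psi>\<^sub>1\<close> and the cocycle equation for \<open>\<Psi>\<^sub>2\<close> give \<open>(\<pi> \<otimes> id \<otimes> id)(L) = (\<pi> \<otimes> id \<otimes> id)(R)\<close>.
  Replacing \<open>\<Psi>\<close> by \<open>\<Psi>\<^sub>\<omega>\<close> multiplies both \<open>L\<close> and \<open>R\<close> by \<open>\<omega> \<otimes> \<omega> \<otimes> \<omega>\<close> on the left and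
  by the iterated coproduct of the inverse of \<open>\<omega>\<close> on the right.  The results lie in
  \<open>U\<^sub>q(sl\<^sub>N) \<otimes> U \<otimes> U\<close>, where \<open>\<pi> \<otimes> id \<otimes> id\<close> is the identity, so they coincide, and \<open>L = R\<close>.

  The computation takes place on representatives, because on the free algebras all maps are
  everywhere defined homomorphisms and the coproduct is coassociative on the nose.  That the
  coproduct descends to the quotients is checked on the defining relations.  For \<open>\<pi>\<close> no such
  check is possible, as \<open>U\<^sub>q(sl\<^sub>N[u])\<close> is only given as a subalgebra; but if
  \<open>\<pi> \<otimes> id \<otimes> id\<close> maps a single element to a residue class, then it is well defined.
\<close>

section \<open>Linear maps and homomorphisms of free topological algebras\<close>

text \<open>In \<open>\<Psi>\<^sub>\<omega>\<^sup>1\<^sup>2 (\<Delta> \<otimes>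
  id)(\<Psi>\<^sub>\<omega>)\<close> the inner factors \<Delta>(\<omega>^-1) \<otimes> 1 and
  \<Delta>(\<omega>) \<otimes> 1 cancel; in the other product 1 \<otimes> \<Delta>(\<omega>^-1) and
  1 \<otimes> \<Delta>(\<omega>) do. Coassociativity makes the remaining right factors equal. Since
  \<omega> may involve \<open>e\<^sub>0\<close>, \<pi> need not fix the gauge factors, but it is
  multiplicative: it sends both gauged products to the same outer factors around the images of L and
  R, and these images agree. Two kinds of ideals occur. Congruences are multiplied most easily in
  the whole ring of series in all words, whereas \<pi> \<otimes> id \<otimes> id preserves a
  congruence only between elements whose first leg omits \<open>f\<^sub>0\<close>. Hence the
  repeated checks of supports. The well-definedness of \<pi> \<otimes> id \<otimes> id is extracted
  from the hypothesis on (\<Delta> \<otimes> id)(\<open>\<Psi>\<^sub>1\<close>): an induced map is a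
  union over representatives, and that hypothesis says that this union is one residue class. Adding
  an element of the ideal to a representative therefore changes the image by an element of the
  ideal.\<close>

abbreviation (input) keys where "keys \<equiv> Poly_Mapping.keys"
abbreviation (input) lookup where "lookup \<equiv> Poly_Mapping.lookup"
abbreviation (input) single where "single \<equiv> Poly_Mapping.single"

section \<open>Central scalars from the ground ring\<close>

lemma single_mult_commute: "single 0 (a::complex) * p = p * single (0::'w::monoid_add) a"
proof -
  have "p = (\<Sum>w\<in>keys p. single w (lookup p w))"
    by (rule poly_mapping_eqI) (simp add: lookup_sum lookup_single when_def in_keys_iff)
  moreover have "single 0 a * (\<Sum>w\<in>keys p. single w (lookup p w)) =
      (\<Sum>w\<in>keys p. single w (lookup p w)) * single 0 a"
    by (simp add: sum_distrib_left sum_distrib_right mult_single mult.commute)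
  ultimately show ?thesis by metis
qed

lemma scal_nth [simp]: "fps_nth (scal c) n = single 0 (fps_nth c n)"
  by (simp add: scal_def)

lemma scal_0 [simp]: "scal 0 = 0" by (simp add: fps_eq_iff)
lemma scal_1 [simp]: "scal 1 = 1" by (simp add: fps_eq_iff)
lemma scal_add: "scal (c + d) = scal c + scal d" by (simp add: fps_eq_iff single_add)
lemma scal_uminus: "scal (- c) = - scal c" by (simp add: fps_eq_iff single_uminus)

lemma scal_mult: "scal (c * d) = scal c * scal d"
proof -
  have "single (0::'a) (\<Sum>i\<in>A. f i) = (\<Sum>i\<in>A. single 0 (f i))" for f :: "nat \<Rightarrow> complex" and A
    by (induction A rule: infinite_finite_induct) (auto simp: single_add)
  then show ?thesis by (simp add: fps_eq_iff fps_mult_nth mult_single)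
qed

lemma scal_power: "scal (c ^ n) = scal c ^ n"
  by (induction n) (simp_all add: scal_mult)

lemma scal_of_nat: "scal (of_nat n) = of_nat n"
  by (induction n) (simp_all add: scal_add)

lemma scal_of_int: "scal (of_int n) = of_int n"
  by (cases n rule: int_cases2) (simp_all add: scal_of_nat scal_uminus)

lemma scal_fps_X: "scal fps_X = fps_X"
  by (simp add: fps_eq_iff)

lemma scal_commute: "scal c * x = x * scal c"
proof (rule fps_ext)
  fix n
  have "fps_nth (scal c * x) n = (\<Sum>i=0..n. fps_nth x (n - i) * single 0 (fps_nth c i))"
    by (simp add: fps_mult_nth single_mult_commute)
  also have "\<dots> = (\<Sum>i=0..n. fps_nth x i * single 0 (fps_nth c (n - i)))"
    by (subst sum.atLeastAtMost_rev) (auto intro!: sum.cong)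
  finally show "fps_nth (scal c * x) n = fps_nth (x * scal c) n"
    by (simp add: fps_mult_nth)
qed

lemma scal_left_commute: "x * (scal c * y) = scal c * (x * y)"
  by (metis scal_commute mult.assoc)

section \<open>Linear maps over the ground ring\<close>

definition alg_linear :: "('v::monoid_add alg \<Rightarrow> 'w::monoid_add alg) \<Rightarrow> bool" where
  "alg_linear f \<longleftrightarrow> (\<forall>x y. f (x + y) = f x + f y) \<and> (\<forall>c x. f (scal c * x) = scal c * f x)"

lemma hlinI:
  "(\<And>x y. f (x + y) = f x + f y) \<Longrightarrow> (\<And>c x. f (scal c * x) = scal c * f x) \<Longrightarrow> alg_linear f"
  by (simp add: alg_linear_def)

lemma
  assumes "alg_linear f"
  shows alg_linear_add: "f (x + y) = f x + f y"
    and alg_linear_scal: "f (scal c * x) = scal c * f x"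
    and alg_linear_0: "f 0 = 0"
    and alg_linear_uminus: "f (- x) = - f x"
    and alg_linear_diff: "f (x - y) = f x - f y"
    and alg_linear_sum: "f (sum g A) = (\<Sum>i\<in>A. f (g i))"
proof -
  show add: "f (x + y) = f x + f y" for x y using assms by (simp add: alg_linear_def)
  show "f (scal c * x) = scal c * f x" using assms by (simp add: alg_linear_def)
  show zero: "f 0 = 0" using add[of 0 0] by simp
  show minus: "f (- x) = - f x" for x using add[of x "- x"] zero by (simp add: eq_neg_iff_add_eq_0 add.commute)
  show "f (x - y) = f x - f y" using add[of x "- y"] minus by simp
  show "f (sum g A) = (\<Sum>i\<in>A. f (g i))"
    by (induction A rule: infinite_finite_induct) (simp_all add: add zero)
qed

lemma alg_linear_comp: "alg_linear f \<Longrightarrow> alg_linear g \<Longrightarrow> alg_linear (\<lambda>x. f (g x))"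
  by (simp add: alg_linear_def)

lemma alg_linear_id: "alg_linear id" "alg_linear (\<lambda>x. x)" by (simp_all add: alg_linear_def)

lemma alg_linear_plus: "alg_linear f \<Longrightarrow> alg_linear g \<Longrightarrow> alg_linear (\<lambda>x. f x + g x)"
  by (simp add: alg_linear_def algebra_simps)

lemma alg_linear_minus: "alg_linear f \<Longrightarrow> alg_linear g \<Longrightarrow> alg_linear (\<lambda>x. f x - g x)"
  by (simp add: alg_linear_def algebra_simps)

lemma alg_linear_mult_left: "alg_linear f \<Longrightarrow> alg_linear (\<lambda>x. a * f x)"
  by (simp add: alg_linear_def distrib_left scal_left_commute)

lemma alg_linear_mult_right: "alg_linear f \<Longrightarrow> alg_linear (\<lambda>x. f x * a)"
  by (simp add: alg_linear_def distrib_right mult.assoc)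

lemma const_eq_sum_mon: "fps_const p = (\<Sum>w\<in>keys p. scal (fps_const (lookup p w)) * mon w)"
proof -
  have s: "scal (fps_const c) = fps_const (single 0 c)" for c
    by (simp add: fps_eq_iff)
  have sc: "(\<Sum>w\<in>A. fps_const (f w)) = fps_const (\<Sum>w\<in>A. f w)" for f :: "'a \<Rightarrow> 'a \<Rightarrow>\<^sub>0 complex" and A
    by (simp add: fps_eq_iff fps_sum_nth)
  have "p = (\<Sum>w\<in>keys p. single w (lookup p w))"
    by (rule poly_mapping_eqI) (simp add: lookup_sum lookup_single when_def in_keys_iff)
  then show ?thesis
    by (simp add: mon_def s mult_single sc)
qed

lemma fps_split_const: "(x :: 'w::monoid_add alg) = fps_const (fps_nth x 0) + scal fps_X * fps_shift 1 x"
  by (rule fps_ext) (simp add: scal_fps_X)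

text \<open>Continuity comes for free, because a linear map commutes with multiplication by \<hbar>.
  Since \<open>d\<close> vanishes on constant series, \<open>d x\<close> is \<hbar> times the value
  of \<open>d\<close> on the shifted series, and its coefficients vanish one after another.\<close>

lemma alg_linear_zero_on_mon:
  assumes "alg_linear d" and "\<And>w. d (mon w) = 0"
  shows "d x = 0"
proof -
  have c: "d (fps_const p) = 0" for p
    by (subst const_eq_sum_mon) (simp add: alg_linear_sum[OF assms(1)] alg_linear_scal[OF assms(1)] assms(2))
  have step: "d x = scal fps_X * d (fps_shift 1 x)" for x
    using arg_cong[OF fps_split_const[of x], of d]
    by (simp add: alg_linear_add[OF assms(1)] alg_linear_scal[OF assms(1)] c)
  have "fps_nth (d x) n = 0" for n
    by (induction n arbitrary: x) (subst step, simp add: scal_fps_X)+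
  then show ?thesis by (simp add: fps_eq_iff)
qed

lemma alg_linear_ext:
  assumes "alg_linear f" "alg_linear g" and "\<And>w. f (mon w) = g (mon w)"
  shows "f x = g x"
proof -
  have "alg_linear (\<lambda>x. f x - g x)"
    using assms(1,2) by (rule alg_linear_minus)
  from alg_linear_zero_on_mon[OF this] assms(3) show ?thesis by simp
qed

text \<open>The coefficients of \<open>lin \<phi> x\<close> are convolutions of the finite linear
  combinations \<open>L\<close>, so compatibility with scalars is the associativity of the Cauchy
  product.\<close>

lemma alg_linear_lin [simp]: "alg_linear (lin \<phi>)"
proof -
  define L where "L p m = (\<Sum>w\<in>keys p. single 0 (lookup p w) * fps_nth (\<phi> w) m)" for p m
  have nth: "fps_nth (lin \<phi> x) n = (\<Sum>k=0..n. L (fps_nth x k) (n - k))" for x n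
    by (simp add: lin_def L_def atMost_atLeast0)
  have add: "L (p + q) m = L p m + L q m" for p q m
    unfolding L_def by (rule setsum_keys_plus_distrib) (simp_all add: single_add distrib_right)
  have zero: "L 0 m = 0" for m by (simp add: L_def)
  have L_sum: "L (\<Sum>i\<in>A. f i) m = (\<Sum>i\<in>A. L (f i) m)" for f :: "nat \<Rightarrow> _" and A m
    by (induction A rule: infinite_finite_induct) (simp_all add: add zero)
  have look: "lookup (single 0 a * p) w = a * lookup p w" for a p w
  proof -
    have "p = (\<Sum>w\<in>keys p. single w (lookup p w))"
      by (rule poly_mapping_eqI) (simp add: lookup_sum lookup_single when_def in_keys_iff)
    then have "single 0 a * p = (\<Sum>w\<in>keys p. single w (a * lookup p w))"
      by (metis (no_types, lifting) mult_single add_0 sum.cong sum_distrib_left)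
    then show ?thesis by (simp add: lookup_sum lookup_single when_def in_keys_iff)
  qed
  have scal: "L (single 0 a * p) m = single 0 a * L p m" for a p m
  \<comment> \<open>Multiplication by a constant leaves the set of keys unchanged only if the
    constant is nonzero.\<close>
  proof (cases "a = 0")
    case False
    then have "keys (single 0 a * p) = keys p" by (auto simp: in_keys_iff look)
    then show ?thesis
      by (simp add: L_def look sum_distrib_left mult_single flip: mult.assoc)
  qed (simp add: zero)
  show ?thesis
  proof (rule hlinI)
    show "lin \<phi> (x + y) = lin \<phi> x + lin \<phi> y" for x y
      by (rule fps_ext) (simp add: nth add sum.distrib)
    show "lin \<phi> (scal c * x) = scal c * lin \<phi> x" for c x
    proof (rule fps_ext)
      fix n
      have "fps_nth (lin \<phi> (scal c * x)) n =
          (\<Sum>j=0..n. \<Sum>i=0..j. single 0 (fps_nth c i) * L (fps_nth x (j - i)) (n - j))"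
        by (simp add: nth fps_mult_nth L_sum scal)
      also have "\<dots> = (\<Sum>j=0..n. \<Sum>i=0..n - j. single 0 (fps_nth c j) * L (fps_nth x i) (n - j - i))"
        by (rule fps_mult_assoc_lemma)
      also have "\<dots> = fps_nth (scal c * lin \<phi> x) n"
        by (simp add: fps_mult_nth nth sum_distrib_left)
      finally show "fps_nth (lin \<phi> (scal c * x)) n = fps_nth (scal c * lin \<phi> x) n" .
    qed
  qed
qed

lemma lin_mon [simp]: "lin \<phi> (mon w) = \<phi> w"
proof (rule fps_ext)
  fix n
  have "fps_nth (lin \<phi> (mon w)) n = (\<Sum>k\<le>n. if k = 0 then fps_nth (\<phi> w) n else 0)"
    unfolding lin_def mon_def fps_nth_Abs_fps by (rule sum.cong) auto
  also have "\<dots> = fps_nth (\<phi> w) n" by simp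
  finally show "fps_nth (lin \<phi> (mon w)) n = fps_nth (\<phi> w) n" .
qed

lemma alg_linear_eq_lin: "alg_linear f \<Longrightarrow> f x = lin (\<lambda>w. f (mon w)) x"
  by (rule alg_linear_ext) simp_all

lemma supported_onI: "(\<And>n. keys (fps_nth x n) \<subseteq> W) \<Longrightarrow> x \<in> supported_on W"
  by (simp add: supported_on_def)

lemma alg_linear_supported_on:
  assumes "alg_linear f" and "\<And>w. w \<in> S \<Longrightarrow> f (mon w) \<in> supported_on V" and "x \<in> supported_on S"
  shows "f x \<in> supported_on V"
proof (rule supported_onI)
  fix n
  have "keys (single 0 a * p) \<subseteq> keys p" for a and p :: "'b \<Rightarrow>\<^sub>0 complex"
    using keys_mult[of "single 0 a" p] by (auto split: if_splits)
  moreover have "keys (fps_nth (f (mon w)) m) \<subseteq> V" if "w \<in> keys (fps_nth x k)" for w m k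
    using assms(2,3) that by (force simp: supported_on_def)
  ultimately have "keys (single 0 a * fps_nth (f (mon w)) m) \<subseteq> V" if "w \<in> keys (fps_nth x k)" for w m k a
    using that by (meson order_trans)
  then have "xa \<in> V" if "w \<in> keys (fps_nth x k)" "xa \<in> keys (single 0 a * fps_nth (f (mon w)) m)"
    for w k a m xa
    using that by (meson subsetD)
  then show "keys (fps_nth (f x) n) \<subseteq> V"
    by (subst alg_linear_eq_lin[OF assms(1)]) (auto simp: lin_def dest!: subsetD[OF Poly_Mapping.keys_sum])
qed

text \<open>The difference of the two maps sends elements supported on \<open>S\<close> to elements
  supported on the empty set, and these are zero.\<close>

lemma alg_linear_cong_supported_on:
  assumes "alg_linear f" "alg_linear g" and "\<And>w. w \<in> S \<Longrightarrow> f (mon w) = g (mon w)" and "x \<in> supported_on S"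
  shows "f x = g x"
proof -
  have "alg_linear (\<lambda>x. f x - g x)"
    using assms(1,2) by (rule alg_linear_minus)
  from alg_linear_supported_on[OF this _ assms(4), of "{}"] have "f x - g x \<in> supported_on {}"
    using assms(3) by (simp add: supported_on_def)
  then show ?thesis by (simp add: supported_on_def fps_eq_iff)
qed

section \<open>Algebra homomorphisms\<close>

definition alg_hom :: "('v::monoid_add alg \<Rightarrow> 'w::monoid_add alg) \<Rightarrow> bool" where
  "alg_hom f \<longleftrightarrow> alg_linear f \<and> f 1 = 1 \<and> (\<forall>x y. f (x * y) = f x * f y)"

lemma
  assumes "alg_hom f"
  shows hom_alg_linear: "alg_linear f" and hom_1: "f 1 = 1" and hom_mult: "f (x * y) = f x * f y"
    and hom_power: "f (x ^ n) = f x ^ n" and hom_scal': "f (scal c) = scal c"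
    and hom_of_int: "f (of_int i) = of_int i"
proof -
  show 1: "alg_linear f" and 2: "f 1 = 1" and 3: "f (x * y) = f x * f y" for x y
    using assms by (simp_all add: alg_hom_def)
  show "f (x ^ n) = f x ^ n" by (induction n) (simp_all add: 2 3)
  show s: "f (scal c) = scal c" for c using alg_linear_scal[OF 1, of c 1] 2 by simp
  show "f (of_int i) = of_int i" using s[of "of_int i"] by (simp add: scal_of_int)
qed

lemmas hom_simps = hom_1 hom_mult hom_power hom_scal' hom_of_int
  alg_linear_add[OF hom_alg_linear] alg_linear_diff[OF hom_alg_linear] alg_linear_uminus[OF hom_alg_linear] alg_linear_0[OF hom_alg_linear]
  alg_linear_sum[OF hom_alg_linear]

lemma hom_comp: "alg_hom f \<Longrightarrow> alg_hom g \<Longrightarrow> alg_hom (\<lambda>x. f (g x))"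
  by (simp add: alg_hom_def alg_linear_comp)

lemma hom_id: "alg_hom id" "alg_hom (\<lambda>x. x)" by (simp_all add: alg_hom_def alg_linear_id)

lemma mon_0: "mon 0 = 1" by (simp add: mon_def)

lemma mon_add: "mon (u + v) = mon u * mon v"
  by (simp add: mon_def mult_single)

lemma hom_alg_linearI:
  assumes "alg_linear f" and "f (mon 0) = 1" and "\<And>u v. f (mon (u + v)) = f (mon u) * f (mon v)"
  shows "alg_hom f"
proof -
  have "f (x * y) = f x * f y" for x y
  proof (rule alg_linear_ext[of "\<lambda>x. f (x * y)" "\<lambda>x. f x * f y"])
    fix u
    show "f (mon u * y) = f (mon u) * f y"
    proof (rule alg_linear_ext[of "\<lambda>y. f (mon u * y)" "\<lambda>y. f (mon u) * f y"])
      show "f (mon u * mon v) = f (mon u) * f (mon v)" for v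
        using assms(3) by (simp add: mon_add)
    qed (use alg_linear_comp[OF assms(1) alg_linear_mult_left[OF alg_linear_id(2)]] assms(1) in \<open>simp_all add: alg_linear_mult_left\<close>)
  qed (use alg_linear_comp[OF assms(1) alg_linear_mult_right[OF alg_linear_id(2)]] assms(1) in \<open>simp_all add: alg_linear_mult_right\<close>)
  with assms show ?thesis by (simp add: alg_hom_def mon_0)
qed

lemma hom_lin:
  assumes "\<phi> 0 = 1" and "\<And>u v. \<phi> (u + v) = \<phi> u * \<phi> v"
  shows "alg_hom (lin \<phi>)"
  by (rule hom_alg_linearI) (simp_all add: assms)

lemma hom_lin_prod_list: "alg_hom (lin (\<lambda>w. prod_list (map \<phi> w)))"
  by (rule hom_lin) (simp_all add: zero_list_def plus_list_def)

lemma mon_Cons: "mon (g # w) = mon [g] * mon w"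
  using mon_add[of "[g]" w] by (simp add: plus_list_def)

lemma mon_Nil: "mon [] = 1" unfolding zero_list_def[symmetric] by (rule mon_0)

lemma hom_ext_list:
  assumes "alg_hom f" "alg_hom g" and "\<And>a. f (mon [a]) = g (mon [a])"
  shows "f x = g x"
proof (rule alg_linear_ext[OF hom_alg_linear[OF assms(1)] hom_alg_linear[OF assms(2)]])
  fix w
  show "f (mon w) = g (mon w)"
  proof (induction w)
    case Nil
    then show ?case using assms by (simp add: mon_Nil hom_1)
  next
    case (Cons a w)
    then show ?case using assms by (simp add: mon_Cons[of a w] hom_mult)
  qed
qed

subsection \<open>Tensor products\<close>

lemma mon_tensor_mon [simp]: "mon u \<boxtimes> mon v = mon (u, v)"
  by (simp add: tensor_def)

lemma alg_linear_tensor_left: "alg_linear (\<lambda>x. x \<boxtimes> y)"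
  by (simp add: tensor_def)

text \<open>By definition \<open>\<boxtimes>\<close> is linear in its left argument. Linearity on
  the right is clear when the left argument is a word, and extends from there.\<close>

lemma alg_linear_tensor_right: "alg_linear (\<lambda>y. x \<boxtimes> y)"
proof (rule hlinI)
  show "x \<boxtimes> (y + z) = x \<boxtimes> y + x \<boxtimes> z" for y z
    by (rule alg_linear_ext[where f = "\<lambda>x. x \<boxtimes> (y + z)" and g = "\<lambda>x. x \<boxtimes> y + x \<boxtimes> z"],
      rule alg_linear_tensor_left, rule alg_linear_plus, rule alg_linear_tensor_left, rule alg_linear_tensor_left,
      simp add: tensor_def alg_linear_add[OF alg_linear_lin])
  show "x \<boxtimes> (scal c * y) = scal c * (x \<boxtimes> y)" for c y
    by (rule alg_linear_ext[of "\<lambda>x. x \<boxtimes> (scal c * y)" "\<lambda>x. scal c * (x \<boxtimes> y)"])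
      (auto simp: alg_linear_tensor_left alg_linear_mult_left, auto simp: tensor_def alg_linear_scal[OF alg_linear_lin])
qed

lemma hom_tensor_left: "alg_hom (\<lambda>x. x \<boxtimes> 1)"
  by (rule hom_alg_linearI[OF alg_linear_tensor_left])
    (simp_all add: zero_prod_def flip: mon_0 mon_add)

lemma hom_tensor_right: "alg_hom (\<lambda>y. 1 \<boxtimes> y)"
  by (rule hom_alg_linearI[OF alg_linear_tensor_right])
    (simp_all add: zero_prod_def flip: mon_0 mon_add)

lemma alg_linear_ext2:
  assumes "\<And>y. alg_linear (\<lambda>x. f x y)" "\<And>y. alg_linear (\<lambda>x. g x y)" "\<And>x. alg_linear (f x)" "\<And>x. alg_linear (g x)"
    and "\<And>u v. f (mon u) (mon v) = g (mon u) (mon v)"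
  shows "f x y = g x y"
  by (rule alg_linear_ext[of "\<lambda>x. f x y" "\<lambda>x. g x y"], (rule assms)+, rule alg_linear_ext, (rule assms)+)

text \<open>Through this factorisation, products and congruences of pure tensors reduce to the two
  embeddings of the factors.\<close>

lemma tensor_eq_mult: "x \<boxtimes> y = (x \<boxtimes> 1) * (1 \<boxtimes> y)"
  by (rule alg_linear_ext2[of "\<lambda>x y. x \<boxtimes> y"])
    (simp_all add: alg_linear_tensor_left alg_linear_tensor_right alg_linear_mult_left alg_linear_mult_right
      flip: mon_0 mon_add)

lemma tensor_commute: "(1 \<boxtimes> y) * (x \<boxtimes> 1) = (x \<boxtimes> 1) * (1 \<boxtimes> y)"
  by (rule alg_linear_ext2[of "\<lambda>x y. (1 \<boxtimes> y) * (x \<boxtimes> 1)"])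
    (simp_all add: alg_linear_tensor_left alg_linear_tensor_right alg_linear_mult_left alg_linear_mult_right
      flip: mon_0 mon_add)

lemma one_tensor_one [simp]: "1 \<boxtimes> 1 = 1"
  by (simp add: hom_1[OF hom_tensor_left])

lemma tensor_mult_tensor: "(x \<boxtimes> y) * (x' \<boxtimes> y') = (x * x') \<boxtimes> (y * y')"
proof -
  have "(x \<boxtimes> y) * (x' \<boxtimes> y') = (x \<boxtimes> 1) * ((1 \<boxtimes> y) * (x' \<boxtimes> 1)) * (1 \<boxtimes> y')"
    by (simp only: tensor_eq_mult[of x y] tensor_eq_mult[of x' y'] mult.assoc)
  also have "\<dots> = ((x \<boxtimes> 1) * (x' \<boxtimes> 1)) * ((1 \<boxtimes> y) * (1 \<boxtimes> y'))"
    by (simp only: tensor_commute mult.assoc)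
  also have "\<dots> = (x * x') \<boxtimes> (y * y')"
    by (simp only: tensor_eq_mult[of "x * x'"] hom_mult[OF hom_tensor_left] hom_mult[OF hom_tensor_right])
  finally show ?thesis .
qed

lemma tensor_map_tensor [simp]:
  assumes "alg_linear f" "alg_linear g"
  shows "tensor_map f g (x \<boxtimes> y) = f x \<boxtimes> g y"
  by (rule alg_linear_ext2[of "\<lambda>x y. tensor_map f g (x \<boxtimes> y)" "\<lambda>x y. f x \<boxtimes> g y"])
    (simp_all add: alg_linear_comp[OF _ alg_linear_tensor_left] alg_linear_comp[OF _ alg_linear_tensor_right]
      alg_linear_comp[OF alg_linear_tensor_left] alg_linear_comp[OF alg_linear_tensor_right] assms tensor_map_def)

lemma hom_tensor_map:
  assumes "alg_hom f" "alg_hom g"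
  shows "alg_hom (tensor_map f g)"
  unfolding tensor_map_def
proof (rule hom_lin)
  show "(case 0 of (u, v) \<Rightarrow> f (mon u) \<boxtimes> g (mon v)) = 1"
    by (simp add: zero_prod_def mon_0 assms hom_1)
  show "(case p + q of (u, v) \<Rightarrow> f (mon u) \<boxtimes> g (mon v)) =
      (case p of (u, v) \<Rightarrow> f (mon u) \<boxtimes> g (mon v)) * (case q of (u, v) \<Rightarrow> f (mon u) \<boxtimes> g (mon v))" for p q
    by (cases p; cases q) (simp add: mon_add tensor_mult_tensor assms hom_mult)
qed

lemma hom_reassoc: "alg_hom reassoc"
  unfolding reassoc_def
  by (rule hom_lin) (auto simp: zero_prod_def mon_0 case_prod_unfold simp flip: mon_add mon_0)

lemma reassoc_tensor: "reassoc ((x \<boxtimes> y) \<boxtimes> z) = x \<boxtimes> y \<boxtimes> z"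
proof -
  have "reassoc ((x \<boxtimes> mon v) \<boxtimes> mon w) = x \<boxtimes> mon v \<boxtimes> mon w" for v w
    by (rule alg_linear_ext[OF alg_linear_comp[OF hom_alg_linear[OF hom_reassoc] alg_linear_comp[OF alg_linear_tensor_left alg_linear_tensor_left]] alg_linear_tensor_left])
      (simp add: reassoc_def)
  note * = this
  note r = alg_linear_comp[OF hom_alg_linear[OF hom_reassoc]]
  show ?thesis
    by (rule alg_linear_ext2[where f = "\<lambda>y z. reassoc ((x \<boxtimes> y) \<boxtimes> z)" and g = "\<lambda>y z. x \<boxtimes> y \<boxtimes> z"])
      (rule r alg_linear_comp[OF alg_linear_tensor_left alg_linear_tensor_right] alg_linear_tensor_right
        alg_linear_comp[OF alg_linear_tensor_right alg_linear_tensor_left]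
        alg_linear_comp[OF alg_linear_tensor_right alg_linear_tensor_right] *)+
qed

lemma hom_ext_prod:
  assumes "alg_hom f" "alg_hom g" and "\<And>x. f (x \<boxtimes> 1) = g (x \<boxtimes> 1)" "\<And>y. f (1 \<boxtimes> y) = g (1 \<boxtimes> y)"
  shows "f z = g z"
proof (rule alg_linear_ext[OF hom_alg_linear[OF assms(1)] hom_alg_linear[OF assms(2)]])
  fix w :: "'a \<times> 'b"
  have "mon w = (mon (fst w) \<boxtimes> 1) * (1 \<boxtimes> mon (snd w))"
    by (simp flip: tensor_eq_mult)
  then show "f (mon w) = g (mon w)" using assms by (simp add: hom_mult)
qed

section \<open>Closed ideals\<close>

definition two_sided :: "'a::ring_1 set \<Rightarrow> bool" where
  "two_sided J \<longleftrightarrow> 0 \<in> J \<and> (\<forall>x\<in>J. \<forall>y\<in>J. x + y \<in> J) \<and> (\<forall>x\<in>J. \<forall>a. a * x \<in> J \<and> x * a \<in> J)"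

definition cong_mod :: "'a::ring_1 set \<Rightarrow> 'a \<Rightarrow> 'a \<Rightarrow> bool" where
  "cong_mod J x y \<longleftrightarrow> x - y \<in> J"

lemma
  assumes "two_sided J"
  shows two_sided_0: "0 \<in> J"
    and two_sided_add: "x \<in> J \<Longrightarrow> y \<in> J \<Longrightarrow> x + y \<in> J"
    and two_sided_left: "x \<in> J \<Longrightarrow> a * x \<in> J"
    and two_sided_right: "x \<in> J \<Longrightarrow> x * a \<in> J"
    and two_sided_uminus: "x \<in> J \<Longrightarrow> - x \<in> J"
    and two_sided_diff: "x \<in> J \<Longrightarrow> y \<in> J \<Longrightarrow> x - y \<in> J"
    and two_sided_sum: "(\<And>i. i \<in> A \<Longrightarrow> f i \<in> J) \<Longrightarrow> sum f A \<in> J"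
proof -
  show zero: "0 \<in> J" and add: "x \<in> J \<Longrightarrow> y \<in> J \<Longrightarrow> x + y \<in> J"
    and left: "x \<in> J \<Longrightarrow> a * x \<in> J" and "x \<in> J \<Longrightarrow> x * a \<in> J" for x y a
    using assms by (simp_all add: two_sided_def)
  show minus: "x \<in> J \<Longrightarrow> - x \<in> J" for x using left[of x "-1"] by simp
  show "x \<in> J \<Longrightarrow> y \<in> J \<Longrightarrow> x - y \<in> J" using add[of x "- y"] minus[of y] by simp
  show "(\<And>i. i \<in> A \<Longrightarrow> f i \<in> J) \<Longrightarrow> sum f A \<in> J"
    by (induction A rule: infinite_finite_induct) (simp_all add: add zero)
qed

lemma
  assumes "two_sided J"
  shows cong_mod_refl: "cong_mod J x x"
    and cong_mod_sym: "cong_mod J x y \<Longrightarrow> cong_mod J y x"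
    and cong_mod_trans: "cong_mod J x y \<Longrightarrow> cong_mod J y z \<Longrightarrow> cong_mod J x z"
    and cong_mod_add: "cong_mod J x x' \<Longrightarrow> cong_mod J y y' \<Longrightarrow> cong_mod J (x + y) (x' + y')"
    and cong_mod_diff: "cong_mod J x x' \<Longrightarrow> cong_mod J y y' \<Longrightarrow> cong_mod J (x - y) (x' - y')"
    and cong_mod_mult: "cong_mod J x x' \<Longrightarrow> cong_mod J y y' \<Longrightarrow> cong_mod J (x * y) (x' * y')"
proof -
  note simps = two_sided_0[OF assms] two_sided_add[OF assms] two_sided_left[OF assms]
    two_sided_right[OF assms] two_sided_uminus[OF assms] two_sided_diff[OF assms]
  show "cong_mod J x x" by (simp add: cong_mod_def simps)
  show "cong_mod J x y \<Longrightarrow> cong_mod J y x" using simps(5)[of "x - y"] by (simp add: cong_mod_def)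
  show "cong_mod J x y \<Longrightarrow> cong_mod J y z \<Longrightarrow> cong_mod J x z" using simps(2)[of "x - y" "y - z"] by (simp add: cong_mod_def)
  show "cong_mod J x x' \<Longrightarrow> cong_mod J y y' \<Longrightarrow> cong_mod J (x + y) (x' + y')"
    using simps(2)[of "x - x'" "y - y'"] by (simp add: cong_mod_def algebra_simps)
  show "cong_mod J x x' \<Longrightarrow> cong_mod J y y' \<Longrightarrow> cong_mod J (x - y) (x' - y')"
    using simps(6)[of "x - x'" "y - y'"] by (simp add: cong_mod_def algebra_simps)
  show "cong_mod J x x' \<Longrightarrow> cong_mod J y y' \<Longrightarrow> cong_mod J (x * y) (x' * y')"
    using simps(2)[OF simps(4)[of "x - x'" y] simps(3)[of "y - y'" x']]
    by (simp add: cong_mod_def algebra_simps)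
qed

section \<open>Closedness in the \<hbar>-adic topology, expressed through truncations\<close>

definition hclosed :: "'w alg set \<Rightarrow> bool" where
  "hclosed J \<longleftrightarrow> (\<forall>x. (\<forall>n. \<exists>y\<in>J. \<forall>k<n. fps_nth x k = fps_nth y k) \<longrightarrow> x \<in> J)"

lemma hclosedD: "hclosed J \<Longrightarrow> (\<And>n. \<exists>y\<in>J. \<forall>k<n. fps_nth x k = fps_nth y k) \<Longrightarrow> x \<in> J"
  by (simp add: hclosed_def)

text \<open>The distance of two distinct series is 2 to the power minus the order of their
  difference, so small balls consist of the series with a common truncation.\<close>

lemma mem_closure_iff:
  "(x :: 'w alg) \<in> closure S \<longleftrightarrow> (\<forall>n. \<exists>y\<in>S. \<forall>k<n. fps_nth x k = fps_nth y k)"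
proof
  assume *: "x \<in> closure S"
  show "\<forall>n. \<exists>y\<in>S. \<forall>k<n. fps_nth x k = fps_nth y k"
  proof
    fix n
    obtain y where y: "y \<in> S" "dist y x < inverse (2 ^ n)"
      using * unfolding closure_approachable by (meson inverse_positive_iff_positive zero_less_numeral zero_less_power)
    have "fps_nth (y - x) k = 0" if "k < n" for k
    proof (cases "y = x")
      case False
      then have "n < subdegree (y - x)" using y(2) by (simp add: dist_fps_def)
      with that show ?thesis by (intro nth_less_subdegree_zero) simp
    qed simp
    then have "\<forall>k<n. fps_nth x k = fps_nth y k" by simp
    with y(1) show "\<exists>y\<in>S. \<forall>k<n. fps_nth x k = fps_nth y k" by blast
  qed
next
  assume *: "\<forall>n. \<exists>y\<in>S. \<forall>k<n. fps_nth x k = fps_nth y k"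
  show "x \<in> closure S"
    unfolding closure_approachable
  proof safe
    fix e :: real assume "e > 0"
    then obtain n where n: "inverse (2 ^ n) < e"
      using reals_power_lt_ex[of e 2] by (auto simp: inverse_eq_divide power_divide)
    obtain y where y: "y \<in> S" "\<forall>k<n. fps_nth x k = fps_nth y k" using * by blast
    have "dist y x < e"
    proof (cases "y = x")
      case False
      then have "n \<le> subdegree (y - x)" using y(2) by (intro subdegree_geI) auto
      then have "inverse (2 ^ subdegree (y - x)) \<le> inverse (2 ^ n :: real)" by (simp add: field_simps)
      with n have "inverse (2 ^ subdegree (y - x)) < e" by linarith
      with False show ?thesis by (simp only: dist_fps_def if_False)
    qed (use \<open>e > 0\<close> in simp)
    with y(1) show "\<exists>y\<in>S. dist y x < e" by blast
  qed
qed

lemma hclosed_closure: "hclosed (closure S)"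
  unfolding hclosed_def
proof (intro allI impI)
  fix x assume "\<forall>n. \<exists>y\<in>closure S. \<forall>k<n. fps_nth x k = fps_nth y k"
  then have "x \<in> closure (closure S)" by (rule iffD2[OF mem_closure_iff])
  then show "x \<in> closure S" by simp
qed

text \<open>Agreement below order \<open>n\<close> means that the difference is divisible by
  \<hbar>^n, which a linear map preserves.\<close>

lemma alg_linear_nth_cong:
  assumes "alg_linear f" and "\<forall>k<n. fps_nth x k = fps_nth y k"
  shows "\<forall>k<n. fps_nth (f x) k = fps_nth (f y) k"
proof -
  have "x - y = scal (fps_X ^ n) * fps_shift n (x - y)"
    by (rule fps_ext) (use assms(2) in \<open>simp add: scal_power scal_fps_X fps_X_power_mult_nth\<close>)
  then have "f x - f y = scal (fps_X ^ n) * f (fps_shift n (x - y))"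
    by (metis assms(1) alg_linear_diff alg_linear_scal)
  then have "fps_nth (f x - f y) k = 0" if "k < n" for k
    using that by (simp add: scal_power scal_fps_X fps_X_power_mult_nth)
  then show ?thesis by simp
qed

lemma hclosed_vimage: "alg_linear f \<Longrightarrow> hclosed J \<Longrightarrow> hclosed {x. f x \<in> J}"
  unfolding hclosed_def[of "{x. f x \<in> J}"]
proof (intro allI impI CollectI)
  fix x assume *: "alg_linear f" "hclosed J" and x: "\<forall>n. \<exists>y\<in>{x. f x \<in> J}. \<forall>k<n. fps_nth x k = fps_nth y k"
  show "f x \<in> J"
  proof (rule hclosedD[OF *(2)])
    fix n
    obtain y where "f y \<in> J" "\<forall>k<n. fps_nth x k = fps_nth y k" using x by blast
    then show "\<exists>y\<in>J. \<forall>k<n. fps_nth (f x) k = fps_nth y k"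
      using alg_linear_nth_cong[OF *(1)] by (intro bexI[of _ "f y"])
  qed
qed

lemma hclosed_Int:
  assumes "hclosed I" "hclosed J"
  shows "hclosed (I \<inter> J)"
  unfolding hclosed_def[of "I \<inter> J"]
proof (intro allI impI IntI)
  fix x assume x: "\<forall>n. \<exists>y\<in>I \<inter> J. \<forall>k<n. fps_nth x k = fps_nth y k"
  show "x \<in> I" by (rule hclosedD[OF assms(1)]) (use x in blast)
  show "x \<in> J" by (rule hclosedD[OF assms(2)]) (use x in blast)
qed

section \<open>Supports in submonoids of words\<close>

definition submon :: "'w::monoid_add set \<Rightarrow> bool" where
  "submon W \<longleftrightarrow> 0 \<in> W \<and> (\<forall>u\<in>W. \<forall>v\<in>W. u + v \<in> W)"

text \<open>Unlike a submonoid, a face also contains the factors of its elements. This is what makes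
  the map that kills all words outside \<open>W\<close> multiplicative; the words over a given
  alphabet are the main example.\<close>

definition face :: "'w::monoid_add set \<Rightarrow> bool" where
  "face W \<longleftrightarrow> 0 \<in> W \<and> (\<forall>u v. u + v \<in> W \<longleftrightarrow> u \<in> W \<and> v \<in> W)"

lemma face_submon: "face W \<Longrightarrow> submon W" by (simp add: face_def submon_def)

lemma face_lists: "face (lists A)"
  by (simp add: face_def zero_list_def plus_list_def)

lemma face_Times: "face V \<Longrightarrow> face W \<Longrightarrow> face (V \<times> W)"
  by (auto simp: face_def zero_prod_def)

lemma supported_on_mono: "V \<subseteq> W \<Longrightarrow> x \<in> supported_on V \<Longrightarrow> x \<in> supported_on W"
  by (auto simp: supported_on_def)

lemma
  supported_on_0 [simp, intro]: "0 \<in> supported_on W" and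
  supported_on_add [intro]: "x \<in> supported_on W \<Longrightarrow> y \<in> supported_on W \<Longrightarrow> x + y \<in> supported_on W" and
  supported_on_uminus [intro]: "x \<in> supported_on W \<Longrightarrow> - x \<in> supported_on W" and
  supported_on_diff [intro]: "x \<in> supported_on W \<Longrightarrow> y \<in> supported_on W \<Longrightarrow> x - y \<in> supported_on W"
proof -
  show "0 \<in> supported_on W" by (simp add: supported_on_def)
  show add: "x \<in> supported_on W \<Longrightarrow> y \<in> supported_on W \<Longrightarrow> x + y \<in> supported_on W" for x y
    using Poly_Mapping.keys_add by (fastforce simp: supported_on_def)
  show minus: "x \<in> supported_on W \<Longrightarrow> - x \<in> supported_on W" for x
    by (simp add: supported_on_def)
  show "x \<in> supported_on W \<Longrightarrow> y \<in> supported_on W \<Longrightarrow> x - y \<in> supported_on W"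
    using add[of x "- y"] minus[of y] by simp
qed

lemma supported_on_sum: "(\<And>i. i \<in> A \<Longrightarrow> f i \<in> supported_on W) \<Longrightarrow> sum f A \<in> supported_on W"
  by (induction A rule: infinite_finite_induct) auto

lemma supported_on_mon: "w \<in> W \<Longrightarrow> mon w \<in> supported_on W"
  by (simp add: supported_on_def mon_def)

lemma
  assumes "submon W"
  shows supported_on_1: "1 \<in> supported_on W"
    and supported_on_scal: "scal c \<in> supported_on W"
    and supported_on_mult: "x \<in> supported_on W \<Longrightarrow> y \<in> supported_on W \<Longrightarrow> x * y \<in> supported_on W"
    and supported_on_power: "x \<in> supported_on W \<Longrightarrow> x ^ n \<in> supported_on W"
    and supported_on_of_int: "of_int i \<in> supported_on W"
proof -
  show 1: "1 \<in> supported_on W" using supported_on_mon[of 0 W] assms by (simp add: submon_def mon_0)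
  show s: "scal c \<in> supported_on W" for c using assms by (auto simp: submon_def supported_on_def)
  show mult: "x * y \<in> supported_on W" if x: "x \<in> supported_on W" and y: "y \<in> supported_on W" for x y
  proof (rule supported_onI)
    fix n
    have "keys (fps_nth x i * fps_nth y j) \<subseteq> W" for i j
    proof -
      have "keys (fps_nth x i) \<subseteq> W" "keys (fps_nth y j) \<subseteq> W" using x y by (auto simp: supported_on_def)
      moreover have "{a + b |a b. a \<in> keys (fps_nth x i) \<and> b \<in> keys (fps_nth y j)} \<subseteq> W"
        using assms calculation unfolding submon_def by blast
      ultimately show ?thesis using keys_mult[of "fps_nth x i" "fps_nth y j"] by (meson order_trans)
    qed
    then have "(\<Union>i\<in>{0..n}. keys (fps_nth x i * fps_nth y (n - i))) \<subseteq> W" by blast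
    then show "keys (fps_nth (x * y) n) \<subseteq> W"
      unfolding fps_mult_nth by (rule order_trans[OF Poly_Mapping.keys_sum])
  qed
  show "x \<in> supported_on W \<Longrightarrow> x ^ n \<in> supported_on W"
    by (induction n) (simp_all add: 1 mult)
  show "of_int i \<in> supported_on W" using s[of "of_int i"] by (simp add: scal_of_int)
qed

lemma hclosed_supported_on: "hclosed (supported_on W)"
  unfolding hclosed_def
proof (intro allI impI supported_onI)
  fix x and n :: nat
  assume "\<forall>n. \<exists>y\<in>supported_on W. \<forall>k<n. fps_nth x k = fps_nth y k"
  then obtain y where "y \<in> supported_on W" "\<forall>k<Suc n. fps_nth x k = fps_nth y k" by blast
  then show "keys (fps_nth x n) \<subseteq> W" by (auto simp: supported_on_def)
qed

lemma free_alg_simps [simp]: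
  "carrier (free_alg W) = supported_on W" "monoid.mult (free_alg W) = (*)" "one (free_alg W) = 1"
  "zero (free_alg W) = 0" "add (free_alg W) = (+)"
  by (simp_all add: free_alg_def)

lemma ring_free_alg:
  assumes "submon W"
  shows "ring (free_alg W)"
proof (rule ringI)
  show "abelian_group (free_alg W)"
  proof (rule abelian_groupI)
    fix x assume "x \<in> carrier (free_alg W)"
    then show "\<exists>y\<in>carrier (free_alg W). y \<oplus>\<^bsub>free_alg W\<^esub> x = \<zero>\<^bsub>free_alg W\<^esub>"
      by (intro bexI[of _ "- x"]) auto
  qed (auto simp: add.assoc add.commute)
  show "Group.monoid (free_alg W)"
    by (rule monoidI) (auto simp: supported_on_mult supported_on_1 assms mult.assoc)
qed (auto simp: algebra_simps)

section \<open>Closed ideals of free algebras\<close>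

definition closed_ideal :: "'w::monoid_add set \<Rightarrow> 'w alg set \<Rightarrow> bool" where
  "closed_ideal W I \<longleftrightarrow> I \<subseteq> supported_on W \<and> 0 \<in> I \<and> (\<forall>x\<in>I. \<forall>y\<in>I. x + y \<in> I) \<and>
     (\<forall>x\<in>I. \<forall>a\<in>supported_on W. a * x \<in> I \<and> x * a \<in> I) \<and> hclosed I"

lemma closed_ideal_closure:
  assumes "submon W" and "ideal I (free_alg W)"
  shows "closed_ideal W (closure I)"
proof -
  interpret ideal I "free_alg W" by fact
  have I: "I \<subseteq> supported_on W" using a_subset by simp
  \<comment> \<open>Continuity of multiplication: a truncation of a product depends only on the
    truncations of the factors.\<close>
  have cong: "\<forall>k<n. fps_nth (x * y) k = fps_nth (x' * y') k"
    if "\<forall>k<n. fps_nth x k = fps_nth x' k" "\<forall>k<n. fps_nth y k = fps_nth y' k" for n and x y x' y' :: "'a alg"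
    using that by (simp add: fps_mult_nth)
  show ?thesis
    unfolding closed_ideal_def
  proof (intro conjI ballI)
    show sub: "closure I \<subseteq> supported_on W"
    proof
      fix x assume "x \<in> closure I"
      then show "x \<in> supported_on W"
        using I unfolding mem_closure_iff by (intro hclosedD[OF hclosed_supported_on]) blast
    qed
    show "0 \<in> closure I" 
      using subsetD[OF closure_subset additive_subgroup.zero_closed[OF is_additive_subgroup]] by simp
    show "x + y \<in> closure I" if cl: "x \<in> closure I" "y \<in> closure I" for x y
      unfolding mem_closure_iff
    proof
      fix n
      obtain x' y' where "x' \<in> I" "\<forall>k<n. fps_nth x k = fps_nth x' k" "y' \<in> I" "\<forall>k<n. fps_nth y k = fps_nth y' k"
        using cl unfolding mem_closure_iff by meson
      then show "\<exists>z\<in>I. \<forall>k<n. fps_nth (x + y) k = fps_nth z k"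
        using additive_subgroup.a_closed[OF is_additive_subgroup, of x' y'] by (intro bexI[of _ "x' + y'"]) auto
    qed
    show "a * x \<in> closure I" if cl: "x \<in> closure I" "a \<in> supported_on W" for x a
      unfolding mem_closure_iff
    proof
      fix n
      obtain x' where "x' \<in> I" "\<forall>k<n. fps_nth x k = fps_nth x' k"
        using cl unfolding mem_closure_iff by meson
      then show "\<exists>z\<in>I. \<forall>k<n. fps_nth (a * x) k = fps_nth z k"
        using I_l_closed[of x' a] cl cong by (intro bexI[of _ "a * x'"]) auto
    qed
    show "x * a \<in> closure I" if cl: "x \<in> closure I" "a \<in> supported_on W" for x a
      unfolding mem_closure_iff
    proof
      fix n
      obtain x' where "x' \<in> I" "\<forall>k<n. fps_nth x k = fps_nth x' k"
        using cl unfolding mem_closure_iff by meson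
      then show "\<exists>z\<in>I. \<forall>k<n. fps_nth (x * a) k = fps_nth z k"
        using I_r_closed[of x' a] cl cong by (intro bexI[of _ "x' * a"]) auto
    qed
    show "hclosed (closure I)" by (rule hclosed_closure)
  qed
qed

lemma closed_ideal_closure_genideal:
  assumes "submon W" and "G \<subseteq> supported_on W"
  shows "closed_ideal W (closure (Idl\<^bsub>free_alg W\<^esub> G))" and "G \<subseteq> closure (Idl\<^bsub>free_alg W\<^esub> G)"
proof -
  interpret ring "free_alg W" using assms(1) by (rule ring_free_alg)
  show "closed_ideal W (closure (Idl\<^bsub>free_alg W\<^esub> G))"
    using assms by (intro closed_ideal_closure genideal_ideal) simp_all
  show "G \<subseteq> closure (Idl\<^bsub>free_alg W\<^esub> G)"
    using genideal_self[of G] closure_subset assms(2) by fastforce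
qed

lemma closed_ideal_ideal:
  assumes "submon W" and "closed_ideal W I"
  shows "ideal I (free_alg W)"
proof (rule idealI)
  show "ring (free_alg W)" using assms(1) by (rule ring_free_alg)
  then interpret ring "free_alg W" .
  have minus: "- x \<in> I" if "x \<in> I" for x
  proof -
    have "- 1 \<in> supported_on W" using supported_on_1[OF assms(1)] by (rule supported_on_uminus)
    then have "(- 1) * x \<in> I" using that assms(2) unfolding closed_ideal_def by blast
    then show ?thesis by simp
  qed
  show "subgroup I (add_monoid (free_alg W))"
  proof (rule add.subgroupI)
    show "I \<subseteq> carrier (free_alg W)" "I \<noteq> {}" using assms(2) by (auto simp: closed_ideal_def)
    fix x assume x: "x \<in> I"
    then have "\<ominus>\<^bsub>free_alg W\<^esub> x = - x"
      using assms(2) by (intro minus_equality) (auto simp: closed_ideal_def)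
    with minus[OF x] show "\<ominus>\<^bsub>free_alg W\<^esub> x \<in> I" by simp
  next
    fix x y assume "x \<in> I" "y \<in> I"
    then show "x \<oplus>\<^bsub>free_alg W\<^esub> y \<in> I" using assms(2) by (auto simp: closed_ideal_def)
  qed
qed (use assms(2) in \<open>auto simp: closed_ideal_def\<close>)

text \<open>The preimage of \<open>J\<close> among the elements supported on \<open>W\<close> is a
  closed ideal containing \<open>G\<close>, hence contains the closed ideal generated by
  \<open>G\<close>. Descent of a homomorphism to a quotient is thereby reduced to the defining
  relations.\<close>

lemma hom_closure_genideal:
  assumes "submon W" "G \<subseteq> supported_on W" "alg_hom f" "two_sided J" "hclosed J"
    and "\<And>x. x \<in> G \<Longrightarrow> f x \<in> J" and "x \<in> closure (Idl\<^bsub>free_alg W\<^esub> G)"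
  shows "f x \<in> J"
proof -
  interpret ring "free_alg W" using assms(1) by (rule ring_free_alg)
  have "closed_ideal W ({x. f x \<in> J} \<inter> supported_on W)"
    using hclosed_Int[OF hclosed_vimage[OF hom_alg_linear[OF assms(3)] assms(5)] hclosed_supported_on[of W]]
      two_sided_add[OF assms(4)] two_sided_left[OF assms(4)] two_sided_right[OF assms(4)] two_sided_0[OF assms(4)]
    unfolding closed_ideal_def by (auto simp: hom_simps[OF assms(3)] supported_on_mult[OF assms(1)])
  then have *: "ideal ({x. f x \<in> J} \<inter> supported_on W) (free_alg W)"
    by (rule closed_ideal_ideal[OF assms(1)])
  have sub: "Idl\<^bsub>free_alg W\<^esub> G \<subseteq> {x. f x \<in> J}"
    using genideal_minimal[OF *] assms(2,6) by auto
  have "x \<in> {x. f x \<in> J}"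
    by (rule hclosedD[OF hclosed_vimage[OF hom_alg_linear[OF assms(3)] assms(5)]])
      (use assms(7) sub in \<open>unfold mem_closure_iff, blast\<close>)
  then show ?thesis by simp
qed

text \<open>Extending an ideal of the algebra on the words in \<open>W\<close> by all other words gives an ideal of the
  whole ring, so that congruences can be multiplied without regard to supports.\<close>

definition restr :: "'w::monoid_add set \<Rightarrow> 'w alg \<Rightarrow> 'w alg" where
  "restr W = lin (\<lambda>w. if w \<in> W then mon w else 0)"

definition ext :: "'w::monoid_add set \<Rightarrow> 'w alg set \<Rightarrow> 'w alg set" where
  "ext W I = {x. restr W x \<in> I}"

lemma hom_restr: "face W \<Longrightarrow> alg_hom (restr W)"
  unfolding restr_def by (rule hom_lin) (auto simp: face_def mon_0 mon_add)

lemma restr_supported_on: "restr W x \<in> supported_on W"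
  by (rule alg_linear_supported_on[of _ UNIV])
    (auto simp: restr_def supported_on_mon, simp add: supported_on_def)

lemma restr_eq: "x \<in> supported_on W \<Longrightarrow> restr W x = x"
  by (rule alg_linear_cong_supported_on[of "restr W" "\<lambda>x. x" W]) (simp_all add: restr_def alg_linear_id)

text \<open>As \<open>restr W\<close> is a homomorphism with values in the algebra on
  \<open>W\<close>, an arbitrary multiplier acts on \<open>restr W x\<close> through an element of
  that algebra.\<close>

lemma two_sided_ext:
  assumes "face W" and "closed_ideal W I"
  shows "two_sided (ext W I)"
  using assms(2) unfolding two_sided_def ext_def closed_ideal_def
  by (simp add: hom_simps[OF hom_restr[OF assms(1)]] restr_supported_on)

lemma hclosed_ext: "face W \<Longrightarrow> closed_ideal W I \<Longrightarrow> hclosed (ext W I)"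
  unfolding ext_def by (intro hclosed_vimage) (simp_all add: restr_def closed_ideal_def)

lemma ext_iff: "x \<in> supported_on W \<Longrightarrow> x \<in> ext W I \<longleftrightarrow> x \<in> I"
  by (simp add: ext_def restr_eq)

section \<open>The exponential\<close>

text \<open>The \<open>k\<close>-th term of the exponential \<open>qexp x\<close>. Being divisible
  by \<hbar>^k, it affects no coefficient below \<open>k\<close>, so finite partial sums suffice for
  each coefficient.\<close>

definition qpow :: "'w::monoid_add alg \<Rightarrow> nat \<Rightarrow> 'w alg" where
  "qpow x k = scal (fps_const (1 / fact k) * fps_X ^ k) * x ^ k"

lemma qpow_0: "qpow x 0 = 1" by (simp add: qpow_def)

lemma qpow_nth:
  "fps_nth (qpow x k) m = (if m < k then 0 else single 0 (1 / fact k) * fps_nth (x ^ k) (m - k))"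
proof -
  have "(scal (fps_const (1 / fact k)) :: 'a alg) = fps_const (single 0 (1 / fact k))"
    by (simp add: fps_eq_iff)
  then show ?thesis
    by (simp add: qpow_def scal_mult scal_power scal_fps_X mult.assoc fps_X_power_mult_nth)
qed

lemma qexp_nth: "m \<le> n \<Longrightarrow> fps_nth (qexp x) m = fps_nth (\<Sum>k\<le>n. qpow x k) m"
proof -
  assume "m \<le> n"
  then have "(\<Sum>k\<le>n. fps_nth (qpow x k) m) = (\<Sum>k\<le>m. fps_nth (qpow x k) m)"
    by (intro sum.mono_neutral_right) (auto simp: qpow_nth)
  then show ?thesis by (simp add: fps_sum_nth qexp_def qpow_nth)
qed

lemma hom_qpow: "alg_hom f \<Longrightarrow> f (qpow x k) = qpow (f x) k"
  by (simp add: qpow_def hom_simps)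

text \<open>A homomorphism respects the finite partial sums, and by continuity it respects their
  limit.\<close>

lemma hom_qexp:
  assumes "alg_hom f"
  shows "f (qexp x) = qexp (f x)"
proof (rule fps_ext)
  fix m
  have "fps_nth (f (qexp x)) m = fps_nth (f (\<Sum>k\<le>m. qpow x k)) m"
    using alg_linear_nth_cong[OF hom_alg_linear[OF assms], of "Suc m" "qexp x" "\<Sum>k\<le>m. qpow x k"]
    by (simp add: qexp_nth[of _ m])
  also have "\<dots> = fps_nth (qexp (f x)) m"
    by (simp add: hom_simps assms hom_qpow qexp_nth[of m m])
  finally show "fps_nth (f (qexp x)) m = fps_nth (qexp (f x)) m" .
qed

lemma qpow_Suc: "of_nat (Suc n) * qpow x (Suc n) = scal fps_X * (x * qpow x n)"
proof -
  have "of_nat (Suc n) * (fps_const (1 / fact (Suc n)) * fps_X ^ Suc n) =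
      fps_X * (fps_const (1 / fact n) * fps_X ^ n :: complex fps)"
  proof -
    have "(of_nat (Suc n) :: complex fps) * fps_const (1 / fact (Suc n)) = fps_const (1 / fact n)"
      by (simp add: fps_of_nat[symmetric] del: of_nat_Suc)
    then show ?thesis by (simp add: mult.assoc[symmetric] del: of_nat_Suc fact_Suc)
  qed
  then have "scal (of_nat (Suc n)) * qpow x (Suc n) = scal (fps_X * (fps_const (1 / fact n) * fps_X ^ n)) * x ^ Suc n"
    unfolding qpow_def by (metis mult.assoc scal_mult)
  also have "\<dots> = scal fps_X * (x * qpow x n)"
    by (simp only: qpow_def scal_left_commute[of x] scal_mult[of fps_X] power_Suc mult.assoc)
  finally show ?thesis by (simp only: scal_of_nat)
qed

text \<open>The binomial theorem in divided-power form. The recursion \<open>qpow_Suc\<close> turns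
  the induction step into an identity multiplied by \<open>n + 1\<close>.\<close>

lemma qpow_add:
  assumes "x * y = y * x"
  shows "qpow (x + y) n = (\<Sum>i\<le>n. qpow x i * qpow y (n - i))"
proof (induction n)
  case 0
  show ?case by (simp add: qpow_0)
next
  case (Suc n)
  have comm: "y * qpow x i = qpow x i * y" for i
    using assms by (simp add: qpow_def scal_left_commute mult.assoc power_commuting_commutes)
  have "of_nat (Suc n) * qpow (x + y) (Suc n) =
      scal fps_X * (x * (\<Sum>i\<le>n. qpow x i * qpow y (n - i))) + scal fps_X * (y * (\<Sum>i\<le>n. qpow x i * qpow y (n - i)))"
    by (simp only: qpow_Suc Suc distrib_right distrib_left)
  also have "\<dots> = (\<Sum>i\<le>n. scal fps_X * (x * qpow x i) * qpow y (n - i)) +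
      (\<Sum>i\<le>n. qpow x i * (scal fps_X * (y * qpow y (n - i))))"
    by (simp add: sum_distrib_left scal_left_commute mult.assoc comm flip: mult.assoc[of y])
  also have "\<dots> = (\<Sum>i\<le>n. of_nat (Suc i) * (qpow x (Suc i) * qpow y (n - i))) +
      (\<Sum>i\<le>n. of_nat (Suc n - i) * (qpow x i * qpow y (Suc n - i)))"
  proof -
    have "qpow x i * (scal fps_X * (y * qpow y (n - i))) = of_nat (Suc n - i) * (qpow x i * qpow y (Suc n - i))"
      if "i \<le> n" for i
    proof -
      have "qpow x i * (scal fps_X * (y * qpow y (n - i))) = (qpow x i * of_nat (Suc (n - i))) * qpow y (Suc (n - i))"
        by (simp only: qpow_Suc[symmetric] mult.assoc)
      also have "\<dots> = of_nat (Suc n - i) * (qpow x i * qpow y (Suc n - i))"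
        using that by (simp only: mult_of_nat_commute[symmetric] mult.assoc Suc_diff_le)
      finally show ?thesis .
    qed
    then show ?thesis by (simp only: qpow_Suc[symmetric] mult.assoc) simp
  qed
  also have "(\<Sum>i\<le>n. of_nat (Suc i) * (qpow x (Suc i) * qpow y (n - i))) =
      (\<Sum>i\<le>Suc n. of_nat i * (qpow x i * qpow y (Suc n - i)))"
    by (subst sum.atMost_Suc_shift) simp
  also have "(\<Sum>i\<le>n. of_nat (Suc n - i) * (qpow x i * qpow y (Suc n - i))) =
      (\<Sum>i\<le>Suc n. of_nat (Suc n - i) * (qpow x i * qpow y (Suc n - i)))"
    by simp
  \<comment> \<open>The weights \<open>i\<close> and \<open>Suc n - i\<close> of each summand add up
    to \<open>Suc n\<close>.\<close>
  also have "(\<Sum>i\<le>Suc n. of_nat i * (qpow x i * qpow y (Suc n - i))) +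
      (\<Sum>i\<le>Suc n. of_nat (Suc n - i) * (qpow x i * qpow y (Suc n - i))) =
      of_nat (Suc n) * (\<Sum>i\<le>Suc n. qpow x i * qpow y (Suc n - i))"
    unfolding sum.distrib[symmetric] sum_distrib_left
    by (rule sum.cong) (simp_all only: distrib_right[symmetric] of_nat_add[symmetric], simp)
  finally have *: "scal (of_nat (Suc n)) * qpow (x + y) (Suc n) =
      scal (of_nat (Suc n)) * (\<Sum>i\<le>Suc n. qpow x i * qpow y (Suc n - i))"
    by (simp only: scal_of_nat)
  \<comment> \<open>The factor \<open>Suc n\<close> is cancelled by its inverse in the ground
    ring.\<close>
  have one: "fps_const (1 / of_nat (Suc n)) * of_nat (Suc n) = (1 :: complex fps)"
    by (simp add: fps_of_nat[symmetric] del: of_nat_Suc)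
  from arg_cong[OF *, of "\<lambda>z. scal (fps_const (1 / of_nat (Suc n))) * z"]
  show ?case by (simp only: mult.assoc[symmetric] scal_mult[symmetric] one scal_1 mult_1_left)
qed

text \<open>A product of an \<open>i\<close>-th and a \<open>j\<close>-th term is divisible by
  \<hbar>^(i + j). Hence for the coefficient at \<open>m\<close> the triangle i + j \<le> m of the
  binomial sums may be enlarged to the square of the product of partial sums.\<close>

lemma qexp_add:
  assumes "x * y = y * x"
  shows "qexp (x + y) = qexp x * qexp y"
proof (rule fps_ext)
  fix m
  let ?g = "\<lambda>i j. fps_nth (qpow x i * qpow y j) m"
  have 0: "?g i j = 0" if "i + j > m" for i j
  proof -
    have "qpow x i * qpow y j =
        scal ((fps_const (1 / fact i) * fps_X ^ i) * (fps_const (1 / fact j) * fps_X ^ j)) * (x ^ i * y ^ j)"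
      by (simp only: qpow_def scal_mult scal_left_commute[of "x ^ i"] mult.assoc)
    also have "(fps_const (1 / fact i) * fps_X ^ i) * (fps_const (1 / fact j) * fps_X ^ j) =
        fps_X ^ (i + j) * (fps_const (1 / fact i) * fps_const (1 / fact j) :: complex fps)"
      by (simp only: power_add mult_ac)
    also have "scal \<dots> * (x ^ i * y ^ j) =
        scal (fps_X ^ (i + j)) * (scal (fps_const (1 / fact i) * fps_const (1 / fact j)) * (x ^ i * y ^ j))"
      by (simp only: scal_mult[of "fps_X ^ (i + j)"] mult.assoc)
    finally show ?thesis using that
      by (simp add: scal_power[of fps_X] scal_fps_X fps_X_power_mult_nth)
  qed
  have "fps_nth (qexp (x + y)) m = (\<Sum>n\<le>m. \<Sum>i\<le>n. ?g i (n - i))"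
    by (simp add: qexp_nth[of m m] qpow_add[OF assms] fps_sum_nth)
  also have "\<dots> = (\<Sum>(i, j)\<in>{(i, j). i + j \<le> m}. ?g i j)"
    by (simp add: sum.triangle_reindex_eq)
  also have "\<dots> = (\<Sum>(i, j)\<in>{..m} \<times> {..m}. ?g i j)"
    by (rule sum.mono_neutral_left) (auto intro!: 0)
  also have "\<dots> = fps_nth ((\<Sum>i\<le>m. qpow x i) * (\<Sum>j\<le>m. qpow y j)) m"
    by (simp add: sum_product sum.cartesian_product[symmetric] fps_sum_nth)
  also have "\<dots> = fps_nth (qexp x * qexp y) m"
    unfolding fps_mult_nth by (intro sum.cong refl arg_cong2[where f = "(*)"]) (simp_all add: qexp_nth[of _ m])
  finally show "fps_nth (qexp (x + y)) m = fps_nth (qexp x * qexp y) m" .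
qed

lemma qexp_of_int: "qexp (of_int a) = scal (fps_exp (of_int a))"
proof (rule fps_ext)
  fix n
  have *: "(of_int a :: 'a alg) ^ k = scal (fps_const (of_int a ^ k))" for k
    by (metis fps_const_power fps_of_int scal_of_int scal_power)
  have "fps_nth (qexp (of_int a)) n = (\<Sum>k\<le>n. if k = n then single (0::'a) (of_int a ^ n / fact n) else 0)"
    unfolding qexp_def fps_nth_Abs_fps * by (rule sum.cong) (auto simp: mult_single)
  then show "fps_nth (qexp (of_int a)) n = fps_nth (scal (fps_exp (of_int a)) :: 'a alg) n"
    by simp
qed

lemma supported_on_qexp:
  assumes "submon W" "x \<in> supported_on W"
  shows "qexp x \<in> supported_on W"
proof (rule hclosedD[OF hclosed_supported_on])
  fix n
  have "(\<Sum>k\<le>n. qpow x k) \<in> supported_on W"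
    unfolding qpow_def
    by (intro supported_on_sum supported_on_mult supported_on_scal supported_on_power assms)
  then show "\<exists>y\<in>supported_on W. \<forall>k<n. fps_nth (qexp x) k = fps_nth y k"
    by (intro bexI[of _ "\<Sum>k\<le>n. qpow x k"]) (simp_all add: qexp_nth[of _ n])
qed

text \<open>Moving \<open>e\<close> to the left past \<open>h\<close> replaces \<open>h\<close> by
  \<open>h + of_int a\<close>. The same holds for powers, hence for partial sums of the exponential,
  and for the exponential itself because \<open>J\<close> is closed. The shift by the central
  \<open>a\<close> then comes out as the factor q^a.\<close>

lemma qexp_commute_cong_mod:
  assumes J: "two_sided J" "hclosed J" and "cong_mod J (h * e) (e * h + of_int a * e)"
  shows "cong_mod J (qexp h * e) (scal (fps_exp (of_int a)) * (e * qexp h))"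
proof -
  have c: "e * of_int a = of_int a * e"
    by (simp add: mult_of_int_commute)
  have step: "cong_mod J (h * e) (e * (h + of_int a))"
    using assms(3) by (simp add: distrib_left c)
  have pow: "cong_mod J (h ^ k * e) (e * (h + of_int a) ^ k)" for k
  proof (induction k)
    case (Suc k)
    have "cong_mod J (h * (h ^ k * e)) (h * (e * (h + of_int a) ^ k))"
      by (intro cong_mod_mult J cong_mod_refl Suc)
    moreover have "cong_mod J (h * e * (h + of_int a) ^ k) (e * (h + of_int a) * (h + of_int a) ^ k)"
      by (intro cong_mod_mult J cong_mod_refl step)
    ultimately show ?case
      by (simp add: mult.assoc) (rule cong_mod_trans[OF J(1)])
  qed (simp add: cong_mod_refl J)
  have qpow: "cong_mod J (qpow h k * e) (e * qpow (h + of_int a) k)" for k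
    using cong_mod_mult[OF J(1) cong_mod_refl[OF J(1)] pow[of k]]
    by (simp add: qpow_def scal_left_commute mult.assoc)
  have "cong_mod J (qexp h * e) (e * qexp (h + of_int a))"
    unfolding cong_mod_def
  proof (rule hclosedD[OF J(2)])
    fix n
    have "(\<Sum>k\<le>n. qpow h k * e - e * qpow (h + of_int a) k) \<in> J"
      using qpow by (intro two_sided_sum J) (simp add: cong_mod_def)
    moreover have "fps_nth (qexp h * e) k = fps_nth ((\<Sum>k\<le>n. qpow h k) * e) k" if "k < n" for k
      unfolding fps_mult_nth using that by (intro sum.cong refl arg_cong2[where f = "(*)"]) (simp_all add: qexp_nth[of _ n])
    moreover have "fps_nth (e * qexp g) k = fps_nth (e * (\<Sum>k\<le>n. qpow g k)) k" if "k < n" for k g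
      unfolding fps_mult_nth using that by (intro sum.cong refl arg_cong2[where f = "(*)"]) (simp_all add: qexp_nth[of _ n])
    ultimately show "\<exists>y\<in>J. \<forall>k<n. fps_nth (qexp h * e - e * qexp (h + of_int a)) k = fps_nth y k"
      by (intro bexI[of _ "\<Sum>k\<le>n. qpow h k * e - e * qpow (h + of_int a) k"])
        (auto simp: sum_subtractf sum_distrib_left sum_distrib_right)
  qed
  moreover have "qexp (h + of_int a) = scal (fps_exp (of_int a)) * qexp h"
    by (simp add: qexp_add mult_of_int_commute qexp_of_int scal_commute)
  ultimately show ?thesis by (simp add: scal_left_commute)
qed

lemma scal_fps_X_cancel: "scal fps_X * x = scal fps_X * y \<Longrightarrow> x = y"
proof (rule fps_ext)
  fix n assume "scal fps_X * x = scal fps_X * y"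
  then have "fps_nth (fps_X * x) (Suc n) = fps_nth (fps_X * y) (Suc n)" by (simp add: scal_fps_X)
  then show "fps_nth x n = fps_nth y n" by simp
qed

lemma scal_fps_X_shift: "scal fps_X * fps_shift 1 (qexp x - qexp (- x)) = qexp x - qexp (- x)"
proof -
  have "fps_nth (qexp x - qexp (- x)) 0 = 0" by (simp add: qexp_def)
  then show ?thesis using fps_split_const[of "qexp x - qexp (- x)"] by simp
qed

text \<open>Multiplication by \<hbar> undoes the shift in \<open>qbracket\<close>. As \<hbar> can be
  cancelled, identities between brackets may be checked on their numerators.\<close>

lemma fps_X_qbracket:
  "scal fps_X * qbracket x =
    scal (inverse (fps_shift 1 (fps_exp 1 - fps_exp (-1)))) * (qexp x - qexp (- x))"
  unfolding qbracket_def by (subst scal_left_commute) (simp only: scal_fps_X_shift)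

lemma hom_qbracket:
  assumes "alg_hom f"
  shows "f (qbracket x) = qbracket (f x)"
proof (rule scal_fps_X_cancel)
  have "scal fps_X * f (qbracket x) = f (scal fps_X * qbracket x)"
    by (simp add: hom_simps assms)
  also have "\<dots> = scal fps_X * qbracket (f x)"
    unfolding fps_X_qbracket by (simp add: hom_simps assms hom_qexp)
  finally show "scal fps_X * f (qbracket x) = scal fps_X * qbracket (f x)" .
qed

text \<open>The numerators telescope: with u = q^x and v = q^y, the difference uv - u^-1 v^-1 is (u
  - u^-1) v + u^-1 (v - v^-1).\<close>

lemma qbracket_add:
  assumes "x * y = y * x"
  shows "qbracket (x + y) = qbracket x * qexp y + qexp (- x) * qbracket y"
proof (rule scal_fps_X_cancel)
  have "qexp (x + y) - qexp (- (x + y)) = (qexp x - qexp (- x)) * qexp y + qexp (- x) * (qexp y - qexp (- y))"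
    using qexp_add[OF assms] qexp_add[of "- x" "- y"] assms by (simp add: algebra_simps)
  moreover have "scal fps_X * (qbracket x * qexp y + qexp (- x) * qbracket y) =
      (scal fps_X * qbracket x) * qexp y + qexp (- x) * (scal fps_X * qbracket y)"
    by (simp add: distrib_left mult.assoc scal_left_commute[of "qexp (- x)" fps_X])
  ultimately show "scal fps_X * qbracket (x + y) = scal fps_X * (qbracket x * qexp y + qexp (- x) * qbracket y)"
    by (simp only: fps_X_qbracket distrib_left mult.assoc scal_left_commute[of "qexp (- x)"])
qed

lemma supported_on_qbracket:
  assumes "submon W" "x \<in> supported_on W"
  shows "qbracket x \<in> supported_on W"
proof -
  have "qexp x - qexp (- x) \<in> supported_on W"
    by (intro supported_on_diff supported_on_qexp supported_on_uminus assms)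
  then have "fps_shift 1 (qexp x - qexp (- x)) \<in> supported_on W"
    by (simp add: supported_on_def)
  then show ?thesis
    unfolding qbracket_def using assms(1) by (intro supported_on_mult supported_on_scal)
qed

section \<open>The Serre relation for sums of q-commuting elements\<close>

text \<open>The quantum Serre expression, with \<open>s\<close> and \<open>t\<close> standing for q
  and q^-1 in either order: \<Delta>(\<open>e\<^sub>i\<close>) and
  \<Delta>(\<open>f\<^sub>i\<close>) require opposite orders in \<open>qserre_cross\<close>.\<close>

definition qserre :: "complex fps \<Rightarrow> complex fps \<Rightarrow> 'w::monoid_add alg \<Rightarrow> 'w alg \<Rightarrow> 'w alg" where
  "qserre s t x y = x * x * y - scal (s + t) * (x * y * x) + y * x * x"

text \<open>The mixed terms of the expansion fall into four groups according to how often each of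
  \<open>A\<close>, \<open>B\<close>, \<open>C\<close>, \<open>D\<close> occurs. In each group the
  q-commutation rules bring all terms to one or two normal words, whose coefficients vanish by
  \<open>s * t = 1\<close>.\<close>

lemma qserre_cross:
  fixes J :: "'w::monoid_add alg set"
  assumes J: "two_sided J" and "s * t = 1"
    and BA: "cong_mod J (B * A) (scal (t * t) * (A * B))"
    and BC: "cong_mod J (B * C) (scal s * (C * B))"
    and DA: "cong_mod J (D * A) (scal s * (A * D))"
  shows "cong_mod J (qserre s t (A + B) (C + D)) (qserre s t A C + qserre s t B D)"
proof -
  note refl = cong_mod_refl[OF J] and trans [trans] = cong_mod_trans[OF J]
  have left: "cong_mod J (u * x) (u * y)" if "cong_mod J x y" for x y u
    using that by (rule cong_mod_mult[OF J refl])
  have right: "cong_mod J (x * u) (y * u)" if "cong_mod J x y" for x y u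
    using that by (rule cong_mod_mult[OF J _ refl])
  note norm = mult.assoc scal_left_commute[of A] scal_left_commute[of B] scal_left_commute[of C] scal_left_commute[of D]
  have "scal s * scal t = (1 :: 'w alg)" "scal t * scal s = (1 :: 'w alg)"
    using assms(2) by (simp_all add: mult.commute[of t] flip: scal_mult)
  then have sst: "scal s * (scal t * x) = x" "scal t * (scal s * x) = x" for x :: "'w alg"
    by (simp_all flip: mult.assoc)
  have 1: "cong_mod J (A * D * A) (scal s * (A * A * D))"
    using left[OF DA, of A] by (simp add: norm)
  have 2: "cong_mod J (D * A * A) (scal s * (scal s * (A * A * D)))"
    by (rule trans[OF _ left[OF 1]]) (use right[OF DA, of A] in \<open>simp add: norm\<close>)
  \<comment> \<open>The coefficient of \<open>A * A * D\<close> becomes 1 - (s + t) s + s^2 =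
    0.\<close>
  have G1: "cong_mod J (A * A * D - scal (s + t) * (A * D * A) + D * A * A) 0"
  proof -
    have "cong_mod J (A * A * D - scal (s + t) * (A * D * A) + D * A * A)
      (A * A * D - scal (s + t) * (scal s * (A * A * D)) + scal s * (scal s * (A * A * D)))"
      by (rule cong_mod_add[OF J cong_mod_diff[OF J refl left[OF 1]] 2])
    then show ?thesis by (simp add: scal_add distrib_right distrib_left sst)
  qed

  have 1: "cong_mod J (B * C * B) (scal s * (C * B * B))"
    using right[OF BC, of B] by (simp add: norm)
  have 2: "cong_mod J (B * B * C) (scal s * (scal s * (C * B * B)))"
    by (rule trans[OF _ left[OF 1]]) (use left[OF BC, of B] in \<open>simp add: norm\<close>)
  \<comment> \<open>The coefficient of \<open>C * B * B\<close> becomes s^2 - (s + t) s + 1 =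
    0.\<close>
  have G2: "cong_mod J (B * B * C - scal (s + t) * (B * C * B) + C * B * B) 0"
  proof -
    have "cong_mod J (B * B * C - scal (s + t) * (B * C * B) + C * B * B)
      (scal s * (scal s * (C * B * B)) - scal (s + t) * (scal s * (C * B * B)) + C * B * B)"
      by (rule cong_mod_add[OF J cong_mod_diff[OF J 2 left[OF 1]] refl])
    then show ?thesis by (simp add: scal_add distrib_right distrib_left sst)
  qed

  have BA': "cong_mod J (B * A) (scal t * (scal t * (A * B)))"
    using BA by (simp add: scal_mult mult.assoc)
  have 1: "cong_mod J (A * B * C) (scal s * (A * C * B))"
    using left[OF BC, of A] by (simp add: norm)
  have 2: "cong_mod J (B * A * C) (scal t * (A * C * B))"
  proof -
    have "cong_mod J (B * A * C) ((scal t * scal t) * (scal s * (A * C * B)))"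
      by (rule trans[OF _ left[OF 1]]) (use right[OF BA', of C] in \<open>simp add: norm\<close>)
    then show ?thesis by (simp add: norm sst)
  qed
  have 3: "cong_mod J (C * B * A) (scal t * (scal t * (C * A * B)))"
    using left[OF BA', of C] by (simp add: norm)
  have 4: "cong_mod J (B * C * A) (scal t * (C * A * B))"
  proof -
    have "cong_mod J (B * C * A) (scal s * (scal t * (scal t * (C * A * B))))"
      by (rule trans[OF _ left[OF 3]]) (use right[OF BC, of A] in \<open>simp add: norm\<close>)
    then show ?thesis by (simp add: norm sst)
  qed
  \<comment> \<open>The normal words are \<open>A * C * B\<close>, with coefficient s + t - (s + t),
    and \<open>C * A * B\<close>, with coefficient 1 + t^2 - (s + t) t.\<close>
  have G3: "cong_mod J ((A * B * C + B * A * C) - scal (s + t) * (A * C * B + B * C * A) + (C * A * B + C * B * A)) 0"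
  proof -
    have "cong_mod J ((A * B * C + B * A * C) - scal (s + t) * (A * C * B + B * C * A) + (C * A * B + C * B * A))
      ((scal s * (A * C * B) + scal t * (A * C * B)) - scal (s + t) * (A * C * B + scal t * (C * A * B))
        + (C * A * B + scal t * (scal t * (C * A * B))))"
      by (rule cong_mod_add[OF J cong_mod_diff[OF J cong_mod_add[OF J 1 2] left[OF cong_mod_add[OF J refl 4]]] cong_mod_add[OF J refl 3]])
    then show ?thesis by (simp add: scal_add distrib_right distrib_left sst)
  qed

  have 1: "cong_mod J (D * A * B) (scal s * (A * D * B))"
    using right[OF DA, of B] by (simp add: norm)
  have 2: "cong_mod J (D * B * A) (scal t * (A * D * B))"
  proof -
    have "cong_mod J (D * B * A) ((scal t * scal t) * (scal s * (A * D * B)))"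
      by (rule trans[OF _ left[OF 1]]) (use left[OF BA', of D] in \<open>simp add: norm\<close>)
    then show ?thesis by (simp add: norm sst)
  qed
  have 3: "cong_mod J (B * A * D) (scal t * (scal t * (A * B * D)))"
    using right[OF BA', of D] by (simp add: norm)
  have 4: "cong_mod J (B * D * A) (scal t * (A * B * D))"
  proof -
    have "cong_mod J (B * D * A) (scal s * (scal t * (scal t * (A * B * D))))"
      by (rule trans[OF _ left[OF 3]]) (use left[OF DA, of B] in \<open>simp add: norm\<close>)
    then show ?thesis by (simp add: norm sst)
  qed
  \<comment> \<open>Here they are \<open>A * B * D\<close>, with coefficient 1 + t^2 - (s + t) t,
    and \<open>A * D * B\<close>, with coefficient s + t - (s + t).\<close>
  have G4: "cong_mod J ((A * B * D + B * A * D) - scal (s + t) * (A * D * B + B * D * A) + (D * A * B + D * B * A)) 0"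
  proof -
    have "cong_mod J ((A * B * D + B * A * D) - scal (s + t) * (A * D * B + B * D * A) + (D * A * B + D * B * A))
      ((A * B * D + scal t * (scal t * (A * B * D))) - scal (s + t) * (A * D * B + scal t * (A * B * D))
        + (scal s * (A * D * B) + scal t * (A * D * B)))"
      by (rule cong_mod_add[OF J cong_mod_diff[OF J cong_mod_add[OF J refl 3] left[OF cong_mod_add[OF J refl 4]]] cong_mod_add[OF J 1 2]])
    then show ?thesis by (simp add: scal_add distrib_right distrib_left sst)
  qed

  have "qserre s t (A + B) (C + D) - (qserre s t A C + qserre s t B D) =
    (A * A * D - scal (s + t) * (A * D * A) + D * A * A) +
    (B * B * C - scal (s + t) * (B * C * B) + C * B * B) +
    ((A * B * C + B * A * C) - scal (s + t) * (A * C * B + B * C * A) + (C * A * B + C * B * A)) +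
    ((A * B * D + B * A * D) - scal (s + t) * (A * D * B + B * D * A) + (D * A * B + D * B * A))"
    by (simp add: qserre_def algebra_simps)
  moreover note cong_mod_add[OF J cong_mod_add[OF J cong_mod_add[OF J G1 G2] G3] G4]
  ultimately show ?thesis by (simp add: cong_mod_def)
qed

section \<open>Ideals of tensor products\<close>

lemma alg_linear_restr: "alg_linear (restr W)"
  by (simp add: restr_def)

lemma restr_tensor: "restr (V \<times> W) (x \<boxtimes> y) = restr V x \<boxtimes> restr W y"
  by (rule alg_linear_ext2[where f = "\<lambda>x y. restr (V \<times> W) (x \<boxtimes> y)" and g = "\<lambda>x y. restr V x \<boxtimes> restr W y"])
    (rule alg_linear_comp[OF alg_linear_restr alg_linear_tensor_left] alg_linear_comp[OF alg_linear_restr alg_linear_tensor_right]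
      alg_linear_comp[OF alg_linear_tensor_left alg_linear_restr] alg_linear_comp[OF alg_linear_tensor_right alg_linear_restr]
    | simp add: restr_def alg_linear_0[OF alg_linear_tensor_left] alg_linear_0[OF alg_linear_tensor_right])+

lemma supported_on_tensor:
  assumes "x \<in> supported_on V" "y \<in> supported_on W"
  shows "x \<boxtimes> y \<in> supported_on (V \<times> W)"
  using restr_supported_on[of "V \<times> W" "x \<boxtimes> y"] assms by (simp add: restr_tensor restr_eq)

text \<open>The last conclusion is the means of descent for maps on tensor products: a homomorphism
  needs to be tested only on the two embedded ideals.\<close>

lemma
  assumes "face V" "face W" "I \<subseteq> supported_on V" "J \<subseteq> supported_on W"
  shows closed_ideal_tensor_ideal: "closed_ideal (V \<times> W) (tensor_ideal V I W J)"
    and tensor_ideal_left: "x \<in> I \<Longrightarrow> x \<boxtimes> 1 \<in> tensor_ideal V I W J"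
    and tensor_ideal_right: "y \<in> J \<Longrightarrow> 1 \<boxtimes> y \<in> tensor_ideal V I W J"
    and hom_tensor_ideal: "alg_hom f \<Longrightarrow> two_sided K \<Longrightarrow> hclosed K \<Longrightarrow> (\<And>x. x \<in> I \<Longrightarrow> f (x \<boxtimes> 1) \<in> K) \<Longrightarrow>
      (\<And>y. y \<in> J \<Longrightarrow> f (1 \<boxtimes> y) \<in> K) \<Longrightarrow> z \<in> tensor_ideal V I W J \<Longrightarrow> f z \<in> K"
proof -
  have m: "submon (V \<times> W)" using assms(1,2) by (intro face_submon face_Times)
  have 1: "1 \<in> supported_on V" "1 \<in> supported_on W"
    using assms(1,2) by (simp_all add: supported_on_1 face_submon)
  have G: "(\<lambda>x. x \<boxtimes> 1) ` I \<union> (\<lambda>y. 1 \<boxtimes> y) ` J \<subseteq> supported_on (V \<times> W)"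
    using assms(3,4) 1 by (auto intro!: supported_on_tensor)
  note * = closed_ideal_closure_genideal[OF m G]
  show "closed_ideal (V \<times> W) (tensor_ideal V I W J)"
    unfolding tensor_ideal_def by (rule *(1))
  show "x \<in> I \<Longrightarrow> x \<boxtimes> 1 \<in> tensor_ideal V I W J" "y \<in> J \<Longrightarrow> 1 \<boxtimes> y \<in> tensor_ideal V I W J"
    unfolding tensor_ideal_def by (rule subsetD[OF *(2)], blast)+
  show "f z \<in> K" if "alg_hom f" "two_sided K" "hclosed K" "\<And>x. x \<in> I \<Longrightarrow> f (x \<boxtimes> 1) \<in> K"
      "\<And>y. y \<in> J \<Longrightarrow> f (1 \<boxtimes> y) \<in> K" "z \<in> tensor_ideal V I W J"
    by (rule hom_closure_genideal[OF m G that(1-3) _ that(6)[unfolded tensor_ideal_def]])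
      (use that(4,5) in auto)
qed

lemma cong_mod_tensor:
  assumes "face V" "face W" "closed_ideal V I" "closed_ideal W J"
    and "cong_mod (ext V I) x x'" "cong_mod (ext W J) y y'"
  shows "cong_mod (ext (V \<times> W) (tensor_ideal V I W J)) (x \<boxtimes> y) (x' \<boxtimes> y')"
proof -
  let ?T = "tensor_ideal V I W J"
  have IJ: "I \<subseteq> supported_on V" "J \<subseteq> supported_on W" using assms(3,4) by (simp_all add: closed_ideal_def)
  have T: "two_sided (ext (V \<times> W) ?T)"
    using assms(1,2) IJ by (intro two_sided_ext face_Times closed_ideal_tensor_ideal)
  have 1: "x \<boxtimes> 1 \<in> ext (V \<times> W) ?T" if "x \<in> ext V I" for x
    using that tensor_ideal_left[OF assms(1,2) IJ]
    by (simp add: ext_def restr_tensor hom_1 hom_restr assms)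
  have 2: "1 \<boxtimes> y \<in> ext (V \<times> W) ?T" if "y \<in> ext W J" for y
    using that tensor_ideal_right[OF assms(1,2) IJ]
    by (simp add: ext_def restr_tensor hom_1 hom_restr assms)
  have "cong_mod (ext (V \<times> W) ?T) (x \<boxtimes> 1) (x' \<boxtimes> 1)" "cong_mod (ext (V \<times> W) ?T) (1 \<boxtimes> y) (1 \<boxtimes> y')"
    using 1 2 assms(5,6) unfolding cong_mod_def
    by (simp_all flip: alg_linear_diff[OF alg_linear_tensor_left] alg_linear_diff[OF alg_linear_tensor_right])
  then show ?thesis
    unfolding tensor_eq_mult[of x y] tensor_eq_mult[of x' y'] by (rule cong_mod_mult[OF T])
qed

section \<open>The ideals defining the quantum affine algebra and its tensor powers\<close>

lemma face_W: "face (W1 N)" "face (W2 N)" "face (W3 N)"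
  by (simp_all add: W1_def W2_def W3_def face_lists face_Times)

lemma gen_supported:
  assumes "i < N"
  shows "e_gen i \<in> supported_on (W1 N)" "f_gen i \<in> supported_on (W1 N)" "h_gen N i \<in> supported_on (W1 N)"
proof -
  have "Gen_e i \<in> aff_gens N" "Gen_f i \<in> aff_gens N"
    using assms by (cases "i = 0"; auto simp: aff_gens_def cur_gens_def fin_gens_def)+
  then show "e_gen i \<in> supported_on (W1 N)" "f_gen i \<in> supported_on (W1 N)"
    by (simp_all add: e_gen_def f_gen_def W1_def supported_on_mon)
  have "mon [Gen_h j] \<in> supported_on (W1 N)" if "j \<in> {1..<N}" for j
    using that by (simp add: W1_def supported_on_mon aff_gens_def cur_gens_def fin_gens_def)
  then show "h_gen N i \<in> supported_on (W1 N)"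
    using assms by (auto simp: h_gen_def intro!: supported_on_uminus supported_on_sum)
qed

lemma relations_supported: "relations N \<subseteq> supported_on (W1 N)"
proof -
  have m: "submon (W1 N)" by (intro face_submon face_W)
  note [intro] = supported_on_mult[OF m] supported_on_power[OF m] supported_on_scal[OF m]
    supported_on_of_int[OF m] gen_supported supported_on_qbracket[OF m]
  show ?thesis
    unfolding relations_def commutator_def serre_def by (auto intro!: supported_on_add supported_on_diff)
qed

lemma closed_ideal_I1: "closed_ideal (W1 N) (I1 N)"
  and relations_I1: "relations N \<subseteq> I1 N"
  unfolding I1_def
  by (rule closed_ideal_closure_genideal[OF face_submon[OF face_W(1)] relations_supported])+

lemma I1_supported: "I1 N \<subseteq> supported_on (W1 N)"
  using closed_ideal_I1 by (simp add: closed_ideal_def)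

lemma closed_ideal_I2: "closed_ideal (W2 N) (I2 N)"
  unfolding I2_def W2_def by (intro closed_ideal_tensor_ideal face_W I1_supported)

lemma I2_supported: "I2 N \<subseteq> supported_on (W2 N)"
  using closed_ideal_I2 by (simp add: closed_ideal_def)

lemma closed_ideal_I3: "closed_ideal (W3 N) (I3 N)"
  unfolding I3_def W3_def by (intro closed_ideal_tensor_ideal face_W I1_supported I2_supported)

text \<open>Congruences are multiplied modulo \<open>J1\<close>, \<open>J2\<close>,
  \<open>J3\<close>, which are ideals of the whole rings; equality of residue classes concerns
  \<open>I1\<close>, \<open>I2\<close>, \<open>I3\<close>. On elements of the right support the two
  notions agree.\<close>

definition J1 where "J1 N = ext (W1 N) (I1 N)"
definition J2 where "J2 N = ext (W2 N) (I2 N)"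
definition J3 where "J3 N = ext (W3 N) (I3 N)"

lemma two_sided_J: "two_sided (J1 N)" "two_sided (J2 N)" "two_sided (J3 N)"
  unfolding J1_def J2_def J3_def
  by (intro two_sided_ext face_W closed_ideal_I1 closed_ideal_I2 closed_ideal_I3)+

lemma hclosed_J: "hclosed (J1 N)" "hclosed (J2 N)" "hclosed (J3 N)"
  unfolding J1_def J2_def J3_def
  by (intro hclosed_ext face_W closed_ideal_I1 closed_ideal_I2 closed_ideal_I3)+

lemma I_subset_J: "x \<in> I1 N \<Longrightarrow> x \<in> J1 N" "y \<in> I2 N \<Longrightarrow> y \<in> J2 N" "z \<in> I3 N \<Longrightarrow> z \<in> J3 N"
  using closed_ideal_I1[of N] closed_ideal_I2[of N] closed_ideal_I3[of N]
  by (auto simp: J1_def J2_def J3_def ext_iff closed_ideal_def subset_iff)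

lemma cong_mod_tensor2: "cong_mod (J1 N) x x' \<Longrightarrow> cong_mod (J1 N) y y' \<Longrightarrow> cong_mod (J2 N) (x \<boxtimes> y) (x' \<boxtimes> y')"
  unfolding J1_def J2_def I2_def W2_def by (intro cong_mod_tensor face_W closed_ideal_I1)

lemma cong_mod_tensor3: "cong_mod (J1 N) x x' \<Longrightarrow> cong_mod (J2 N) y y' \<Longrightarrow> cong_mod (J3 N) (x \<boxtimes> y) (x' \<boxtimes> y')"
  unfolding J1_def J2_def J3_def I3_def W3_def by (intro cong_mod_tensor face_W closed_ideal_I1 closed_ideal_I2)

section \<open>The coproduct respects the relations\<close>

lemma cartan_sym: "cartan N i j = cartan N j i"
  by (auto simp: cartan_def)

context
  fixes N :: nat
begin

private abbreviation (input) "e \<equiv> e_gen"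
private abbreviation (input) "f \<equiv> f_gen"
private abbreviation (input) "h \<equiv> h_gen N"
private abbreviation (input) "K i \<equiv> qexp (h_gen N i)"
private abbreviation (input) "K' i \<equiv> qexp (- h_gen N i)"
private abbreviation (input) "\<Delta> \<equiv> coprod_free N"
private abbreviation (input) "a i j \<equiv> cartan N i j"
private abbreviation (input) "q n \<equiv> scal (fps_exp (of_int n))"

lemma relation_J1: "x \<in> relations N \<Longrightarrow> x \<in> J1 N"
  using relations_I1 I_subset_J(1) by blast

lemma
  assumes "i < N" "j < N"
  shows relation_he: "h i * e j - e j * h i - of_int (a i j) * e j \<in> J1 N"
    and relation_hf: "h i * f j - f j * h i + of_int (a i j) * f j \<in> J1 N"
    and relation_hh: "cong_mod (J1 N) (h i * h j) (h j * h i)"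
    and relation_ef: "i \<noteq> j \<Longrightarrow> e i * f j - f j * e i \<in> J1 N"
    and relation_ef_same: "e i * f i - f i * e i - qbracket (h i) \<in> J1 N"
    and relation_ee: "a i j = 0 \<Longrightarrow> cong_mod (J1 N) (e i * e j) (e j * e i)"
    and relation_ff: "a i j = 0 \<Longrightarrow> cong_mod (J1 N) (f i * f j) (f j * f i)"
    and relation_serre_e: "a i j = -1 \<Longrightarrow> serre (e i) (e j) \<in> J1 N"
    and relation_serre_f: "a i j = -1 \<Longrightarrow> serre (f i) (f j) \<in> J1 N"
proof -
  note r = relation_J1[unfolded relations_def commutator_def]
  show "h i * e j - e j * h i - of_int (a i j) * e j \<in> J1 N" by (rule r) (use assms in blast)
  show "h i * f j - f j * h i + of_int (a i j) * f j \<in> J1 N" by (rule r) (use assms in blast)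
  show "cong_mod (J1 N) (h i * h j) (h j * h i)" unfolding cong_mod_def by (rule r) (use assms in blast)
  show "e i * f j - f j * e i \<in> J1 N" if "i \<noteq> j" by (rule r) (use assms that in blast)
  show "e i * f i - f i * e i - qbracket (h i) \<in> J1 N" by (rule r) (use assms in blast)
  show "cong_mod (J1 N) (e i * e j) (e j * e i)" if "a i j = 0" unfolding cong_mod_def by (rule r) (use assms that in blast)
  show "cong_mod (J1 N) (f i * f j) (f j * f i)" if "a i j = 0" unfolding cong_mod_def by (rule r) (use assms that in blast)
  show "serre (e i) (e j) \<in> J1 N" if "a i j = -1" by (rule r) (use assms that in blast)
  show "serre (f i) (f j) \<in> J1 N" if "a i j = -1" by (rule r) (use assms that in blast)
qed

lemma cong_mod_qexp:
  assumes "cong_mod (J1 N) (x * y) (y * x)"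
  shows "cong_mod (J1 N) (qexp x * y) (y * qexp x)"
  using qexp_commute_cong_mod[OF two_sided_J(1) hclosed_J(1), of N x y 0] assms by simp

lemma cong_mod_uminus:
  assumes "cong_mod (J1 N) (x * y) (y * x)"
  shows "cong_mod (J1 N) (- x * y) (y * - x)"
  using two_sided_uminus[OF two_sided_J(1)] assms by (simp add: cong_mod_def) fastforce

text \<open>All of these exponentiate the linear relations for \<open>h i\<close> and
  \<open>- h i\<close>: a commutation with weight a turns into one with factor q^a. Two exponentials
  commute by applying this once to each of them.\<close>

lemma
  assumes "i < N" "j < N"
  shows qexp_h_h: "cong_mod (J1 N) (K i * h j) (h j * K i)"
    and qexp_minus_h_h: "cong_mod (J1 N) (K' i * h j) (h j * K' i)"
    and qexp_h_qexp_h: "cong_mod (J1 N) (K i * K j) (K j * K i)"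
    and qexp_minus_h_qexp_minus_h: "cong_mod (J1 N) (K' i * K' j) (K' j * K' i)"
    and qexp_h_e: "cong_mod (J1 N) (K i * e j) (q (a i j) * (e j * K i))"
    and qexp_minus_h_e: "cong_mod (J1 N) (K' i * e j) (q (- a i j) * (e j * K' i))"
    and qexp_h_f: "cong_mod (J1 N) (K i * f j) (q (- a i j) * (f j * K i))"
    and qexp_minus_h_f: "cong_mod (J1 N) (K' i * f j) (q (a i j) * (f j * K' i))"
proof -
  note J = two_sided_J(1) hclosed_J(1)
  note sym = cong_mod_sym[OF J(1)]
  have qexp_h_h: "cong_mod (J1 N) (K i * h j) (h j * K i)" if "i < N" "j < N" for i j
    using that by (intro cong_mod_qexp relation_hh)
  have qexp_minus_h_h: "cong_mod (J1 N) (K' i * h j) (h j * K' i)" if "i < N" "j < N" for i j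
    using that by (intro cong_mod_qexp cong_mod_uminus relation_hh)
  show "cong_mod (J1 N) (K i * h j) (h j * K i)" "cong_mod (J1 N) (K' i * h j) (h j * K' i)"
    by (intro qexp_h_h qexp_minus_h_h assms)+
  show "cong_mod (J1 N) (K i * K j) (K j * K i)"
    by (intro cong_mod_qexp sym[OF qexp_h_h] assms)
  show "cong_mod (J1 N) (K' i * K' j) (K' j * K' i)"
    by (intro cong_mod_qexp cong_mod_uminus sym[OF qexp_minus_h_h] assms)
  have "cong_mod (J1 N) (h i * e j) (e j * h i + of_int (a i j) * e j)"
    "cong_mod (J1 N) (h i * f j) (f j * h i + of_int (- a i j) * f j)"
    using relation_he[OF assms] relation_hf[OF assms] by (simp_all add: cong_mod_def algebra_simps)
  then show "cong_mod (J1 N) (K i * e j) (q (a i j) * (e j * K i))"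
    "cong_mod (J1 N) (K i * f j) (q (- a i j) * (f j * K i))"
    by - (rule qexp_commute_cong_mod[OF J], assumption)+
  have "cong_mod (J1 N) (- h i * e j) (e j * - h i + of_int (- a i j) * e j)"
    "cong_mod (J1 N) (- h i * f j) (f j * - h i + of_int (a i j) * f j)"
    using two_sided_uminus[OF J(1) relation_he[OF assms]] two_sided_uminus[OF J(1) relation_hf[OF assms]]
    by (simp_all add: cong_mod_def algebra_simps)
  then show "cong_mod (J1 N) (K' i * e j) (q (- a i j) * (e j * K' i))"
    "cong_mod (J1 N) (K' i * f j) (q (a i j) * (f j * K' i))"
    by - (rule qexp_commute_cong_mod[OF J], assumption)+
qed

section \<open>Coproducts of generators, exponentials and brackets\<close>

lemma hom_coprod: "alg_hom \<Delta>"
  unfolding coprod_free_def by (rule hom_lin_prod_list)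

lemma coprod_mon: "\<Delta> (mon [g]) = coprod_gen N g"
  by (simp add: coprod_free_def)

lemma coprod_e: "\<Delta> (e i) = e i \<boxtimes> 1 + K' i \<boxtimes> e i"
  and coprod_f: "\<Delta> (f i) = f i \<boxtimes> K i + 1 \<boxtimes> f i"
  by (simp_all add: e_gen_def f_gen_def coprod_mon)

lemma coprod_h: "\<Delta> (h i) = h i \<boxtimes> 1 + 1 \<boxtimes> h i"
proof (cases "i = 0")
  case True
  then show ?thesis
    by (simp add: h_gen_def hom_simps hom_coprod coprod_mon sum.distrib
      alg_linear_uminus[OF alg_linear_tensor_left] alg_linear_uminus[OF alg_linear_tensor_right]
      alg_linear_sum[OF alg_linear_tensor_left] alg_linear_sum[OF alg_linear_tensor_right])
qed (simp add: h_gen_def coprod_mon)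

lemma tensor_commutes: "(x \<boxtimes> 1) * (1 \<boxtimes> y) = (1 \<boxtimes> y) * (x \<boxtimes> 1)"
  by (simp add: tensor_mult_tensor)

lemma qexp_tensor_left: "qexp (x \<boxtimes> 1) = qexp x \<boxtimes> 1"
  and qexp_tensor_right: "qexp (1 \<boxtimes> y) = 1 \<boxtimes> qexp y"
  by (simp_all add: hom_qexp[OF hom_tensor_left] hom_qexp[OF hom_tensor_right])

lemma qexp_tensor: "qexp (x \<boxtimes> 1 + 1 \<boxtimes> y) = qexp x \<boxtimes> qexp y"
  by (simp add: qexp_add tensor_commutes qexp_tensor_left qexp_tensor_right tensor_mult_tensor)

lemma coprod_K: "\<Delta> (K i) = K i \<boxtimes> K i" "\<Delta> (K' i) = K' i \<boxtimes> K' i"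
proof -
  show "\<Delta> (K i) = K i \<boxtimes> K i" by (simp add: hom_qexp[OF hom_coprod] coprod_h qexp_tensor)
  have "\<Delta> (- h i) = (- h i) \<boxtimes> 1 + 1 \<boxtimes> (- h i)"
    by (simp add: hom_simps hom_coprod coprod_h alg_linear_uminus[OF alg_linear_tensor_left] alg_linear_uminus[OF alg_linear_tensor_right])
  then show "\<Delta> (K' i) = K' i \<boxtimes> K' i" by (simp add: hom_qexp[OF hom_coprod] qexp_tensor)
qed

text \<open>This is \<open>qbracket_add\<close> for the commuting elements
  \<open>h i \<boxtimes> 1\<close> and \<open>1 \<boxtimes> h i\<close>; the two terms match those
  in the coproduct of the commutator of \<open>e i\<close> and \<open>f i\<close>.\<close>

lemma coprod_qbracket: "\<Delta> (qbracket (h i)) = qbracket (h i) \<boxtimes> K i + K' i \<boxtimes> qbracket (h i)"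
proof -
  have "\<Delta> (qbracket (h i)) = qbracket (h i \<boxtimes> 1 + 1 \<boxtimes> h i)"
    by (simp add: hom_qbracket[OF hom_coprod] coprod_h)
  also have "\<dots> = (qbracket (h i) \<boxtimes> 1) * (1 \<boxtimes> K i) + (K' i \<boxtimes> 1) * (1 \<boxtimes> qbracket (h i))"
    by (simp add: qbracket_add[OF tensor_commutes] qexp_tensor_left qexp_tensor_right
      hom_qbracket[OF hom_tensor_left, symmetric] hom_qbracket[OF hom_tensor_right, symmetric]
      flip: alg_linear_uminus[OF alg_linear_tensor_left])
  finally show ?thesis by (simp add: tensor_mult_tensor)
qed

lemmas tensor_linear = alg_linear_add[OF alg_linear_tensor_left] alg_linear_add[OF alg_linear_tensor_right]
  alg_linear_diff[OF alg_linear_tensor_left] alg_linear_diff[OF alg_linear_tensor_right]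
  alg_linear_uminus[OF alg_linear_tensor_left] alg_linear_uminus[OF alg_linear_tensor_right]
  alg_linear_scal[OF alg_linear_tensor_left] alg_linear_scal[OF alg_linear_tensor_right]

lemma tensor_of_int: "(of_int n * x) \<boxtimes> y = of_int n * (x \<boxtimes> y)" "x \<boxtimes> (of_int n * y) = of_int n * (x \<boxtimes> y)"
  using alg_linear_scal[OF alg_linear_tensor_left, of "of_int n" x y] alg_linear_scal[OF alg_linear_tensor_right, of x "of_int n" y]
  by (simp_all add: scal_of_int)

lemma J2_left: "x \<in> J1 N \<Longrightarrow> x \<boxtimes> y \<in> J2 N"
  using cong_mod_tensor2[of N x 0 y y] cong_mod_refl[OF two_sided_J(1)] by (simp add: cong_mod_def alg_linear_0[OF alg_linear_tensor_left])

lemma J2_right: "y \<in> J1 N \<Longrightarrow> x \<boxtimes> y \<in> J2 N"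
  using cong_mod_tensor2[of N x x y 0] cong_mod_refl[OF two_sided_J(1)] by (simp add: cong_mod_def alg_linear_0[OF alg_linear_tensor_right])

lemmas J2_add = two_sided_add[OF two_sided_J(2)[of N]]
lemmas coprod_simps = hom_simps[OF hom_coprod] coprod_e coprod_f coprod_h coprod_K coprod_qbracket

section \<open>Images of the quadratic relations under the coproduct\<close>

lemma coprod_hh: "i < N \<Longrightarrow> j < N \<Longrightarrow> \<Delta> (h i * h j - h j * h i) \<in> J2 N"
proof -
  assume "i < N" "j < N"
  then have r: "h i * h j - h j * h i \<in> J1 N" using relation_hh by (simp add: cong_mod_def)
  have "\<Delta> (h i * h j - h j * h i) = (h i * h j - h j * h i) \<boxtimes> 1 + 1 \<boxtimes> (h i * h j - h j * h i)"
    by (simp add: coprod_simps distrib_left distrib_right tensor_mult_tensor tensor_linear)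
  with r show ?thesis by (simp only: J2_add J2_left J2_right)
qed

text \<open>Besides the relation in each leg there appears a commutator of \<open>h i\<close> with
  \<open>K' j\<close>, which vanishes in the quotient because the Cartan generators commute.\<close>

lemma coprod_he:
  assumes "i < N" "j < N"
  shows "\<Delta> (h i * e j - e j * h i - of_int (a i j) * e j) \<in> J2 N"
proof -
  have "\<Delta> (h i * e j - e j * h i - of_int (a i j) * e j) = (h i * e j - e j * h i - of_int (a i j) * e j) \<boxtimes> 1
     + (h i * K' j - K' j * h i) \<boxtimes> e j + K' j \<boxtimes> (h i * e j - e j * h i - of_int (a i j) * e j)"
    by (simp add: coprod_simps distrib_left distrib_right tensor_mult_tensor tensor_linear tensor_of_int)
  moreover have "h i * K' j - K' j * h i \<in> J1 N"
    using cong_mod_sym[OF two_sided_J(1) qexp_minus_h_h[OF assms(2,1)]] by (simp add: cong_mod_def)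
  ultimately show ?thesis using relation_he[OF assms] by (simp only: J2_add J2_left J2_right)
qed

lemma coprod_hf:
  assumes "i < N" "j < N"
  shows "\<Delta> (h i * f j - f j * h i + of_int (a i j) * f j) \<in> J2 N"
proof -
  have "\<Delta> (h i * f j - f j * h i + of_int (a i j) * f j) = (h i * f j - f j * h i + of_int (a i j) * f j) \<boxtimes> K j
     + f j \<boxtimes> (h i * K j - K j * h i) + 1 \<boxtimes> (h i * f j - f j * h i + of_int (a i j) * f j)"
    by (simp add: coprod_simps distrib_left distrib_right tensor_mult_tensor tensor_linear tensor_of_int)
  moreover have "h i * K j - K j * h i \<in> J1 N"
    using cong_mod_sym[OF two_sided_J(1) qexp_h_h[OF assms(2,1)]] by (simp add: cong_mod_def)
  ultimately show ?thesis using relation_hf[OF assms] by (simp only: J2_add J2_left J2_right)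
qed

text \<open>Normalising the first leg on one side and the second leg on the other gives the factors
  q^(a_ij) and q^(a_ji), which agree because the Cartan matrix is symmetric.\<close>

lemma coprod_ef_cross:
  assumes "i < N" "j < N"
  shows "cong_mod (J2 N) ((K' i * f j) \<boxtimes> (e i * K j)) ((f j * K' i) \<boxtimes> (K j * e i))"
proof -
  have "cong_mod (J2 N) ((K' i * f j) \<boxtimes> (e i * K j)) ((q (a i j) * (f j * K' i)) \<boxtimes> (e i * K j))"
    by (intro cong_mod_tensor2 qexp_minus_h_f assms cong_mod_refl[OF two_sided_J(1)])
  moreover have "cong_mod (J2 N) ((f j * K' i) \<boxtimes> (K j * e i)) ((f j * K' i) \<boxtimes> (q (a j i) * (e i * K j)))"
    by (intro cong_mod_tensor2 qexp_h_e assms cong_mod_refl[OF two_sided_J(1)])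
  ultimately show ?thesis
    unfolding tensor_linear cartan_sym[of N j i]
    by (rule cong_mod_trans[OF two_sided_J(2) _ cong_mod_sym[OF two_sided_J(2)]])
qed

lemma coprod_ef:
  assumes "i < N" "j < N" "i \<noteq> j"
  shows "\<Delta> (e i * f j - f j * e i) \<in> J2 N"
proof -
  have "\<Delta> (e i * f j - f j * e i) = (e i * f j - f j * e i) \<boxtimes> K j + K' i \<boxtimes> (e i * f j - f j * e i)
    + ((K' i * f j) \<boxtimes> (e i * K j) - (f j * K' i) \<boxtimes> (K j * e i))"
    by (simp add: coprod_simps distrib_left distrib_right tensor_mult_tensor tensor_linear)
  with coprod_ef_cross[OF assms(1,2)] relation_ef[OF assms] show ?thesis
    by (simp only: J2_add J2_left J2_right cong_mod_def)
qed

text \<open>By \<open>coprod_qbracket\<close> the brackets come with the same companions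
  \<open>K i\<close> and \<open>K' i\<close> as the two commutators, so the relation reappears in
  each leg.\<close>

lemma coprod_ef_same:
  assumes "i < N"
  shows "\<Delta> (e i * f i - f i * e i - qbracket (h i)) \<in> J2 N"
proof -
  have "\<Delta> (e i * f i - f i * e i - qbracket (h i)) =
      (e i * f i - f i * e i - qbracket (h i)) \<boxtimes> K i + K' i \<boxtimes> (e i * f i - f i * e i - qbracket (h i))
    + ((K' i * f i) \<boxtimes> (e i * K i) - (f i * K' i) \<boxtimes> (K i * e i))"
    by (simp add: coprod_simps distrib_left distrib_right tensor_mult_tensor tensor_linear)
  with coprod_ef_cross[OF assms assms] relation_ef_same[OF assms assms] show ?thesis
    by (simp only: J2_add J2_left J2_right cong_mod_def)
qed

lemma coprod_ee:
  assumes "i < N" "j < N" "a i j = 0"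
  shows "\<Delta> (e i * e j - e j * e i) \<in> J2 N"
proof -
  have *: "e i * e j - e j * e i \<in> J1 N" "K' j * e i - e i * K' j \<in> J1 N" "K' i * e j - e j * K' i \<in> J1 N"
    using relation_ee[OF assms] qexp_minus_h_e[OF assms(2,1)] qexp_minus_h_e[OF assms(1,2)] assms(3)
    by (simp_all add: cong_mod_def cartan_sym[of N j i])
  have "cong_mod (J2 N) ((K' i * K' j) \<boxtimes> (e i * e j)) ((K' j * K' i) \<boxtimes> (e j * e i))"
    by (intro cong_mod_tensor2 qexp_minus_h_qexp_minus_h relation_ee assms)
  then have **: "(K' i * K' j) \<boxtimes> (e i * e j) - (K' j * K' i) \<boxtimes> (e j * e i) \<in> J2 N"
    by (simp add: cong_mod_def)
  have "\<Delta> (e i * e j - e j * e i) = (e i * e j - e j * e i) \<boxtimes> 1 + (K' i * e j - e j * K' i) \<boxtimes> e i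
      + ((K' i * K' j) \<boxtimes> (e i * e j) - (K' j * K' i) \<boxtimes> (e j * e i)) - (K' j * e i - e i * K' j) \<boxtimes> e j"
    by (simp add: coprod_simps distrib_left distrib_right tensor_mult_tensor tensor_linear)
  with * ** show ?thesis
    by (simp only: J2_add J2_left J2_right two_sided_diff[OF two_sided_J(2)])
qed

lemma coprod_ff:
  assumes "i < N" "j < N" "a i j = 0"
  shows "\<Delta> (f i * f j - f j * f i) \<in> J2 N"
proof -
  have *: "f i * f j - f j * f i \<in> J1 N" "K j * f i - f i * K j \<in> J1 N" "K i * f j - f j * K i \<in> J1 N"
    using relation_ff[OF assms] qexp_h_f[OF assms(2,1)] qexp_h_f[OF assms(1,2)] assms(3)
    by (simp_all add: cong_mod_def cartan_sym[of N j i])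
  have "cong_mod (J2 N) ((f i * f j) \<boxtimes> (K i * K j)) ((f j * f i) \<boxtimes> (K j * K i))"
    by (intro cong_mod_tensor2 qexp_h_qexp_h relation_ff assms)
  then have **: "(f i * f j) \<boxtimes> (K i * K j) - (f j * f i) \<boxtimes> (K j * K i) \<in> J2 N"
    by (simp add: cong_mod_def)
  have "\<Delta> (f i * f j - f j * f i) = 1 \<boxtimes> (f i * f j - f j * f i) + f i \<boxtimes> (K i * f j - f j * K i)
      + ((f i * f j) \<boxtimes> (K i * K j) - (f j * f i) \<boxtimes> (K j * K i)) - f j \<boxtimes> (K j * f i - f i * K j)"
    by (simp add: coprod_simps distrib_left distrib_right tensor_mult_tensor tensor_linear)
  with * ** show ?thesis
    by (simp only: J2_add J2_left J2_right two_sided_diff[OF two_sided_J(2)])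
qed

section \<open>Images of the Serre relations under the coproduct\<close>

lemma serre_eq_qserre: "serre x y = qserre (fps_exp 1) (fps_exp (-1)) x y"
  "serre x y = qserre (fps_exp (-1)) (fps_exp 1) x y"
  by (simp_all add: serre_def qserre_def power2_eq_square mult.assoc add.commute)

lemma fps_exp_inverse: "fps_exp 1 * fps_exp (-1) = (1 :: complex fps)" "fps_exp (-1) * fps_exp 1 = (1 :: complex fps)"
  by (simp_all flip: fps_exp_add_mult)

lemma fps_exp_minus_2: "fps_exp (-2) = fps_exp (-1) * (fps_exp (-1) :: complex fps)" "fps_exp 2 = fps_exp 1 * (fps_exp 1 :: complex fps)"
  by (simp_all flip: fps_exp_add_mult)

lemma cong_mod_J2_eq_mod:
  assumes "cong_mod (J2 N) x y" "y \<in> J2 N"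
  shows "x \<in> J2 N"
  using two_sided_add[OF two_sided_J(2)] assms unfolding cong_mod_def by fastforce

text \<open>The four summands of \<Delta>(\<open>e i\<close>) and \<Delta>(\<open>e j\<close>)
  q-commute as \<open>qserre_cross\<close> demands with s = q: the diagonal Cartan entry 2 gives the
  factor q^-2, the entry -1 gives q. What remains is the Serre relation in one leg at a
  time.\<close>

lemma coprod_serre_e:
  assumes "i < N" "j < N" "a i j = -1"
  shows "\<Delta> (serre (e i) (e j)) \<in> J2 N"
proof -
  let ?S = "qserre (fps_exp 1) (fps_exp (-1)) :: alg2 \<Rightarrow> _"
  let ?A = "e i \<boxtimes> 1" and ?B = "K' i \<boxtimes> e i" and ?C = "e j \<boxtimes> 1" and ?D = "K' j \<boxtimes> e j"
  note refl = cong_mod_refl[OF two_sided_J(1)]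
  have a: "a i i = 2" "a j i = -1" using assms(3) by (simp add: cartan_def, simp add: cartan_sym[of N j i])
  have "\<Delta> (serre (e i) (e j)) = ?S (?A + ?B) (?C + ?D)"
    by (simp add: serre_eq_qserre(1) qserre_def coprod_simps)
  moreover have "cong_mod (J2 N) (?S (?A + ?B) (?C + ?D)) (?S ?A ?C + ?S ?B ?D)"
  proof (rule qserre_cross[OF two_sided_J(2) fps_exp_inverse(1)])
    have "cong_mod (J2 N) (?B * ?A) ((q (- a i i) * (e i * K' i)) \<boxtimes> (e i * 1))"
      unfolding tensor_mult_tensor by (intro cong_mod_tensor2 qexp_minus_h_e assms) (simp add: refl)
    then show "cong_mod (J2 N) (?B * ?A) (scal (fps_exp (- 1) * fps_exp (- 1)) * (?A * ?B))"
      by (simp add: tensor_mult_tensor tensor_linear a fps_exp_minus_2)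
    have "cong_mod (J2 N) (?B * ?C) ((q (- a i j) * (e j * K' i)) \<boxtimes> (e i * 1))"
      unfolding tensor_mult_tensor by (intro cong_mod_tensor2 qexp_minus_h_e assms refl)
    then show "cong_mod (J2 N) (?B * ?C) (scal (fps_exp 1) * (?C * ?B))"
      by (simp add: tensor_mult_tensor tensor_linear assms(3))
    have "cong_mod (J2 N) (?D * ?A) ((q (- a j i) * (e i * K' j)) \<boxtimes> (e j * 1))"
      unfolding tensor_mult_tensor by (intro cong_mod_tensor2 qexp_minus_h_e assms refl)
    then show "cong_mod (J2 N) (?D * ?A) (scal (fps_exp 1) * (?A * ?D))"
      by (simp add: tensor_mult_tensor tensor_linear a)
  qed
  moreover have "?S ?A ?C + ?S ?B ?D \<in> J2 N"
  proof (rule J2_add)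
    have "?S ?A ?C = serre (e i) (e j) \<boxtimes> 1"
      by (simp add: serre_eq_qserre(1) qserre_def tensor_mult_tensor tensor_linear)
    then show "?S ?A ?C \<in> J2 N" using relation_serre_e[OF assms] by (simp add: J2_left)
    \<comment> \<open>Reordering the commuting exponentials gives the three terms a common first
      leg, so that the Serre expression appears in the second.\<close>
    let ?k = "K' i * K' i * K' j"
    have k: "cong_mod (J1 N) (K' i * K' j * K' i) ?k"
      using cong_mod_mult[OF two_sided_J(1) refl qexp_minus_h_qexp_minus_h[OF assms(2,1)], of "K' i"] by (simp add: mult.assoc)
    have k': "cong_mod (J1 N) (K' j * K' i * K' i) ?k"
      using cong_mod_mult[OF two_sided_J(1) qexp_minus_h_qexp_minus_h[OF assms(2,1)] refl, of "K' i"]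
      by (rule cong_mod_trans[OF two_sided_J(1) _ k])
    have "cong_mod (J2 N) (?S ?B ?D) (?k \<boxtimes> (e i * e i * e j) - scal (fps_exp 1 + fps_exp (-1)) * (?k \<boxtimes> (e i * e j * e i)) + ?k \<boxtimes> (e j * e i * e i))"
      unfolding qserre_def tensor_mult_tensor
      by (intro cong_mod_add[OF two_sided_J(2)] cong_mod_diff[OF two_sided_J(2)] cong_mod_mult[OF two_sided_J(2) cong_mod_refl[OF two_sided_J(2)]]
        cong_mod_tensor2 k k' refl)
    moreover have "?k \<boxtimes> (e i * e i * e j) - scal (fps_exp 1 + fps_exp (-1)) * (?k \<boxtimes> (e i * e j * e i)) + ?k \<boxtimes> (e j * e i * e i) = ?k \<boxtimes> serre (e i) (e j)"
      by (simp add: serre_eq_qserre(1) qserre_def tensor_linear)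
    ultimately show "?S ?B ?D \<in> J2 N"
      using J2_right[OF relation_serre_e[OF assms]] cong_mod_J2_eq_mod by metis
  qed
  ultimately show ?thesis using cong_mod_J2_eq_mod by metis
qed

text \<open>Here the exponentials stand in the second leg and in the summands \<open>A\<close> and
  \<open>C\<close>. The rules come out for the products in the opposite order, so the scalars have
  to be inverted and s = q^-1.\<close>

lemma coprod_serre_f:
  assumes "i < N" "j < N" "a i j = -1"
  shows "\<Delta> (serre (f i) (f j)) \<in> J2 N"
proof -
  let ?S = "qserre (fps_exp (-1)) (fps_exp 1) :: alg2 \<Rightarrow> _"
  let ?A = "f i \<boxtimes> K i" and ?B = "1 \<boxtimes> f i" and ?C = "f j \<boxtimes> K j" and ?D = "1 \<boxtimes> f j"
  note refl = cong_mod_refl[OF two_sided_J(1)] and refl2 = cong_mod_refl[OF two_sided_J(2)]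
  have a: "a i i = 2" "a j i = -1" using assms(3) by (simp add: cartan_def, simp add: cartan_sym[of N j i])
  \<comment> \<open>A congruence y = d x is turned into x = c y by means of the inverse scalar c of
    d.\<close>
  have flip: "cong_mod (J2 N) x (scal c * y)" if "cong_mod (J2 N) y (scal d * x)" "c * d = 1" for x y c d
  proof -
    have "cong_mod (J2 N) (scal c * y) (scal c * (scal d * x))"
      by (rule cong_mod_mult[OF two_sided_J(2) refl2 that(1)])
    then show ?thesis
      using that(2) by (simp add: cong_mod_sym[OF two_sided_J(2)] flip: mult.assoc scal_mult)
  qed
  have "\<Delta> (serre (f i) (f j)) = ?S (?A + ?B) (?C + ?D)"
    by (simp add: serre_eq_qserre(2) qserre_def coprod_simps)
  moreover have "cong_mod (J2 N) (?S (?A + ?B) (?C + ?D)) (?S ?A ?C + ?S ?B ?D)"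
  proof (rule qserre_cross[OF two_sided_J(2) fps_exp_inverse(2)])
    have "cong_mod (J2 N) (?A * ?B) ((f i * 1) \<boxtimes> (q (- a i i) * (f i * K i)))"
      unfolding tensor_mult_tensor by (intro cong_mod_tensor2 qexp_h_f assms refl)
    then have "cong_mod (J2 N) (?A * ?B) (scal (fps_exp (-2)) * (?B * ?A))"
      by (simp add: tensor_mult_tensor tensor_linear a)
    then show "cong_mod (J2 N) (?B * ?A) (scal (fps_exp 1 * fps_exp 1) * (?A * ?B))"
      by (rule flip) (simp flip: fps_exp_add_mult)
    have "cong_mod (J2 N) (?C * ?B) ((f j * 1) \<boxtimes> (q (- a j i) * (f i * K j)))"
      unfolding tensor_mult_tensor by (intro cong_mod_tensor2 qexp_h_f assms refl)
    then have "cong_mod (J2 N) (?C * ?B) (scal (fps_exp 1) * (?B * ?C))"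
      by (simp add: tensor_mult_tensor tensor_linear a)
    then show "cong_mod (J2 N) (?B * ?C) (scal (fps_exp (-1)) * (?C * ?B))"
      by (rule flip) (simp flip: fps_exp_add_mult)
    have "cong_mod (J2 N) (?A * ?D) ((f i * 1) \<boxtimes> (q (- a i j) * (f j * K i)))"
      unfolding tensor_mult_tensor by (intro cong_mod_tensor2 qexp_h_f assms refl)
    then have "cong_mod (J2 N) (?A * ?D) (scal (fps_exp 1) * (?D * ?A))"
      by (simp add: tensor_mult_tensor tensor_linear assms(3))
    then show "cong_mod (J2 N) (?D * ?A) (scal (fps_exp (-1)) * (?A * ?D))"
      by (rule flip) (simp flip: fps_exp_add_mult)
  qed
  moreover have "?S ?A ?C + ?S ?B ?D \<in> J2 N"
  proof (rule J2_add)
    have "?S ?B ?D = 1 \<boxtimes> serre (f i) (f j)"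
      by (simp add: serre_eq_qserre(2) qserre_def tensor_mult_tensor tensor_linear)
    then show "?S ?B ?D \<in> J2 N" using relation_serre_f[OF assms] by (simp add: J2_right)
    let ?k = "K i * K i * K j"
    have k: "cong_mod (J1 N) (K i * K j * K i) ?k"
      using cong_mod_mult[OF two_sided_J(1) refl qexp_h_qexp_h[OF assms(2,1)], of "K i"] by (simp add: mult.assoc)
    have k': "cong_mod (J1 N) (K j * K i * K i) ?k"
      using cong_mod_mult[OF two_sided_J(1) qexp_h_qexp_h[OF assms(2,1)] refl, of "K i"]
      by (rule cong_mod_trans[OF two_sided_J(1) _ k])
    have "cong_mod (J2 N) (?S ?A ?C) ((f i * f i * f j) \<boxtimes> ?k - scal (fps_exp (-1) + fps_exp 1) * ((f i * f j * f i) \<boxtimes> ?k) + (f j * f i * f i) \<boxtimes> ?k)"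
      unfolding qserre_def tensor_mult_tensor
      by (intro cong_mod_add[OF two_sided_J(2)] cong_mod_diff[OF two_sided_J(2)] cong_mod_mult[OF two_sided_J(2) refl2]
        cong_mod_tensor2 k k' refl)
    moreover have "(f i * f i * f j) \<boxtimes> ?k - scal (fps_exp (-1) + fps_exp 1) * ((f i * f j * f i) \<boxtimes> ?k) + (f j * f i * f i) \<boxtimes> ?k = serre (f i) (f j) \<boxtimes> ?k"
      by (simp add: serre_eq_qserre(2) qserre_def tensor_linear)
    ultimately show "?S ?A ?C \<in> J2 N"
      using J2_left[OF relation_serre_f[OF assms]] cong_mod_J2_eq_mod by metis
  qed
  ultimately show ?thesis using cong_mod_J2_eq_mod by metis
qed

lemma coprod_relations: "x \<in> relations N \<Longrightarrow> \<Delta> x \<in> J2 N"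
  unfolding relations_def commutator_def
  by (elim UnE CollectE exE conjE; hypsubst)
    (intro coprod_hh coprod_he coprod_hf coprod_ef coprod_ef_same coprod_ee coprod_ff coprod_serre_e coprod_serre_f; assumption)+

lemma coprod_I1_J2: "x \<in> I1 N \<Longrightarrow> \<Delta> x \<in> J2 N"
  unfolding I1_def
  by (rule hom_closure_genideal[OF face_submon[OF face_W(1)] relations_supported hom_coprod two_sided_J(2) hclosed_J(2) coprod_relations])

end

section \<open>Maps into the triple tensor product\<close>

text \<open>These six maps are the maps between free algebras that underlie \<open>leg12\<close>,
  \<open>leg23\<close>, \<open>coprod_id\<close>, \<open>id_coprod\<close>, \<open>proj_id\<close>
  and \<open>proj_id_id\<close>.\<close>

definition L12 :: "alg2 \<Rightarrow> alg3" where "L12 x = reassoc (x \<boxtimes> (1 :: alg1))"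
definition L23 :: "alg2 \<Rightarrow> alg3" where "L23 x = (1 :: alg1) \<boxtimes> x"
definition D12 :: "nat \<Rightarrow> alg2 \<Rightarrow> alg3" where "D12 N x = reassoc (tensor_map (coprod_free N) id x)"
definition D23 :: "nat \<Rightarrow> alg2 \<Rightarrow> alg3" where "D23 N = tensor_map id (coprod_free N)"
definition P2 :: "alg2 \<Rightarrow> alg2" where "P2 = tensor_map proj_free id"
definition P3 :: "alg3 \<Rightarrow> alg3" where "P3 = tensor_map proj_free id"

lemma hom_proj: "alg_hom proj_free"
  unfolding proj_free_def by (rule hom_lin_prod_list)

lemma hom_L12: "alg_hom L12" and hom_L23: "alg_hom L23" and hom_D12: "alg_hom (D12 N)" and hom_D23: "alg_hom (D23 N)"
  and hom_P2: "alg_hom P2" and hom_P3: "alg_hom P3"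
  unfolding L12_def[abs_def] L23_def[abs_def] D12_def[abs_def] D23_def P2_def P3_def
  by (rule hom_comp[OF hom_reassoc hom_tensor_left] hom_tensor_right
      hom_comp[OF hom_reassoc hom_tensor_map[OF hom_coprod hom_id(1)]] hom_tensor_map
      hom_id hom_coprod hom_proj)+

lemma L12_tensor: "L12 (x \<boxtimes> y) = x \<boxtimes> y \<boxtimes> 1"
  and L23_tensor: "L23 (x \<boxtimes> y) = 1 \<boxtimes> x \<boxtimes> y"
  and D23_tensor: "D23 N (x \<boxtimes> y) = x \<boxtimes> coprod_free N y"
  and P2_tensor: "P2 (x \<boxtimes> y) = proj_free x \<boxtimes> y"
  and P3_tensor: "P3 (x \<boxtimes> z) = proj_free x \<boxtimes> z"
  by (simp_all add: L12_def L23_def D23_def P2_def P3_def reassoc_tensor alg_linear_id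
      hom_alg_linear[OF hom_coprod] hom_alg_linear[OF hom_proj])

lemma reassoc_right: "reassoc ((1 :: alg2) \<boxtimes> y) = L23 ((1 :: alg1) \<boxtimes> y)"
  using reassoc_tensor[of "1 :: alg1" "1 :: alg1" y] by (simp add: L23_tensor)

text \<open>The factor \<open>L23 (1 \<boxtimes> y)\<close> is \<open>y\<close> in the third leg.
  This form avoids splitting \<Delta>(x) into pure tensors.\<close>

lemma D12_tensor: "D12 N (x \<boxtimes> y) = L12 (coprod_free N x) * L23 (1 \<boxtimes> y)"
proof -
  have "coprod_free N x \<boxtimes> y = (coprod_free N x \<boxtimes> 1) * (1 \<boxtimes> y)"
    by (rule tensor_eq_mult)
  then show ?thesis
    by (simp add: D12_def L12_def reassoc_right alg_linear_id hom_alg_linear[OF hom_coprod] hom_mult[OF hom_reassoc])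
qed

lemma D12_left: "D12 N (x \<boxtimes> 1) = L12 (coprod_free N x)"
  by (simp add: D12_tensor hom_1[OF hom_L23])

lemma D12_right: "D12 N (1 \<boxtimes> y) = L23 (1 \<boxtimes> y)"
  by (simp add: D12_tensor hom_1[OF hom_L12] hom_1[OF hom_coprod])

lemma D23_left: "D23 N (x \<boxtimes> 1) = L12 (x \<boxtimes> 1)"
  by (simp add: D23_tensor L12_tensor hom_1[OF hom_coprod])

lemma D23_right: "D23 N (1 \<boxtimes> y) = L23 (coprod_free N y)"
  by (simp add: D23_tensor L23_def)

lemma L12_L23: "L12 (1 \<boxtimes> x) = L23 (x \<boxtimes> 1)"
  by (simp add: L12_tensor L23_tensor)

lemma L23_commute_left: "L12 (x \<boxtimes> 1) * L23 z = L23 z * L12 (x \<boxtimes> 1)"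
  by (simp add: L12_tensor L23_def tensor_mult_tensor)

lemma L12_commute_right: "L23 (1 \<boxtimes> y) * L12 z = L12 z * L23 (1 \<boxtimes> y)"
  unfolding reassoc_right[symmetric] L12_def hom_mult[OF hom_reassoc, symmetric] by (simp add: tensor_commute)

text \<open>Both sides are homomorphisms, and on generators the identity holds without any
  relations, because the exponentials are exactly group-like in the free algebra.\<close>

lemma coassoc: "D12 N (coprod_free N x) = D23 N (coprod_free N x)"
proof (rule hom_ext_list[OF hom_comp[OF hom_D12 hom_coprod] hom_comp[OF hom_D23 hom_coprod]])
  fix g
  have e: "mon [Gen_e i] = e_gen i" and f: "mon [Gen_f i] = f_gen i" for i
    by (simp_all add: e_gen_def f_gen_def)
  show "D12 N (coprod_free N (mon [g])) = D23 N (coprod_free N (mon [g]))"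
  proof (cases g)
    case (Gen_e i)
    then show ?thesis
      by (simp add: e coprod_e coprod_K hom_simps hom_D12 hom_D23 D12_tensor D23_tensor hom_coprod
          L12_tensor L23_tensor hom_L12 hom_L23 tensor_mult_tensor tensor_linear distrib_right)
  next
    case (Gen_f i)
    then show ?thesis
      by (simp add: f coprod_f coprod_K hom_simps hom_D12 hom_D23 D12_tensor D23_tensor hom_coprod
          L12_tensor L23_tensor hom_L12 hom_L23 tensor_mult_tensor tensor_linear distrib_right)
  next
    case (Gen_h i)
    then show ?thesis
      by (simp add: coprod_mon hom_simps hom_D12 hom_D23 D12_tensor D23_tensor hom_coprod
          L12_tensor L23_tensor hom_L12 hom_L23 tensor_mult_tensor tensor_linear distrib_right)
  qed
qed

text \<open>The projection acts on the first leg alone, so it passes through maps that leave this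
  leg untouched. It does not pass through \<open>D12\<close>, which splits the first leg; there the
  hypothesis on \<open>\<Psi>\<^sub>1\<close> has to step in.\<close>

lemma P3_L12: "P3 (L12 x) = L12 (P2 x)"
  by (rule hom_ext_prod[OF hom_comp[OF hom_P3 hom_L12] hom_comp[OF hom_L12 hom_P2]])
    (simp_all add: L12_tensor P3_tensor P2_tensor)

lemma P3_L23: "P3 (L23 x) = L23 x"
  by (simp add: L23_def P3_tensor hom_1[OF hom_proj])

lemma P3_D23: "P3 (D23 N x) = D23 N (P2 x)"
  by (rule hom_ext_prod[OF hom_comp[OF hom_P3 hom_D23] hom_comp[OF hom_D23 hom_P2]])
    (simp_all add: D23_tensor P3_tensor P2_tensor)

section \<open>Supports\<close>

lemma hom_lists_supported:
  assumes "alg_hom f" "submon V" and "\<And>g. g \<in> A \<Longrightarrow> f (mon [g]) \<in> supported_on V" and "x \<in> supported_on (lists A)"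
  shows "f x \<in> supported_on V"
proof (rule alg_linear_supported_on[OF hom_alg_linear[OF assms(1)] _ assms(4)])
  fix w assume "w \<in> lists A"
  then show "f (mon w) \<in> supported_on V"
  proof (induction w)
    case Nil
    then show ?case using assms(1,2) by (simp add: mon_Nil hom_1 supported_on_1)
  next
    case (Cons g w)
    then show ?case
      using assms(1-3) by (simp add: mon_Cons[of g w] hom_mult supported_on_mult)
  qed
qed

text \<open>Including every \<open>Gen_h j\<close> is essential for stability under the coproduct:
  \<Delta>(\<open>e\<^sub>0\<close>) involves \<open>h\<^sub>0\<close>, which is a combination of
  all of them.\<close>

definition generator_set :: "nat \<Rightarrow> gen set \<Rightarrow> bool" where
  "generator_set N S \<longleftrightarrow> fin_gens N \<subseteq> S \<and> S \<subseteq> aff_gens N"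

lemma generator_set: "generator_set N (fin_gens N)" "generator_set N (cur_gens N)" "generator_set N (aff_gens N)"
  by (auto simp: generator_set_def aff_gens_def cur_gens_def)

lemma lists_W1: "generator_set N S \<Longrightarrow> lists S \<subseteq> W1 N"
  by (auto simp: generator_set_def W1_def)

lemma coprod_supported:
  assumes S: "generator_set N S" and "x \<in> supported_on (lists S)"
  shows "coprod_free N x \<in> supported_on (lists S \<times> lists S)"
proof (rule hom_lists_supported[OF hom_coprod _ _ assms(2)])
  have m: "submon (lists S)" by (intro face_submon face_lists)
  show "submon (lists S \<times> lists S)" by (intro face_submon face_Times face_lists)
  fix g assume g: "g \<in> S"
  have h: "mon [Gen_h j] \<in> supported_on (lists S)" if "1 \<le> j" "j < N" for j
    using S that by (intro supported_on_mon) (auto simp: generator_set_def fin_gens_def)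
  then have hg: "h_gen N i \<in> supported_on (lists S)" if "i = 0 \<or> (1 \<le> i \<and> i < N)" for i
    using that by (auto simp: h_gen_def intro!: supported_on_uminus supported_on_sum)
  have gm: "mon [g] \<in> supported_on (lists S)" using g by (intro supported_on_mon) simp
  have idx: "i = 0 \<or> (1 \<le> i \<and> i < N)" if "g = Gen_e i \<or> g = Gen_f i \<or> g = Gen_h i" for i
    using that g S by (auto simp: generator_set_def aff_gens_def cur_gens_def fin_gens_def)
  show "coprod_free N (mon [g]) \<in> supported_on (lists S \<times> lists S)"
    using gm hg[OF idx]
    by (cases g) (auto simp: coprod_mon e_gen_def f_gen_def
        intro!: supported_on_add supported_on_tensor supported_on_1 supported_on_qexp supported_on_uminus m)
qed

lemma tensor_map_supported:
  fixes x :: "('v::monoid_add \<times> 'w::monoid_add) alg"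
  assumes "\<And>u. u \<in> S \<Longrightarrow> f (mon u) \<in> supported_on V" "\<And>u. u \<in> T \<Longrightarrow> g (mon u) \<in> supported_on W"
    and "x \<in> supported_on (S \<times> T)"
  shows "tensor_map f g x \<in> supported_on (V \<times> W)"
  by (rule alg_linear_supported_on[OF _ _ assms(3)])
    (auto simp: tensor_map_def intro!: supported_on_tensor assms(1,2))

lemma reassoc_supported: "x \<in> supported_on ((U \<times> V) \<times> W) \<Longrightarrow> reassoc x \<in> supported_on (U \<times> V \<times> W)"
  by (rule alg_linear_supported_on[OF hom_alg_linear[OF hom_reassoc]]) (auto simp: reassoc_def supported_on_mon)

lemma
  assumes S: "generator_set N S" and x: "x \<in> supported_on (lists S \<times> W1 N)"
  shows L12_supported: "L12 x \<in> supported_on (lists S \<times> W2 N)"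
    and L23_supported: "L23 x \<in> supported_on (lists S \<times> W2 N)"
    and D12_supported: "D12 N x \<in> supported_on (lists S \<times> W2 N)"
    and D23_supported: "D23 N x \<in> supported_on (lists S \<times> W2 N)"
proof -
  have 1: "(1 :: alg1) \<in> supported_on (W1 N)" "1 \<in> supported_on (lists S)"
    by (simp_all add: supported_on_1 face_submon face_W face_lists)
  show "L12 x \<in> supported_on (lists S \<times> W2 N)"
    unfolding L12_def W2_def by (intro reassoc_supported supported_on_tensor x 1)
  have "x \<in> supported_on (W2 N)"
    by (rule supported_on_mono[OF _ x]) (use lists_W1[OF S] in \<open>auto simp: W2_def\<close>)
  then show "L23 x \<in> supported_on (lists S \<times> W2 N)"
    unfolding L23_def by (intro supported_on_tensor 1)
  have "D12 N x \<in> supported_on (lists S \<times> lists S \<times> W1 N)"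
    unfolding D12_def
    by (rule reassoc_supported, rule tensor_map_supported[OF _ _ x])
      (simp_all add: coprod_supported[OF S] supported_on_mon)
  then show "D12 N x \<in> supported_on (lists S \<times> W2 N)"
    by (rule supported_on_mono[rotated]) (use lists_W1[OF S] in \<open>auto simp: W2_def\<close>)
  have "W1 N = lists (aff_gens N)" by (simp add: W1_def)
  then show "D23 N x \<in> supported_on (lists S \<times> W2 N)"
    unfolding D23_def W2_def using coprod_supported[OF generator_set(3)[of N]]
    by (intro tensor_map_supported[OF _ _ x]) (simp_all add: supported_on_mon)
qed

lemma proj_supported:
  assumes "x \<in> supported_on (lists (cur_gens N))"
  shows "proj_free x \<in> supported_on (lists (fin_gens N))"
  by (rule hom_lists_supported[OF hom_proj face_submon[OF face_lists] _ assms])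
    (auto simp: proj_free_def proj_gen_def cur_gens_def intro!: supported_on_mon)

lemma P2_supported: "x \<in> supported_on (lists (cur_gens N) \<times> W1 N) \<Longrightarrow> P2 x \<in> supported_on (lists (fin_gens N) \<times> W1 N)"
  unfolding P2_def by (rule tensor_map_supported) (simp_all add: proj_supported supported_on_mon)

text \<open>No word in the first leg contains \<open>Gen_e 0\<close>, the only letter on which the
  projection is not the identity.\<close>

lemma P3_fixes:
  assumes "x \<in> supported_on (lists (fin_gens N) \<times> W2 N)"
  shows "P3 x = x"
proof (rule alg_linear_cong_supported_on[OF hom_alg_linear[OF hom_P3] alg_linear_id(2) _ assms])
  fix w :: "word \<times> word \<times> word" assume w: "w \<in> lists (fin_gens N) \<times> W2 N"
  have "prod_list (map proj_gen u) = mon u" if "u \<in> lists (fin_gens N)" for u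
    using that
  proof (induction u)
    case (Cons g u)
    then have "g \<noteq> Gen_e 0" by (auto simp: fin_gens_def)
    with Cons show ?case by (simp add: proj_gen_def mon_Cons[of g u])
  qed (simp add: mon_Nil)
  then have "proj_free (mon (fst w)) = mon (fst w)"
    using w unfolding proj_free_def lin_mon by (metis mem_Times_iff)
  then show "P3 (mon w) = mon w"
    using P3_tensor[of "mon (fst w)" "mon (snd w)"] by simp
qed

section \<open>Descent of the maps to the quotients\<close>

lemma coprod_I1_I2: "x \<in> I1 N \<Longrightarrow> coprod_free N x \<in> I2 N"
proof -
  assume x: "x \<in> I1 N"
  then have "coprod_free N x \<in> supported_on (W2 N)"
    using coprod_supported[OF generator_set(3)] I1_supported by (auto simp: W1_def W2_def)
  then show ?thesis using coprod_I1_J2[OF x] by (simp add: J2_def ext_iff)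
qed

lemma J3_left: "x \<in> J1 N \<Longrightarrow> x \<boxtimes> y \<in> J3 N"
  using cong_mod_tensor3[of N x 0 y y] cong_mod_refl[OF two_sided_J(2)] by (simp add: cong_mod_def alg_linear_0[OF alg_linear_tensor_left])

lemma J3_right: "y \<in> J2 N \<Longrightarrow> x \<boxtimes> y \<in> J3 N"
  using cong_mod_tensor3[of N x x y 0] cong_mod_refl[OF two_sided_J(1)] by (simp add: cong_mod_def alg_linear_0[OF alg_linear_tensor_right])

lemma hom_I2:
  assumes "alg_hom f" "\<And>x. x \<in> I1 N \<Longrightarrow> f (x \<boxtimes> 1) \<in> J3 N" "\<And>x. x \<in> I1 N \<Longrightarrow> f (1 \<boxtimes> x) \<in> J3 N" "z \<in> I2 N"
  shows "f z \<in> J3 N"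
  by (rule hom_tensor_ideal[OF face_W(1) face_W(1) I1_supported I1_supported assms(1)
    two_sided_J(3) hclosed_J(3) assms(2,3) assms(4)[unfolded I2_def]])

lemma L12_I2: "x \<in> I2 N \<Longrightarrow> L12 x \<in> J3 N"
  by (erule hom_I2[OF hom_L12, rotated 2])
    (simp_all add: L12_tensor J3_left J3_right J2_left I_subset_J)

lemma L23_I2: "x \<in> I2 N \<Longrightarrow> L23 x \<in> J3 N"
  by (simp add: L23_def J3_right I_subset_J)

lemma D12_I2: "x \<in> I2 N \<Longrightarrow> D12 N x \<in> J3 N"
  by (erule hom_I2[OF hom_D12, rotated 2])
    (simp_all add: D12_left D12_right L12_I2 coprod_I1_I2, simp add: L23_tensor J3_right J2_right I_subset_J)

lemma D23_I2: "x \<in> I2 N \<Longrightarrow> D23 N x \<in> J3 N"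
  by (erule hom_I2[OF hom_D23, rotated 2])
    (simp_all add: D23_left D23_right L23_I2 coprod_I1_I2, simp add: L12_tensor J3_left I_subset_J)

lemma I3_iff: "x \<in> supported_on (W3 N) \<Longrightarrow> x \<in> I3 N \<longleftrightarrow> x \<in> J3 N"
  by (simp add: J3_def ext_iff)

section \<open>Power series in \<open>\<zeta>\<close>\<close>

text \<open>Series in \<zeta> are taken as formal power series over the algebras, which are
  themselves series in \<hbar>. The ring structure of the outer series then makes the usual
  algebraic calculus available.\<close>

definition zmap :: "('a \<Rightarrow> 'b) \<Rightarrow> 'a fps \<Rightarrow> 'b fps" where
  "zmap f x = Abs_fps (\<lambda>n. f (fps_nth x n))"

lemma zmap_nth [simp]: "fps_nth (zmap f x) n = f (fps_nth x n)"
  by (simp add: zmap_def)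

lemma zmap_const: "f 0 = 0 \<Longrightarrow> zmap f (fps_const c) = fps_const (f c)"
  by (simp add: fps_eq_iff)

lemma
  assumes "alg_hom f"
  shows zmap_mult: "zmap f (x * y) = zmap f x * zmap f y"
    and zmap_diff: "zmap f (x - y) = zmap f x - zmap f y"
    and zmap_1: "zmap f 1 = 1"
  by (simp_all add: fps_eq_iff fps_mult_nth hom_simps assms)

lemma zmap_comp: "zmap f (zmap g x) = zmap (\<lambda>y. f (g y)) x"
  by (simp add: fps_eq_iff)

lemma zmap_commute: "(\<And>x y. f x * g y = g y * f x) \<Longrightarrow> zmap f x * zmap g y = zmap g y * (zmap f x :: 'a::ring_1 fps)"
proof (rule fps_ext)
  fix n assume *: "\<And>x y. f x * g y = g y * f x"
  have "fps_nth (zmap f x * zmap g y) n = (\<Sum>i=0..n. g (fps_nth y (n - i)) * f (fps_nth x i))"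
    by (simp add: fps_mult_nth *)
  also have "\<dots> = (\<Sum>i=0..n. g (fps_nth y i) * f (fps_nth x (n - i)))"
    by (subst sum.atLeastAtMost_rev) (auto intro!: sum.cong)
  finally show "fps_nth (zmap f x * zmap g y) n = fps_nth (zmap g y * zmap f x) n"
    by (simp add: fps_mult_nth)
qed

definition zset :: "'a set \<Rightarrow> 'a fps set" where
  "zset J = {x. \<forall>n. fps_nth x n \<in> J}"

lemma two_sided_zset: "two_sided J \<Longrightarrow> two_sided (zset J)"
  unfolding two_sided_def[of "zset J"]
  by (auto simp: zset_def fps_mult_nth two_sided_0 two_sided_add two_sided_left two_sided_right intro!: two_sided_sum)

lemma zset_mult:
  "submon W \<Longrightarrow> x \<in> zset (supported_on W) \<Longrightarrow> y \<in> zset (supported_on W) \<Longrightarrow> x * y \<in> zset (supported_on W)"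
  by (auto simp: zset_def fps_mult_nth supported_on_mult intro!: supported_on_sum)

lemma zset_diff:
  "x \<in> zset (supported_on W) \<Longrightarrow> y \<in> zset (supported_on W) \<Longrightarrow> x - y \<in> zset (supported_on W)"
  by (auto simp: zset_def)

lemma zset_const: "c \<in> supported_on W \<Longrightarrow> fps_const c \<in> zset (supported_on W)"
  by (simp add: zset_def)

lemma zset_zmap: "(\<And>x. x \<in> A \<Longrightarrow> f x \<in> B) \<Longrightarrow> x \<in> zset A \<Longrightarrow> zmap f x \<in> zset B"
  by (simp add: zset_def)

section \<open>The cocycle equation for representatives\<close>

text \<open>The letters stand for: \<open>t1\<close>, \<open>t2\<close>, \<open>t3\<close> for
  \<omega> in the three legs; \<open>a\<close>, \<open>b\<close> and \<open>a'\<close>,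
  \<open>b'\<close> for the two factors of L and of R; \<open>l\<close>, \<open>m\<close> for
  \<Delta>(\<omega>^-1) and \<Delta>(\<omega>) in legs 1, 2; \<open>l'\<close>, \<open>m'\<close>
  for the same in legs 2, 3; \<open>z\<close> for the iterated coproduct of \<omega>^-1. The inner
  pairs cancel, and \<omega> in the leg that the first factor does not touch moves to the
  left.\<close>

lemma gauge_cocycle:
  fixes J :: "'a::ring_1 set"
  assumes J: "two_sided J"
    and lm: "cong_mod J (l * m) 1" and lm': "cong_mod J (l' * m') 1"
    and c: "t3 * a = a * t3" "t1 * (t2 * (t3 * (a' * l'))) = t2 * (t3 * (a' * l')) * t1"
    and X: "cong_mod J x1 (t1 * t2 * a * l)" "cong_mod J x2 (m * t3 * b * z)"
    and Y: "cong_mod J y1 (t2 * t3 * a' * l')" "cong_mod J y2 (t1 * m' * b' * z)"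
  shows "cong_mod J (x1 * x2) (t1 * t2 * t3 * (a * b) * z)"
    and "cong_mod J (y1 * y2) (t1 * t2 * t3 * (a' * b') * z)"
proof -
  note refl = cong_mod_refl[OF J] and trans = cong_mod_trans[OF J] and mult = cong_mod_mult[OF J]
  have "cong_mod J (t1 * t2 * a * (l * m) * (t3 * b * z)) (t1 * t2 * a * 1 * (t3 * b * z))"
    by (intro mult refl lm)
  moreover have "t1 * t2 * a * 1 * (t3 * b * z) = t1 * t2 * t3 * (a * b) * z"
    using c(1) by (simp add: mult.assoc) (simp flip: mult.assoc add: c(1))
  ultimately show "cong_mod J (x1 * x2) (t1 * t2 * t3 * (a * b) * z)"
    using trans[OF mult[OF X]] by (simp add: mult.assoc)
  have "cong_mod J (t1 * t2 * t3 * a' * (l' * m') * (b' * z)) (t1 * t2 * t3 * a' * 1 * (b' * z))"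
    by (intro mult refl lm')
  moreover have "t2 * t3 * a' * l' * (t1 * m' * b' * z) = t1 * t2 * t3 * a' * (l' * m') * (b' * z)"
    using arg_cong[OF c(2), of "\<lambda>u. u * (m' * b' * z)"] by (simp add: mult.assoc)
  ultimately show "cong_mod J (y1 * y2) (t1 * t2 * t3 * (a' * b') * z)"
    using trans[OF mult[OF Y]] by (simp add: mult.assoc)
qed

text \<open>The series \<open>p\<close>, \<open>p1\<close>, \<open>w\<close>, \<open>w'\<close>,
  \<open>g\<close> represent \<Psi>, \<open>\<Psi>\<^sub>1\<close>, \<omega>, \<omega>^-1 and
  \<open>\<Psi>\<^sub>\<omega>\<close>. Assumption \<open>P3_I3\<close> is the well-definedness of
  \<pi> \<otimes> id \<otimes> id on residue classes.\<close>

lemma cocycle_representative: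
  fixes N :: nat and w w' :: "alg1 fps" and g :: "alg2 fps"
  defines "cur \<equiv> supported_on (lists (cur_gens N))"
    and "cur2 \<equiv> supported_on (lists (cur_gens N) \<times> W1 N)"
    and "fin2 \<equiv> supported_on (lists (fin_gens N) \<times> W1 N)"
    and "cur3 \<equiv> supported_on (lists (cur_gens N) \<times> W2 N)"
    and "E1 \<equiv> zmap (\<lambda>x :: alg1. x \<boxtimes> (1 :: alg1))" and "E2 \<equiv> zmap (\<lambda>x :: alg1. (1 :: alg1) \<boxtimes> x)"
    and "\<Delta> \<equiv> zmap (coprod_free N)"
  assumes p: "p \<in> cur2" "p1 \<in> cur2" "p - p1 * P2 p \<in> I2 N"
    and twist: "L12 (P2 p) * D12 N (P2 p) - L23 (P2 p) * D23 N (P2 p) \<in> I3 N"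
    and commute: "L23 p1 * L12 (P2 p) - L12 (P2 p) * L23 p1 \<in> I3 N"
    and proj: "P3 (D12 N p1) - L23 p1 \<in> I3 N"
    and P3_I3: "\<And>y. y \<in> I3 N \<Longrightarrow> y \<in> cur3 \<Longrightarrow> P3 y \<in> I3 N"
    and w: "w \<in> zset cur" "w' \<in> zset cur" "w' * w - 1 \<in> zset (I1 N)"
    and g: "g \<in> zset fin2" "g - E1 w * E2 w * fps_const p * \<Delta> w' \<in> zset (I2 N)"
  shows "L12 p * D12 N p - L23 p * D23 N p \<in> I3 N"
proof -
  note J = two_sided_J(3)[of N]
  note Jz = two_sided_zset[OF J]
  note refl = cong_mod_refl[OF J] and trans = cong_mod_trans[OF J] and sym = cong_mod_sym[OF J] and mult = cong_mod_mult[OF J]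
  note I3 = I_subset_J(3)
  let ?p2 = "P2 p"
  let ?L = "L12 p * D12 N p" and ?R = "L23 p * D23 N p"

  have p2: "?p2 \<in> fin2"
    using p(1) unfolding cur2_def fin2_def by (rule P2_supported)

  have eq_p: "cong_mod (J3 N) (f p) (f p1 * f ?p2)" if "alg_hom f" "\<And>x. x \<in> I2 N \<Longrightarrow> f x \<in> J3 N" for f
    using that(2)[OF p(3)] by (simp add: cong_mod_def hom_simps that(1))
  have sub3: "submon (lists (cur_gens N) \<times> W2 N)" and sub3': "submon (lists (fin_gens N) \<times> W2 N)"
    by (intro face_submon face_Times face_lists face_W)+
  have cur3_W3: "x \<in> supported_on (W3 N)" if "x \<in> cur3" for x
    using that unfolding cur3_def W3_def
    by (rule supported_on_mono[rotated]) (use lists_W1[OF generator_set(2)] in auto)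
  have fin_cur: "fin2 \<subseteq> cur2"
    unfolding cur2_def fin2_def using supported_on_mono[of "lists (fin_gens N) \<times> W1 N" "lists (cur_gens N) \<times> W1 N"]
    by (auto simp: cur_gens_def)
  have maps: "L12 x \<in> cur3" "L23 x \<in> cur3" "D12 N x \<in> cur3" "D23 N x \<in> cur3" if "x \<in> cur2" for x
    using that unfolding cur2_def cur3_def
    by (rule L12_supported[OF generator_set(2)] L23_supported[OF generator_set(2)] D12_supported[OF generator_set(2)] D23_supported[OF generator_set(2)])+
  \<comment> \<open>The chain is \<open>\<Psi>\<^sub>2\<^sup>1\<^sup>2
    \<Psi>\<^sub>1\<^sup>2\<^sup>3 (\<Delta> \<otimes> id)(\<Psi>\<^sub>2)\<close> =
    \<open>\<Psi>\<^sub>1\<^sup>2\<^sup>3 \<Psi>\<^sub>2\<^sup>1\<^sup>2 (\<Delta> \<otimes>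
    id)(\<Psi>\<^sub>2)\<close> = \<open>\<Psi>\<^sub>1\<^sup>2\<^sup>3
    \<Psi>\<^sub>2\<^sup>2\<^sup>3 (id \<otimes> \<Delta>)(\<Psi>\<^sub>2)\<close> =
    \<open>\<Psi>\<^sup>2\<^sup>3 (id \<otimes> \<Delta>)(\<Psi>\<^sub>2)\<close>, where commutation
    and the cocycle equation give the first two equalities.\<close>
  have PL: "cong_mod (J3 N) (P3 ?L) (P3 ?R)"
  proof -
    have "D12 N p - D12 N p1 * D12 N ?p2 \<in> J3 N"
      using eq_p[OF hom_D12 D12_I2] by (simp add: cong_mod_def)
    \<comment> \<open>The support is needed before the projection may be applied:
      \<open>P3_I3\<close> speaks only of elements of \<open>I3 N\<close> in
      \<open>cur3\<close>.\<close>
    moreover have d: "D12 N p - D12 N p1 * D12 N ?p2 \<in> cur3"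
      using maps(3)[OF p(1)] maps(3)[OF p(2)] maps(3)[OF subsetD[OF fin_cur p2]]
      unfolding cur3_def by (intro supported_on_diff supported_on_mult[OF sub3])
    ultimately have "D12 N p - D12 N p1 * D12 N ?p2 \<in> I3 N"
      using I3_iff[OF cur3_W3] by blast
    from I3[OF P3_I3[OF this d]] have step: "cong_mod (J3 N) (P3 (D12 N p)) (P3 (D12 N p1) * P3 (D12 N ?p2))"
      by (simp add: cong_mod_def hom_simps hom_P3)
    \<comment> \<open>The finite part is stable under the coproduct, so the first leg still contains
      no \<open>Gen_e 0\<close>.\<close>
    have fixed: "P3 (D12 N ?p2) = D12 N ?p2"
      using p2 unfolding fin2_def by (intro P3_fixes[of _ N] D12_supported[OF generator_set(1)])
    have "cong_mod (J3 N) (P3 (D12 N p1) * D12 N ?p2) (L23 p1 * D12 N ?p2)"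
      by (intro mult refl) (use I3[OF proj] in \<open>simp add: cong_mod_def\<close>)
    then have "cong_mod (J3 N) (P3 (D12 N p)) (L23 p1 * D12 N ?p2)"
      by (rule trans[OF step[unfolded fixed]])
    then have "cong_mod (J3 N) (P3 ?L) (L12 ?p2 * (L23 p1 * D12 N ?p2))"
      unfolding hom_mult[OF hom_P3] P3_L12 by (intro mult refl)
    also have "L12 ?p2 * (L23 p1 * D12 N ?p2) = L12 ?p2 * L23 p1 * D12 N ?p2"
      by (simp add: mult.assoc)
    finally have 1: "cong_mod (J3 N) (P3 ?L) (L12 ?p2 * L23 p1 * D12 N ?p2)" .
    have 2: "cong_mod (J3 N) (L12 ?p2 * L23 p1 * D12 N ?p2) (L23 p1 * L12 ?p2 * D12 N ?p2)"
      by (rule mult[OF sym refl]) (use I3[OF commute] in \<open>simp add: cong_mod_def\<close>)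
    have "cong_mod (J3 N) (L23 p1 * (L12 ?p2 * D12 N ?p2)) (L23 p1 * (L23 ?p2 * D23 N ?p2))"
      by (intro mult[OF refl]) (use I3[OF twist] in \<open>simp add: cong_mod_def\<close>)
    then have 3: "cong_mod (J3 N) (L23 p1 * L12 ?p2 * D12 N ?p2) (L23 p1 * L23 ?p2 * D23 N ?p2)"
      by (simp add: mult.assoc)
    have 4: "cong_mod (J3 N) (L23 p1 * L23 ?p2 * D23 N ?p2) (P3 ?R)"
      unfolding hom_mult[OF hom_P3] P3_L23 P3_D23 by (rule mult[OF sym[OF eq_p[OF hom_L23 L23_I2]] refl])
    show ?thesis
      by (rule trans[OF trans[OF trans[OF 1 2] 3] 4])
  qed

  \<comment> \<open>\<omega> placed in each of the three legs; \<open>?Z\<close> below is the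
    iterated coproduct of \<omega>^-1, which \<open>coassoc\<close> makes common to both
    products.\<close>
  let ?T1 = "zmap L12 (E1 w)" and ?T2 = "zmap L12 (E2 w)" and ?T3 = "zmap L23 (E2 w)"
  let ?Z = "zmap (D12 N) (\<Delta> w')"
  let ?W = "?T1 * ?T2 * ?T3"
  let ?Lg = "zmap L12 g * zmap (D12 N) g" and ?Rg = "zmap L23 g * zmap (D23 N) g"
  note zm = zmap_mult[OF hom_L12] zmap_mult[OF hom_L23] zmap_mult[OF hom_D12] zmap_mult[OF hom_D23]
  note zc = zmap_const[of L12, OF alg_linear_0[OF hom_alg_linear[OF hom_L12]]] zmap_const[of L23, OF alg_linear_0[OF hom_alg_linear[OF hom_L23]]]
    zmap_const[of "D12 N", OF alg_linear_0[OF hom_alg_linear[OF hom_D12]]] zmap_const[of "D23 N", OF alg_linear_0[OF hom_alg_linear[OF hom_D23]]]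

  have comp: "zmap (D12 N) (E1 x) = zmap L12 (\<Delta> x)" "zmap (D12 N) (E2 x) = zmap L23 (E2 x)"
    "zmap (D23 N) (E1 x) = zmap L12 (E1 x)" "zmap (D23 N) (E2 x) = zmap L23 (\<Delta> x)"
    "zmap (D23 N) (\<Delta> x) = zmap (D12 N) (\<Delta> x)" "zmap L23 (E1 x) = zmap L12 (E2 x)" for x
    by (simp_all add: E1_def E2_def \<Delta>_def zmap_comp D12_left D12_right D23_left D23_right coassoc L12_L23)

  have lift: "cong_mod (zset (J3 N)) (zmap f g) (zmap f (E1 w * E2 w * fps_const p * \<Delta> w'))"
    if "alg_hom f" "\<And>x. x \<in> I2 N \<Longrightarrow> f x \<in> J3 N" for f
    using zset_zmap[where f = f, OF that(2) g(2)] by (simp add: cong_mod_def zmap_diff that(1))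
  have unit: "cong_mod (zset (J3 N)) (zmap f (\<Delta> w') * zmap f (\<Delta> w)) 1"
    if "alg_hom f" "\<And>x. x \<in> I2 N \<Longrightarrow> f x \<in> J3 N" for f
  proof -
    have "zmap f (\<Delta> (w' * w - 1)) \<in> zset (J3 N)"
      unfolding \<Delta>_def using that(2) coprod_I1_I2 w(3) by (intro zset_zmap[where A = "I2 N"] zset_zmap[where A = "I1 N"])
    then show ?thesis
      by (simp add: cong_mod_def \<Delta>_def zmap_diff zmap_mult zmap_1 hom_coprod that(1))
  qed
  have T3_comm: "?T3 * zmap L12 x = zmap L12 x * ?T3" for x
    unfolding E2_def zmap_comp by (rule zmap_commute) (rule L12_commute_right)
  have T1_comm: "?T1 * zmap L23 x = zmap L23 x * ?T1" for x
    unfolding E1_def zmap_comp by (rule zmap_commute) (rule L23_commute_left)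

  have gauge: "cong_mod (zset (J3 N)) ?Lg (?W * (fps_const (L12 p) * fps_const (D12 N p)) * ?Z)"
    "cong_mod (zset (J3 N)) ?Rg (?W * (fps_const (L23 p) * fps_const (D23 N p)) * ?Z)"
  proof -
    have f1: "cong_mod (zset (J3 N)) (zmap L12 (\<Delta> w') * zmap L12 (\<Delta> w)) 1"
      by (intro unit hom_L12 L12_I2)
    have f2: "cong_mod (zset (J3 N)) (zmap L23 (\<Delta> w') * zmap L23 (\<Delta> w)) 1"
      by (intro unit hom_L23 L23_I2)
    have f3: "?T3 * fps_const (L12 p) = fps_const (L12 p) * ?T3"
      using T3_comm[of "fps_const p"] by (simp add: zc)
    \<comment> \<open>The first leg commutes with everything in the image of \<open>L23\<close>, so
      \<omega> is moved past the whole representative at once; the factor \<open>?T2\<close> is the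
      image of \<open>E1 w\<close>.\<close>
    have "?T1 * zmap L23 (E1 w * (E2 w * (fps_const p * \<Delta> w'))) = zmap L23 (E1 w * (E2 w * (fps_const p * \<Delta> w'))) * ?T1"
      by (rule T1_comm)
    then have f4: "?T1 * (?T2 * (?T3 * (fps_const (L23 p) * zmap L23 (\<Delta> w')))) =
        ?T2 * (?T3 * (fps_const (L23 p) * zmap L23 (\<Delta> w'))) * ?T1"
      by (simp only: zm zc comp)
    have f5: "cong_mod (zset (J3 N)) (zmap L12 g) (?T1 * ?T2 * fps_const (L12 p) * zmap L12 (\<Delta> w'))"
      using lift[OF hom_L12 L12_I2] by (simp only: zm zc)
    have f6: "cong_mod (zset (J3 N)) (zmap (D12 N) g) (zmap L12 (\<Delta> w) * ?T3 * fps_const (D12 N p) * ?Z)"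
      using lift[OF hom_D12 D12_I2] by (simp only: zm zc comp)
    have f7: "cong_mod (zset (J3 N)) (zmap L23 g) (?T2 * ?T3 * fps_const (L23 p) * zmap L23 (\<Delta> w'))"
      using lift[OF hom_L23 L23_I2] by (simp only: zm zc comp)
    have f8: "cong_mod (zset (J3 N)) (zmap (D23 N) g) (?T1 * zmap L23 (\<Delta> w) * fps_const (D23 N p) * ?Z)"
      using lift[OF hom_D23 D23_I2] by (simp only: zm zc comp)
    show "cong_mod (zset (J3 N)) ?Lg (?W * (fps_const (L12 p) * fps_const (D12 N p)) * ?Z)"
      "cong_mod (zset (J3 N)) ?Rg (?W * (fps_const (L23 p) * fps_const (D23 N p)) * ?Z)"
      by (rule gauge_cocycle[OF Jz f1 f2 f3 f4 f5 f6 f7 f8])+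
  qed

  have one: "(1 :: alg1) \<in> cur" "(1 :: alg1) \<in> supported_on (W1 N)"
    by (simp_all add: cur_def supported_on_1 face_submon face_W face_lists)
  have cur_W1: "x \<in> supported_on (W1 N)" if "x \<in> cur" for x
    using that unfolding cur_def by (rule supported_on_mono[OF lists_W1[OF generator_set(2)]])
  have E: "E1 w \<in> zset cur2" "E2 w \<in> zset cur2" "\<Delta> w' \<in> zset cur2"
  proof -
    show "E1 w \<in> zset cur2" "E2 w \<in> zset cur2"
      unfolding E1_def E2_def using w(1) one cur_W1
      by (auto intro!: zset_zmap[where A = cur] supported_on_tensor simp: cur2_def cur_def)
    have "coprod_free N x \<in> cur2" if "x \<in> cur" for x
      unfolding cur2_def
      by (rule supported_on_mono[OF _ coprod_supported[OF generator_set(2) that[unfolded cur_def]]])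
        (use lists_W1[OF generator_set(2)] in auto)
    then show "\<Delta> w' \<in> zset cur2"
      unfolding \<Delta>_def by (rule zset_zmap[OF _ w(2)])
  qed
  have WZ: "?T1 \<in> zset cur3" "?T2 \<in> zset cur3" "?T3 \<in> zset cur3" "?Z \<in> zset cur3"
    by (rule zset_zmap[where A = cur2], erule maps, rule E)+
  have g2: "g \<in> zset cur2" using g(1) fin_cur by (auto simp: zset_def)
  have gs: "zmap L12 g \<in> zset cur3" "zmap L23 g \<in> zset cur3" "zmap (D12 N) g \<in> zset cur3" "zmap (D23 N) g \<in> zset cur3"
    by (rule zset_zmap[where A = cur2], erule maps, rule g2)+
  have mult3: "x * y \<in> zset cur3" if "x \<in> zset cur3" "y \<in> zset cur3" for x y
    using that unfolding cur3_def by (rule zset_mult[OF sub3])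
  have diff3: "x - y \<in> zset cur3" if "x \<in> zset cur3" "y \<in> zset cur3" for x y
    using that unfolding cur3_def by (rule zset_diff)
  have const3: "fps_const x \<in> zset cur3" if "x \<in> cur3" for x
    using that by (simp add: zset_def cur3_def)

  have P3_cong_mod: "cong_mod (zset (J3 N)) (zmap P3 x) (zmap P3 y)"
    if "cong_mod (zset (J3 N)) x y" "x \<in> zset cur3" "y \<in> zset cur3" for x y
  proof -
    have "P3 (fps_nth (x - y) n) \<in> J3 N" for n
    proof (rule I3[OF P3_I3])
      show "fps_nth (x - y) n \<in> cur3" using diff3[OF that(2,3)] by (simp add: zset_def)
      then show "fps_nth (x - y) n \<in> I3 N"
        using that(1) cur3_W3 by (subst I3_iff) (simp_all add: cong_mod_def zset_def)
    qed
    then show ?thesis by (simp add: cong_mod_def zset_def hom_simps hom_P3)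
  qed
  have P3_fin: "zmap P3 x = x" if "x \<in> zset (supported_on (lists (fin_gens N) \<times> W2 N))" for x
    by (rule fps_ext) (use that in \<open>simp add: zset_def P3_fixes[of _ N]\<close>)
  have fin3: "zmap f g \<in> zset (supported_on (lists (fin_gens N) \<times> W2 N))"
    if "\<And>x. x \<in> supported_on (lists (fin_gens N) \<times> W1 N) \<Longrightarrow> f x \<in> supported_on (lists (fin_gens N) \<times> W2 N)" for f
    using that g(1)[unfolded fin2_def] by (rule zset_zmap)
  have fin_g: "zmap L12 g \<in> zset (supported_on (lists (fin_gens N) \<times> W2 N))"
    "zmap L23 g \<in> zset (supported_on (lists (fin_gens N) \<times> W2 N))"
    "zmap (D12 N) g \<in> zset (supported_on (lists (fin_gens N) \<times> W2 N))"
    "zmap (D23 N) g \<in> zset (supported_on (lists (fin_gens N) \<times> W2 N))"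
    by (rule fin3, erule L12_supported[OF generator_set(1)] L23_supported[OF generator_set(1)]
        D12_supported[OF generator_set(1)] D23_supported[OF generator_set(1)])+
  \<comment> \<open>This is where the hypothesis on the gauged element enters: every
    \<zeta>-coefficient of \<open>g\<close> has its first leg in the finite part.\<close>
  have fixed: "zmap P3 ?Lg = ?Lg" "zmap P3 ?Rg = ?Rg"
    by (rule P3_fin, rule zset_mult[OF sub3'], rule fin_g, rule fin_g)+

  note zrefl = cong_mod_refl[OF Jz] and ztrans = cong_mod_trans[OF Jz] and zsym = cong_mod_sym[OF Jz] and zmult = cong_mod_mult[OF Jz]
  have c: "fps_const (L12 p) * fps_const (D12 N p) = fps_const ?L" "fps_const (L23 p) * fps_const (D23 N p) = fps_const ?R"
    by simp_all
  have cc: "fps_const ?L \<in> zset cur3" "fps_const ?R \<in> zset cur3"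
    unfolding c[symmetric] by (intro mult3 const3 maps p(1))+
  have WLZ: "?W * fps_const ?L * ?Z \<in> zset cur3" "?W * fps_const ?R * ?Z \<in> zset cur3"
    by (intro mult3 WZ cc)+
  have LR_g: "?Lg \<in> zset cur3" "?Rg \<in> zset cur3"
    by (intro mult3 gs)+
  have P0: "P3 0 = 0" by (rule alg_linear_0[OF hom_alg_linear[OF hom_P3]])
  have "cong_mod (zset (J3 N)) ?Lg (zmap P3 (?W * fps_const ?L * ?Z))"
    using P3_cong_mod[OF gauge(1)[unfolded c] LR_g(1) WLZ(1)] by (simp only: fixed)
  moreover have "cong_mod (zset (J3 N)) ?Rg (zmap P3 (?W * fps_const ?R * ?Z))"
    using P3_cong_mod[OF gauge(2)[unfolded c] LR_g(2) WLZ(2)] by (simp only: fixed)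
  \<comment> \<open>By multiplicativity the two projected products differ only in the middle factors
    \<open>P3 ?L\<close> and \<open>P3 ?R\<close>, whose congruence is \<open>PL\<close>.\<close>
  moreover have "cong_mod (zset (J3 N)) (fps_const (P3 ?L)) (fps_const (P3 ?R))"
    using PL two_sided_0[OF J] by (simp add: cong_mod_def zset_def)
  then have "cong_mod (zset (J3 N)) (zmap P3 (?W * fps_const ?L * ?Z)) (zmap P3 (?W * fps_const ?R * ?Z))"
    unfolding zmap_mult[OF hom_P3] zmap_const[of P3, OF P0] by (intro zmult zrefl)
  ultimately have "cong_mod (zset (J3 N)) ?Lg ?Rg"
    by (meson ztrans zsym)
  then have WW: "cong_mod (zset (J3 N)) (?W * fps_const ?L * ?Z) (?W * fps_const ?R * ?Z)"
    using gauge unfolding c by (meson ztrans zsym)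

  let ?T1' = "zmap L12 (E1 w')" and ?T2' = "zmap L12 (E2 w')" and ?T3' = "zmap L23 (E2 w')"
  have inv: "cong_mod (zset (J3 N)) (zmap f w' * zmap f w) 1" if "alg_hom f" "\<And>x. x \<in> I1 N \<Longrightarrow> f x \<in> J3 N" for f
    using zset_zmap[where f = f, OF that(2) w(3)] by (simp add: cong_mod_def zmap_diff zmap_mult zmap_1 that(1))
  have inv1: "cong_mod (zset (J3 N)) (?T1' * ?T1) 1" and inv2: "cong_mod (zset (J3 N)) (?T2' * ?T2) 1"
    and inv3: "cong_mod (zset (J3 N)) (?T3' * ?T3) 1"
    unfolding E1_def E2_def zmap_comp
    by (rule inv, rule hom_comp[OF hom_L12 hom_tensor_left] hom_comp[OF hom_L12 hom_tensor_right] hom_comp[OF hom_L23 hom_tensor_right],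
        simp add: L12_tensor L23_tensor J3_left J3_right J2_left J2_right I_subset_J)+
  have invZ: "cong_mod (zset (J3 N)) (?Z * zmap (D12 N) (\<Delta> w)) 1"
    by (rule unit[OF hom_D12 D12_I2])
  have cancel: "cong_mod (zset (J3 N)) x y" if "cong_mod (zset (J3 N)) (u * x) (u * y)" "cong_mod (zset (J3 N)) (u' * u) 1" for u u' x y
  proof -
    have "cong_mod (zset (J3 N)) (u' * u * x) (u' * u * y)"
      using zmult[OF zrefl[of u'] that(1)] by (simp add: mult.assoc)
    moreover have "cong_mod (zset (J3 N)) (u' * u * z) (1 * z)" for z
      by (intro zmult zrefl that(2))
    ultimately show ?thesis by (metis mult_1 zsym ztrans)
  qed
  have cancel_right: "cong_mod (zset (J3 N)) x y" if "cong_mod (zset (J3 N)) (x * u) (y * u)" "cong_mod (zset (J3 N)) (u * u') 1" for u u' x y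
  proof -
    have "cong_mod (zset (J3 N)) (x * (u * u')) (y * (u * u'))"
      using zmult[OF that(1) zrefl[of u']] by (simp add: mult.assoc)
    moreover have "cong_mod (zset (J3 N)) (z * (u * u')) (z * 1)" for z
      by (intro zmult zrefl that(2))
    ultimately show ?thesis by (metis mult_1_right zsym ztrans)
  qed
  \<comment> \<open>The gauge factors are stripped off: the iterated coproduct on the right, then
    \<omega> in each leg on the left.\<close>
  have "cong_mod (zset (J3 N)) (?W * fps_const ?L) (?W * fps_const ?R)"
    by (rule cancel_right[OF WW invZ])
  then have "cong_mod (zset (J3 N)) (?T1 * (?T2 * (?T3 * fps_const ?L))) (?T1 * (?T2 * (?T3 * fps_const ?R)))"
    by (simp only: mult.assoc)
  then have "cong_mod (zset (J3 N)) (fps_const ?L) (fps_const ?R)"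
    by (rule cancel[OF cancel[OF cancel[OF _ inv1] inv2] inv3])
  \<comment> \<open>Both sides are constant in \<zeta>, so the coefficient at 0 carries the whole
    statement.\<close>
  then have "fps_nth (fps_const ?L - fps_const ?R) 0 \<in> J3 N"
    unfolding cong_mod_def zset_def by blast
  then have "?L - ?R \<in> J3 N" by simp
  moreover have "fps_nth (fps_const ?L - fps_const ?R) 0 \<in> cur3"
    using diff3[OF cc] unfolding zset_def by blast
  then have "?L - ?R \<in> cur3" by simp
  ultimately show ?thesis using I3_iff[OF cur3_W3] by blast
qed

section \<open>Representatives of residue classes\<close>

definition coset :: "'w::monoid_add set \<Rightarrow> 'w alg set \<Rightarrow> 'w alg \<Rightarrow> 'w alg set" where
  "coset W I x = I +>\<^bsub>free_alg W\<^esub> x"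

lemma mem_coset: "y \<in> coset W I x \<longleftrightarrow> y - x \<in> I"
  by (auto simp: coset_def a_r_coset_def' intro: bexI[of _ "y - x"])

lemma classes_on_eq: "classes_on W I S = coset W I ` supported_on S"
  by (simp add: classes_on_def coset_def image_def)

text \<open>\<open>Q\<close> is the image of the algebra on \<open>S\<close> in the quotient of the
  algebra on \<open>W\<close>; the case \<open>S = W\<close> gives the full quotient. Treating both
  at once covers the subalgebras and the tensor powers.\<close>

locale quotient_alg =
  fixes W S :: "'w::monoid_add set" and I :: "'w alg set"
  assumes face: "face W" and closed: "closed_ideal W I" and submon: "submon S" and sub: "S \<subseteq> W"
begin

abbreviation Q :: "'w alg set ring" where
  "Q \<equiv> restrict_carrier (free_alg W Quot I) (classes_on W I S)"

abbreviation cl :: "'w alg \<Rightarrow> 'w alg set" where "cl \<equiv> coset W I"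

sublocale ideal I "free_alg W"
  by (rule closed_ideal_ideal[OF face_submon[OF face] closed])

lemma supp: "x \<in> supported_on S \<Longrightarrow> x \<in> supported_on W"
  by (rule supported_on_mono[OF sub])

lemma I_diff: "x \<in> I \<Longrightarrow> y \<in> I \<Longrightarrow> x - y \<in> I"
  and I_add: "x \<in> I \<Longrightarrow> y \<in> I \<Longrightarrow> x + y \<in> I" and I_0: "0 \<in> I"
proof -
  have T: "two_sided (ext W I)" by (rule two_sided_ext[OF face closed])
  have I: "x \<in> I \<longleftrightarrow> x \<in> ext W I \<and> x \<in> supported_on W" for x
    using closed ext_iff[of x W I] by (auto simp: closed_ideal_def)
  show "x \<in> I \<Longrightarrow> y \<in> I \<Longrightarrow> x - y \<in> I" "x \<in> I \<Longrightarrow> y \<in> I \<Longrightarrow> x + y \<in> I" "0 \<in> I"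
    unfolding I by (auto simp: two_sided_diff[OF T] two_sided_add[OF T] two_sided_0[OF T])
qed

lemma cl_eq_iff: "cl x = cl y \<longleftrightarrow> x - y \<in> I"
proof
  assume "cl x = cl y"
  moreover have "x \<in> cl x" using I_0 by (simp add: mem_coset)
  ultimately show "x - y \<in> I" by (simp add: mem_coset)
next
  assume *: "x - y \<in> I"
  show "cl x = cl y"
  proof (rule Set.set_eqI)
    fix z
    show "z \<in> cl x \<longleftrightarrow> z \<in> cl y"
      using I_add[of "z - x" "x - y"] I_diff[of "z - y" "x - y"] * by (auto simp: mem_coset)
  qed
qed

lemma cl_0: "cl 0 = I"
  by (auto simp: mem_coset)

lemma Q_simps:
  "carrier Q = cl ` supported_on S" "one Q = cl 1" "zero Q = cl 0"
  by (simp_all only: restrict_carrier_def classes_on_eq FactRing_def cl_0) (simp_all add: coset_def)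

lemma Q_mult: "x \<in> supported_on W \<Longrightarrow> y \<in> supported_on W \<Longrightarrow> cl x \<otimes>\<^bsub>Q\<^esub> cl y = cl (x * y)"
  using rcoset_mult_add[of x y] by (simp add: restrict_carrier_def FactRing_def coset_def)

lemma Q_add: "x \<in> supported_on W \<Longrightarrow> y \<in> supported_on W \<Longrightarrow> cl x \<oplus>\<^bsub>Q\<^esub> cl y = cl (x + y)"
  using a_rcos_sum[of x y] by (simp add: restrict_carrier_def FactRing_def coset_def)

lemma abelian_monoid_Q: "abelian_monoid Q"
  by (rule abelian_monoidI)
    (auto simp: Q_simps(1,3) Q_add supp supported_on_add add_ac)

lemma finsum_Q:
  fixes f :: "nat \<Rightarrow> 'w alg"
  assumes "\<And>k. k \<le> n \<Longrightarrow> f k \<in> supported_on S"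
  shows "(\<Oplus>\<^bsub>Q\<^esub>k\<in>{..n}. cl (f k)) = cl (\<Sum>k\<le>n. f k)"
  using assms
proof (induction n)
  case 0
  then show ?case
    using abelian_monoid.finsum_0[OF abelian_monoid_Q, of "\<lambda>k. cl (f k)"] by (simp add: Q_simps)
next
  case (Suc n)
  have "(\<Oplus>\<^bsub>Q\<^esub>k\<in>{..Suc n}. cl (f k)) = cl (f (Suc n)) \<oplus>\<^bsub>Q\<^esub> (\<Oplus>\<^bsub>Q\<^esub>k\<in>{..n}. cl (f k))"
    using Suc.prems by (intro abelian_monoid.finsum_Suc[OF abelian_monoid_Q]) (auto simp: Q_simps)
  also have "\<dots> = cl (f (Suc n) + (\<Sum>k\<le>n. f k))"
  proof -
    have "(\<Sum>k\<le>n. f k) \<in> supported_on W"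
      by (intro supported_on_sum supp) (use Suc.prems in auto)
    with Suc show ?thesis by (simp add: Q_add supp)
  qed
  finally show ?case by (simp add: add.commute)
qed

definition zcl :: "'w alg fps \<Rightarrow> nat \<Rightarrow> 'w alg set" where
  "zcl x = (\<lambda>n. cl (fps_nth x n))"

lemma zcl_eq_iff: "zcl x = zcl y \<longleftrightarrow> x - y \<in> zset I"
  by (simp add: zcl_def fun_eq_iff cl_eq_iff zset_def)

lemma zeta_carrier: "carrier (zeta_ring Q) = zcl ` zset (supported_on S)"
proof (rule Set.set_eqI)
  fix a
  show "a \<in> carrier (zeta_ring Q) \<longleftrightarrow> a \<in> zcl ` zset (supported_on S)"
  proof
    assume "a \<in> carrier (zeta_ring Q)"
    then have "\<forall>n. \<exists>x. x \<in> supported_on S \<and> a n = cl x" by (auto simp: zeta_ring_def Q_simps)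
    then obtain x where "\<And>n. x n \<in> supported_on S \<and> a n = cl (x n)" by metis
    then have "Abs_fps x \<in> zset (supported_on S)" "a = zcl (Abs_fps x)"
      by (auto simp: zset_def zcl_def)
    then show "a \<in> zcl ` zset (supported_on S)" by blast
  qed (auto simp: zeta_ring_def Q_simps zset_def zcl_def)
qed

lemma zeta_mult:
  assumes "x \<in> zset (supported_on S)" "y \<in> zset (supported_on S)"
  shows "zcl x \<otimes>\<^bsub>zeta_ring Q\<^esub> zcl y = zcl (x * y)"
proof
  fix n
  have "(zcl x \<otimes>\<^bsub>zeta_ring Q\<^esub> zcl y) n = (\<Oplus>\<^bsub>Q\<^esub>k\<in>{..n}. cl (fps_nth x k * fps_nth y (n - k)))"
    using assms by (simp add: zeta_ring_def zcl_def Q_mult supp zset_def)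
  also have "\<dots> = zcl (x * y) n"
    using assms submon by (simp add: finsum_Q zset_def supported_on_mult zcl_def fps_mult_nth atLeast0AtMost)
  finally show "(zcl x \<otimes>\<^bsub>zeta_ring Q\<^esub> zcl y) n = zcl (x * y) n" .
qed

lemma zeta_one: "one (zeta_ring Q) = zcl 1"
  by (simp add: zeta_ring_def Q_simps zcl_def fun_eq_iff)

lemma zset_I_iff: "x \<in> zset (supported_on W) \<Longrightarrow> x \<in> zset I \<longleftrightarrow> x \<in> zset (ext W I)"
  by (simp add: zset_def ext_iff)

lemma zeta_unit:
  assumes "a \<in> Units (zeta_ring Q)"
  obtains x y where "x \<in> zset (supported_on S)" "y \<in> zset (supported_on S)" "a = zcl x"
    "inv\<^bsub>zeta_ring Q\<^esub> a = zcl y" "y * x - 1 \<in> zset I"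
proof -
  from assms obtain b where ab: "a \<in> carrier (zeta_ring Q)" "b \<in> carrier (zeta_ring Q)"
    "b \<otimes>\<^bsub>zeta_ring Q\<^esub> a = \<one>\<^bsub>zeta_ring Q\<^esub>" "a \<otimes>\<^bsub>zeta_ring Q\<^esub> b = \<one>\<^bsub>zeta_ring Q\<^esub>"
    by (auto simp: Units_def)
  then obtain x y where x: "x \<in> zset (supported_on S)" "a = zcl x" and y: "y \<in> zset (supported_on S)" "b = zcl y"
    by (auto simp: zeta_carrier)
  have yx: "y * x - 1 \<in> zset I"
    using ab(3) x y by (simp add: zeta_mult zeta_one zcl_eq_iff)
  \<comment> \<open>The inverse is a definite description, so uniqueness is shown directly on
    representatives: z = (y x) z = y (x z) = y modulo the ideal.\<close>
  have "inv\<^bsub>zeta_ring Q\<^esub> a = b"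
    unfolding m_inv_def
  proof (rule the_equality)
    show "b \<in> carrier (zeta_ring Q) \<and> a \<otimes>\<^bsub>zeta_ring Q\<^esub> b = \<one>\<^bsub>zeta_ring Q\<^esub> \<and> b \<otimes>\<^bsub>zeta_ring Q\<^esub> a = \<one>\<^bsub>zeta_ring Q\<^esub>"
      using ab by blast
    fix c assume c: "c \<in> carrier (zeta_ring Q) \<and> a \<otimes>\<^bsub>zeta_ring Q\<^esub> c = \<one>\<^bsub>zeta_ring Q\<^esub> \<and> c \<otimes>\<^bsub>zeta_ring Q\<^esub> a = \<one>\<^bsub>zeta_ring Q\<^esub>"
    then obtain z where z: "z \<in> zset (supported_on S)" "c = zcl z" by (auto simp: zeta_carrier)
    have xz: "x * z - 1 \<in> zset I"
      using c x z by (simp add: zeta_mult zeta_one zcl_eq_iff)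
    let ?J = "zset (ext W I)"
    have J: "two_sided ?J" by (intro two_sided_zset two_sided_ext face closed)
    have IJ: "u \<in> ?J" if "u \<in> zset I" for u
      using that closed ext_iff[of _ W I] by (auto simp: zset_def closed_ideal_def)
    have "cong_mod ?J (y * (x * z)) (y * 1)" "cong_mod ?J (y * x * z) (1 * z)"
      by (intro cong_mod_mult[OF J] cong_mod_refl[OF J], simp add: cong_mod_def IJ xz yx)+
    then have "cong_mod ?J z y"
      by (simp add: mult.assoc) (meson J cong_mod_sym cong_mod_trans)
    moreover have "z - y \<in> zset (supported_on W)"
      using y z by (auto simp: zset_def supp)
    ultimately have "z - y \<in> zset I" by (simp add: zset_I_iff cong_mod_def)
    then show "c = b" using y z by (simp add: zcl_eq_iff)
  qed
  with x y yx show thesis by (intro that[of x y]) simp_all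
qed

end

text \<open>Two representatives supported on \<open>S\<close> differ by an element of
  \<open>I\<close> supported on \<open>S\<close>, which \<open>f\<close> sends into
  \<open>J\<close>. All members of the union therefore coincide, and \<open>x\<close> shows that
  there is at least one.\<close>

lemma induced_coset:
  assumes "quotient_alg V T J" and "alg_linear f"
    and "\<And>y. y \<in> I \<Longrightarrow> y \<in> supported_on S \<Longrightarrow> f y \<in> J" and "x \<in> supported_on S" "0 \<in> I"
  shows "induced S V J f (coset W I x) = coset V J (f x)"
proof -
  interpret quotient_alg V T J by fact
  have "coset V J (f z) = coset V J (f x)" if "z \<in> coset W I x" "z \<in> supported_on S" for z
    using assms(3)[of "z - x"] that assms(4)
    by (simp add: cl_eq_iff mem_coset supported_on_diff alg_linear_diff[OF assms(2)])
  moreover have "x \<in> coset W I x" using assms(5) by (simp add: mem_coset)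
  ultimately show ?thesis
    using assms(4) unfolding induced_def coset_def[symmetric] by blast
qed

text \<open>This holds whether or not \<open>f\<close> respects the ideals, and is what can be said
  about \<pi> before its well-definedness is known.\<close>

lemma mem_induced: "x \<in> X \<Longrightarrow> x \<in> supported_on S \<Longrightarrow> y \<in> coset V J (f x) \<Longrightarrow> y \<in> induced S V J f X"
  by (auto simp: induced_def coset_def)

section \<open>The concrete quotients and the action of the maps on their classes\<close>

lemma quotient_alg_1: "generator_set N S \<Longrightarrow> quotient_alg (W1 N) (lists S) (I1 N)"
  by (intro quotient_alg.intro face_W closed_ideal_I1 face_submon face_lists lists_W1)

lemma quotient_alg_2: "generator_set N S \<Longrightarrow> quotient_alg (W2 N) (lists S \<times> W1 N) (I2 N)"
  using lists_W1[of N S]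
  by (intro quotient_alg.intro face_W closed_ideal_I2 face_submon face_Times face_lists)
    (auto simp: W2_def)

lemma quotient_alg_3: "quotient_alg (W3 N) (W3 N) (I3 N)"
  by (intro quotient_alg.intro face_W closed_ideal_I3 face_submon order_refl)

lemma U2_eq: "U2 N = restrict_carrier (free_alg (W2 N) Quot I2 N) (classes_on (W2 N) (I2 N) (W2 N))"
  by (simp add: U2_def restrict_carrier_def classes_on_def FactRing_def A_RCOSETS_defs a_r_coset_def)
    auto

lemma U3_eq: "U3 N = restrict_carrier (free_alg (W3 N) Quot I3 N) (classes_on (W3 N) (I3 N) (W3 N))"
  by (simp add: U3_def restrict_carrier_def classes_on_def FactRing_def A_RCOSETS_defs a_r_coset_def)
    auto

lemma quotient_alg_U2: "quotient_alg (W2 N) (W2 N) (I2 N)"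
  using quotient_alg_2[OF generator_set(3)] by (simp add: W1_def W2_def)

lemma coprod_coset: "x \<in> supported_on (W1 N) \<Longrightarrow> coprod N (coset (W1 N) (I1 N) x) = coset (W2 N) (I2 N) (coprod_free N x)"
  unfolding coprod_def using closed_ideal_I1[of N]
  by (intro induced_coset[OF quotient_alg_U2 hom_alg_linear[OF hom_coprod]]) (auto simp: coprod_I1_I2 closed_ideal_def)

lemma W2_eq: "W2 N = lists (aff_gens N) \<times> W1 N" and W3_eq: "W3 N = lists (aff_gens N) \<times> W2 N"
  by (simp_all add: W1_def W2_def W3_def)

lemma maps_supported:
  assumes "x \<in> supported_on (W2 N)"
  shows "L12 x \<in> supported_on (W3 N)" "L23 x \<in> supported_on (W3 N)"
    "D12 N x \<in> supported_on (W3 N)" "D23 N x \<in> supported_on (W3 N)"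
proof -
  have "x \<in> supported_on (lists (aff_gens N) \<times> W1 N)"
    using assms by (simp only: W2_eq)
  then show "L12 x \<in> supported_on (W3 N)" "L23 x \<in> supported_on (W3 N)"
    "D12 N x \<in> supported_on (W3 N)" "D23 N x \<in> supported_on (W3 N)"
    unfolding W3_eq by (rule L12_supported[OF generator_set(3)] L23_supported[OF generator_set(3)]
      D12_supported[OF generator_set(3)] D23_supported[OF generator_set(3)])+
qed

lemma
  assumes "x \<in> supported_on (W2 N)"
  shows leg12_coset: "leg12 N (coset (W2 N) (I2 N) x) = coset (W3 N) (I3 N) (L12 x)"
    and leg23_coset: "leg23 N (coset (W2 N) (I2 N) x) = coset (W3 N) (I3 N) (L23 x)"
    and coprod_id_coset: "coprod_id N (coset (W2 N) (I2 N) x) = coset (W3 N) (I3 N) (D12 N x)"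
    and id_coprod_coset: "id_coprod N (coset (W2 N) (I2 N) x) = coset (W3 N) (I3 N) (D23 N x)"
proof -
  have *: "induced (W2 N) (W3 N) (I3 N) f (coset (W2 N) (I2 N) x) = coset (W3 N) (I3 N) (f x)"
    if "alg_hom f" "\<And>x. x \<in> I2 N \<Longrightarrow> f x \<in> J3 N" "\<And>x. x \<in> supported_on (W2 N) \<Longrightarrow> f x \<in> supported_on (W3 N)" for f
    using closed_ideal_I2[of N]
    by (intro induced_coset[OF quotient_alg_3 hom_alg_linear[OF that(1)]] assms)
      (use that(2,3) I3_iff in \<open>auto simp: closed_ideal_def\<close>)
  show "leg12 N (coset (W2 N) (I2 N) x) = coset (W3 N) (I3 N) (L12 x)"
    unfolding leg12_def L12_def[symmetric] by (rule *[OF hom_L12 L12_I2 maps_supported(1)])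
  show "leg23 N (coset (W2 N) (I2 N) x) = coset (W3 N) (I3 N) (L23 x)"
    unfolding leg23_def L23_def[symmetric] by (rule *[OF hom_L23 L23_I2 maps_supported(2)])
  show "coprod_id N (coset (W2 N) (I2 N) x) = coset (W3 N) (I3 N) (D12 N x)"
    unfolding coprod_id_def D12_def[symmetric] by (rule *[OF hom_D12 D12_I2 maps_supported(3)])
  show "id_coprod N (coset (W2 N) (I2 N) x) = coset (W3 N) (I3 N) (D23 N x)"
    unfolding id_coprod_def D23_def[symmetric] by (rule *[OF hom_D23 D23_I2 maps_supported(4)])
qed

lemma class_tensor_coset:
  assumes "x \<in> supported_on (W1 N)" "y \<in> supported_on (W1 N)"
  shows "class_tensor N (coset (W1 N) (I1 N) x) (coset (W1 N) (I1 N) y) = coset (W2 N) (I2 N) (x \<boxtimes> y)"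
proof -
  interpret quotient_alg "W2 N" "W2 N" "I2 N" by (rule quotient_alg_U2)
  have I1: "0 \<in> I1 N" and sup: "z \<in> I1 N \<Longrightarrow> z \<in> supported_on (W1 N)" for z
    using closed_ideal_I1[of N] by (auto simp: closed_ideal_def)
  have "coset (W2 N) (I2 N) (x' \<boxtimes> y') = coset (W2 N) (I2 N) (x \<boxtimes> y)"
    if "x' \<in> coset (W1 N) (I1 N) x" "y' \<in> coset (W1 N) (I1 N) y" for x' y'
  proof -
    have xy: "x' - x \<in> I1 N" "y' - y \<in> I1 N" using that by (simp_all add: mem_coset)
    then have "x' \<in> supported_on (W1 N)" "y' \<in> supported_on (W1 N)"
      using supported_on_add[OF sup[OF xy(1)] assms(1)] supported_on_add[OF sup[OF xy(2)] assms(2)] by simp_all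
    then have "x' \<boxtimes> y' - x \<boxtimes> y \<in> supported_on (W2 N)"
      using assms unfolding W2_def by (intro supported_on_diff supported_on_tensor)
    moreover have "x' \<boxtimes> y' - x \<boxtimes> y \<in> J2 N"
      using cong_mod_tensor2[of N x' x y' y] xy by (simp add: cong_mod_def I_subset_J)
    ultimately show ?thesis by (simp add: cl_eq_iff J2_def ext_iff)
  qed
  moreover have "x \<in> coset (W1 N) (I1 N) x" "y \<in> coset (W1 N) (I1 N) y"
    using I1 by (simp_all add: mem_coset)
  ultimately show ?thesis
    unfolding class_tensor_def coset_def[symmetric] by blast
qed

theorem theorem4:
  fixes N :: nat
    and \<Psi> \<Psi>\<^sub>1 \<Psi>\<^sub>2 :: "alg2 set"
  assumes "N \<ge> 3"
    and "\<Psi> \<in> Units (U_cur_aff N)"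
    and "\<Psi>\<^sub>1 \<in> carrier (U_cur_aff N)"
    and "\<Psi> = \<Psi>\<^sub>1 \<otimes>\<^bsub>U2 N\<^esub> \<Psi>\<^sub>2"
    and "\<Psi>\<^sub>2 = proj_id N \<Psi>"
    and "is_twist N \<Psi>\<^sub>2"
    and "leg23 N \<Psi>\<^sub>1 \<otimes>\<^bsub>U3 N\<^esub> leg12 N \<Psi>\<^sub>2 = leg12 N \<Psi>\<^sub>2 \<otimes>\<^bsub>U3 N\<^esub> leg23 N \<Psi>\<^sub>1"
    and "proj_id_id N (coprod_id N \<Psi>\<^sub>1) = leg23 N \<Psi>\<^sub>1"
    and "\<exists>\<omega> \<in> Units (zeta_ring (U_cur N)). gauge N \<omega> \<Psi> \<in> carrier (zeta_ring (U_fin_aff N))"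
  shows "is_twist N \<Psi>"
proof -
  let ?c2 = "coset (W2 N) (I2 N)" and ?c3 = "coset (W3 N) (I3 N)"
  let ?cur2 = "lists (cur_gens N) \<times> W1 N" and ?fin2 = "lists (fin_gens N) \<times> W1 N"
  interpret C1: quotient_alg "W1 N" "lists (cur_gens N)" "I1 N" by (rule quotient_alg_1[OF generator_set(2)])
  interpret C2: quotient_alg "W2 N" ?cur2 "I2 N" by (rule quotient_alg_2[OF generator_set(2)])
  interpret F2: quotient_alg "W2 N" ?fin2 "I2 N" by (rule quotient_alg_2[OF generator_set(1)])
  interpret A2: quotient_alg "W2 N" "W2 N" "I2 N" by (rule quotient_alg_U2)
  interpret A3: quotient_alg "W3 N" "W3 N" "I3 N" by (rule quotient_alg_3)

  have \<Psi>C: "\<Psi> \<in> carrier (U_cur_aff N)" using assms(2) by (simp add: Units_def)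
  obtain p where p: "p \<in> supported_on ?cur2" "\<Psi> = ?c2 p"
    using \<Psi>C by (auto simp: U_cur_aff_def U2_def C2.Q_simps)
  obtain p1 where p1: "p1 \<in> supported_on ?cur2" "\<Psi>\<^sub>1 = ?c2 p1"
    using assms(3) by (auto simp: U_cur_aff_def U2_def C2.Q_simps)
  let ?p2 = "P2 p"
  have p2: "?p2 \<in> supported_on ?fin2" using p(1) by (rule P2_supported)
  have pW: "p \<in> supported_on (W2 N)" "p1 \<in> supported_on (W2 N)" "?p2 \<in> supported_on (W2 N)"
    by (rule C2.supp[OF p(1)] C2.supp[OF p1(1)] F2.supp[OF p2])+
  \<comment> \<open>Well-definedness of \<pi> \<otimes> id is bypassed:
    \<open>\<Psi>\<^sub>2\<close> contains \<open>P2 p\<close>, and as a twist it is a single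
    residue class, so it is the class of \<open>P2 p\<close>.\<close>
  have "p \<in> \<Psi>" using C2.I_0 by (simp add: p(2) mem_coset)
  then have "?p2 \<in> \<Psi>\<^sub>2"
    unfolding assms(5) proj_id_def P2_def[symmetric]
    by (rule mem_induced) (use p(1) C2.I_0 in \<open>simp_all add: mem_coset\<close>)
  moreover have "\<Psi>\<^sub>2 \<in> carrier (U2 N)" using assms(6) by (auto simp: is_twist_def Units_def)
  then obtain x2 where "\<Psi>\<^sub>2 = ?c2 x2" by (auto simp: U2_eq A2.Q_simps)
  ultimately have \<Psi>2: "\<Psi>\<^sub>2 = ?c2 ?p2" using C2.cl_eq_iff by (simp add: mem_coset) (metis C2.cl_eq_iff)

  note legs = leg12_coset leg23_coset coprod_id_coset id_coprod_coset
  note sup = maps_supported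
  have m3: "?c3 x \<otimes>\<^bsub>U3 N\<^esub> ?c3 y = ?c3 (x * y)" if "x \<in> supported_on (W3 N)" "y \<in> supported_on (W3 N)" for x y
    unfolding U3_eq using that by (rule A3.Q_mult)

  have h1: "p - p1 * ?p2 \<in> I2 N"
    using assms(4) unfolding U2_eq by (simp add: p p1 \<Psi>2 A2.Q_mult pW C2.cl_eq_iff)
  have h2: "L12 ?p2 * D12 N ?p2 - L23 ?p2 * D23 N ?p2 \<in> I3 N"
    using assms(6) unfolding is_twist_def \<Psi>2 by (simp add: legs pW m3 sup A3.cl_eq_iff)
  have h3: "L23 p1 * L12 ?p2 - L12 ?p2 * L23 p1 \<in> I3 N"
    using assms(7) unfolding \<Psi>2 p1 by (simp add: legs pW m3 sup A3.cl_eq_iff)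
  \<comment> \<open>All of \<open>D12 N p1 + y\<close> represent the same class, so their
    projections all lie in \<open>proj_id_id N (coprod_id N \<Psi>\<^sub>1)\<close>, which by
    hypothesis is the one class of \<open>L23 p1\<close>. Comparing a general \<open>y\<close> with
    \<open>y = 0\<close> gives the well-definedness \<open>h4\<close>.\<close>
  have P3_mem: "P3 (D12 N p1 + y) - L23 p1 \<in> I3 N"
    if "y \<in> I3 N" "y \<in> supported_on (lists (cur_gens N) \<times> W2 N)" for y
  proof -
    have "P3 (D12 N p1 + y) \<in> proj_id_id N (coprod_id N \<Psi>\<^sub>1)"
      unfolding proj_id_id_def P3_def[symmetric] p1(2) coprod_id_coset[OF pW(2)]
      by (rule mem_induced[where x = "D12 N p1 + y"])
        (use that A3.I_0 D12_supported[OF generator_set(2) p1(1)] in \<open>auto simp: mem_coset\<close>)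
    moreover have "proj_id_id N (coprod_id N \<Psi>\<^sub>1) = ?c3 (L23 p1)"
      unfolding assms(8) by (simp only: p1(2) leg23_coset[OF pW(2)])
    ultimately show ?thesis by (simp add: mem_coset)
  qed
  have proj: "P3 (D12 N p1) - L23 p1 \<in> I3 N"
    using P3_mem[of 0] A3.I_0 by simp
  have h4: "P3 y \<in> I3 N" if "y \<in> I3 N" "y \<in> supported_on (lists (cur_gens N) \<times> W2 N)" for y
    using A3.I_diff[OF P3_mem[OF that] proj] by (simp add: hom_simps hom_P3)
  obtain \<omega> where \<omega>: "\<omega> \<in> Units (zeta_ring (U_cur N))" "gauge N \<omega> \<Psi> \<in> carrier (zeta_ring (U_fin_aff N))"
    using assms(9) by blast
  obtain w w' where w: "w \<in> zset (supported_on (lists (cur_gens N)))" "w' \<in> zset (supported_on (lists (cur_gens N)))"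
    "\<omega> = C1.zcl w" "inv\<^bsub>zeta_ring (U_cur N)\<^esub> \<omega> = C1.zcl w'" "w' * w - 1 \<in> zset (I1 N)"
    using C1.zeta_unit[of \<omega>] \<omega>(1) unfolding U_cur_def U1_def by metis
  let ?E1 = "zmap (\<lambda>x :: alg1. x \<boxtimes> (1 :: alg1)) w" and ?E2 = "zmap (\<lambda>x :: alg1. (1 :: alg1) \<boxtimes> x) w"
  let ?D = "zmap (coprod_free N) w'"
  obtain g where g: "g \<in> zset (supported_on ?fin2)" "gauge N \<omega> \<Psi> = F2.zcl g"
    using \<omega>(2) by (auto simp: U_fin_aff_def U2_def F2.zeta_carrier)
  have W1: "fps_nth w n \<in> supported_on (W1 N)" "fps_nth w' n \<in> supported_on (W1 N)" for n
    using w(1,2) C1.supp by (auto simp: zset_def)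
  have one: "(1 :: alg1) \<in> supported_on (W1 N)"
    by (simp add: supported_on_1 face_submon face_W)
  have E: "?E1 \<in> zset (supported_on (W2 N))" "?E2 \<in> zset (supported_on (W2 N))"
    using W1 one by (auto simp: zset_def W2_def intro!: supported_on_tensor)
  have D: "?D \<in> zset (supported_on (W2 N))"
    using W1 coprod_supported[OF generator_set(3)] by (auto simp: zset_def W1_def W2_def)
  \<comment> \<open>\<omega> \<otimes> \<omega> is written as a product of two series in \<zeta>,
    one for each leg; the Cauchy product reproduces the sum in \<open>zeta_tensor\<close>.\<close>
  have tens: "zeta_tensor N \<omega> \<omega> = A2.zcl (?E1 * ?E2)"
  proof
    fix n
    have "zeta_tensor N \<omega> \<omega> n = (\<Oplus>\<^bsub>U2 N\<^esub>k\<in>{..n}. ?c2 (fps_nth w k \<boxtimes> fps_nth w (n - k)))"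
      by (simp add: zeta_tensor_def w(3) C1.zcl_def class_tensor_coset W1)
    also have "\<dots> = ?c2 (\<Sum>k\<le>n. fps_nth w k \<boxtimes> fps_nth w (n - k))"
      unfolding U2_eq by (rule A2.finsum_Q) (use W1 in \<open>auto simp: W2_def intro!: supported_on_tensor\<close>)
    also have "\<dots> = A2.zcl (?E1 * ?E2) n"
      by (simp add: A2.zcl_def fps_mult_nth atLeast0AtMost flip: tensor_eq_mult)
    finally show "zeta_tensor N \<omega> \<omega> n = A2.zcl (?E1 * ?E2) n" .
  qed
  have const: "zeta_const (U2 N) \<Psi> = A2.zcl (fps_const p)"
    by (simp add: zeta_const_def fun_eq_iff A2.zcl_def p U2_eq A2.Q_simps)
  have cop: "zeta_coprod N (inv\<^bsub>zeta_ring (U_cur N)\<^esub> \<omega>) = A2.zcl ?D"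
    by (simp add: zeta_coprod_def w(4) C1.zcl_def A2.zcl_def coprod_coset W1)
  have sm: "submon (W2 N)" by (intro face_submon face_W)
  have "gauge N \<omega> \<Psi> = A2.zcl (?E1 * ?E2 * fps_const p * ?D)"
    unfolding gauge_def tens const cop unfolding U2_eq
    by (simp add: A2.zeta_mult zset_mult[OF sm] E D zset_const pW)
  then have "A2.zcl g = A2.zcl (?E1 * ?E2 * fps_const p * ?D)"
    using g(2) by (simp add: F2.zcl_def A2.zcl_def)
  then have h5: "g - ?E1 * ?E2 * fps_const p * ?D \<in> zset (I2 N)"
    by (simp only: A2.zcl_eq_iff)
  have "L12 p * D12 N p - L23 p * D23 N p \<in> I3 N"
    by (rule cocycle_representative[OF p(1) p1(1) h1 h2 h3 proj h4 w(1,2,5) g(1) h5])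
  then have "leg12 N \<Psi> \<otimes>\<^bsub>U3 N\<^esub> coprod_id N \<Psi> = leg23 N \<Psi> \<otimes>\<^bsub>U3 N\<^esub> id_coprod N \<Psi>"
    unfolding p by (simp add: legs pW m3 sup A3.cl_eq_iff)
  \<comment> \<open>The subalgebra has the same unit element and multiplication as
    \<open>U2 N\<close>, so an inverse in it is an inverse there.\<close>
  moreover have "\<Psi> \<in> Units (U2 N)"
  proof -
    have "carrier (U_cur_aff N) = ?c2 ` supported_on ?cur2"
      unfolding U_cur_aff_def U2_def by (rule C2.Q_simps(1))
    moreover have "carrier (U2 N) = ?c2 ` supported_on (W2 N)"
      unfolding U2_eq by (rule A2.Q_simps(1))
    ultimately have "carrier (U_cur_aff N) \<subseteq> carrier (U2 N)"
      using C2.supp by blast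
    moreover have "one (U_cur_aff N) = one (U2 N)" "monoid.mult (U_cur_aff N) = monoid.mult (U2 N)"
      by (simp_all add: U_cur_aff_def restrict_carrier_def)
    ultimately show ?thesis using assms(2) by (auto simp: Units_def)
  qed
  ultimately show ?thesis by (simp add: is_twist_def)
qed

end
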